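(* There exists a compact set $E\subset\mathbb{R}$ of positive Lebesgue measure with the following properties: (i) If $\mu\in M(E)$ is nontrivial (nonzero), then $$\int_{\mathbb{R}}|\widehat{\mu}(\xi)|^q\,d\xi=\infty\qquad\text{for all }0<q<2.$$ (ii) There exists a nontrivial $\nu\in M(E)$ such that for every $A>0$ there is $C(A)>0$ with $$|\widehat{\nu}(\xi)|\le C(A)\,\xi^{-A},\qquad \xi>0.$$
   Context: For a compact set $E\subset\mathbb{R}$, $M(E)$ is the set of complex finite Borel measures on $\mathbb{R}$ supported in $E$. The Fourier transform is $\widehat{\mu}(\xi)=\int_{\mathbb{R}}e^{-ix\xi}\,d\mu(x)$, $\xi\in\mathbb{R}$. *)

theory Defs
  imports "HOL-Analysis.Analysis"
begin

text \<open>
  A complex Borel measure on the line is a countably additive complex-valued set function on the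
  Borel sets. Finiteness is automatic, and so is \<open>\<mu> {} = 0\<close> (take all \<open>A i\<close> empty). The values
  of \<open>\<mu>\<close> outside the Borel sets are irrelevant and never inspected.
\<close>

definition complex_borel_measure :: "(real set \<Rightarrow> complex) \<Rightarrow> bool" where
  "complex_borel_measure \<mu> \<longleftrightarrow>
     (\<forall>A :: nat \<Rightarrow> real set. range A \<subseteq> sets borel \<longrightarrow> disjoint_family A \<longrightarrow>
        (\<lambda>i. \<mu> (A i)) sums \<mu> (\<Union>i. A i))"

definition nontrivial_measure :: "(real set \<Rightarrow> complex) \<Rightarrow> bool" where
  "nontrivial_measure \<mu> \<longleftrightarrow> (\<exists>A \<in> sets borel. \<mu> A \<noteq> 0)"

text \<open>
  For closed \<open>E\<close>, the vanishing condition says exactly that the topological support of \<open>\<mu>\<close> is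
  contained in \<open>E\<close>.
\<close>

definition measures_on :: "real set \<Rightarrow> (real set \<Rightarrow> complex) set" where
  "measures_on E = {\<mu>. complex_borel_measure \<mu> \<and>
     (\<forall>A \<in> sets borel. A \<inter> E = {} \<longrightarrow> \<mu> A = 0)}"

text \<open>
  The positive variation \<open>\<nu>\<^sup>+(A) = sup {\<nu>(B) | B \<subseteq> A Borel}\<close> of a real-valued countably additive
  \<open>\<nu>\<close>; the negative variation is the positive variation of \<open>-\<nu>\<close>, and \<open>\<nu> = \<nu>\<^sup>+ - \<nu>\<^sup>-\<close> is the
  Jordan decomposition. Truncation of negative values by \<open>ennreal\<close> is harmless, because \<open>B = {}\<close>
  already contributes the value 0 to the supremum.
\<close>

definition pos_variation :: "(real set \<Rightarrow> real) \<Rightarrow> real measure" where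
  "pos_variation \<nu> = measure_of UNIV (sets borel)
     (\<lambda>A. SUP B \<in> {B \<in> sets borel. B \<subseteq> A}. ennreal (\<nu> B))"

definition signed_integral :: "(real set \<Rightarrow> real) \<Rightarrow> (real \<Rightarrow> complex) \<Rightarrow> complex" where
  "signed_integral \<nu> f =
     integral\<^sup>L (pos_variation \<nu>) f - integral\<^sup>L (pos_variation (\<lambda>A. - \<nu> A)) f"

definition complex_measure_integral :: "(real set \<Rightarrow> complex) \<Rightarrow> (real \<Rightarrow> complex) \<Rightarrow> complex" where
  "complex_measure_integral \<mu> f =
     signed_integral (\<lambda>A. Re (\<mu> A)) f + \<i> * signed_integral (\<lambda>A. Im (\<mu> A)) f"

definition fourier_transform :: "(real set \<Rightarrow> complex) \<Rightarrow> real \<Rightarrow> complex" where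
  "fourier_transform \<mu> \<xi> =
     complex_measure_integral \<mu> (\<lambda>x. exp (- \<i> * complex_of_real (x * \<xi>)))"

end

theory Submission
  imports Defs "HOL-Probability.Probability" "HOL-Complex_Analysis.Complex_Analysis"
    "HOL-Real_Asymp.Real_Asymp"
begin

text \<open>
  The set is obtained from \<open>[-1, 1]\<close> by a sieve. At scale \<open>k\<close> there are \<open>M = 2^(k^2)\<close> dilations
  \<open>N = 2^(12 k^2) + j\<close>, and for each of them all points \<open>x\<close> are removed for which \<open>N x\<close> lies closer
  than \<open>\<delta> = 2^(-k^2 - 3 k)\<close> to \<open>2 \<pi> \<int>\<close>; the scales run over all \<open>k \<ge> k0\<close> for a large \<open>k0\<close>.

  No nonzero measure on this set has a Fourier transform in \<open>L^q\<close>, \<open>q < 2\<close>. Let \<open>H\<close> be a trigonometric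
  polynomial concentrated within \<open>\<delta>\<close> of \<open>2 \<pi> \<int>\<close>, with constant coefficient 1, all coefficients at most 1
  and degree not much larger than \<open>1 / \<delta>\<close>
  (\<open>concentrated_trig_polynomial\<close>). On the sieved set every \<open>H(N x)\<close> is tiny, hence so is the average
  \<open>G\<close> of the \<open>M\<close> functions \<open>H(N x)\<close>. The frequencies of different summands do not collide, so \<open>G\<close> still has
  constant coefficient 1, but the others have size at most \<open>1 / M\<close> and there are about \<open>M / \<delta>\<close>, that is
  \<open>M^2\<close> up to factors \<open>2^(O(k))\<close>, of them: they tend to 0 in \<open>\<ell>^p\<close> for every \<open>p > 2\<close>. Testing
  \<open>\<mu>\<close> against \<open>G(x) e^(-i t x)\<close> therefore bounds \<open>|\<mu>^(t)|\<close> by a vanishing constant plus a vanishing multiple of the sum of \<open>|\<mu>^|^q\<close> over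
  distinct integer translates of \<open>t\<close>. Integrated over a unit interval, that sum is at most the full
  integral of \<open>|\<mu>^|^q\<close>; if this is finite, it follows that \<open>\<mu>^ = 0\<close>, hence \<open>\<mu> = 0\<close>
  (\<open>fourier_transform_eq_0_criterion\<close>).

  A measure with rapid one-sided decay comes from an infinite product. The function
  \<open>\<gamma>(z) = exp(-\<kappa> / sqrt((1 - e^(i \<delta>) z)(1 - e^(-i \<delta>) z)))\<close> is analytic in the disc, bounded by 1, has
  \<open>\<gamma>(0) = e^(-\<kappa>)\<close>, and on the arc \<open>|arg z| < \<delta>\<close> it has size at most \<open>exp(-\<kappa> / (5 \<delta>))\<close> and vanishes to
  infinite order at both endpoints. Cutting \<open>\<gamma>\<close> off to zero on that arc yields a factor
  \<open>\<psi>(x) = \<gamma>(e^(-i N x)) - s(N x)\<close> which vanishes on the removed set, where \<open>s\<close> is smooth and extremely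
  small. Multiplication by a bounded analytic function of \<open>e^(-i x)\<close> creates only lower frequencies
  and so preserves bounds for positive frequencies; multiplication by \<open>s(N x)\<close> multiplies such a bound by a
  weighted \<open>\<ell>^1\<close> norm of the Fourier coefficients of \<open>s\<close> (\<open>controlled_mult_arc_cutoff\<close>). These
  norms are summable over all factors, because \<open>\<kappa> / \<delta> = 2^k\<close> beats every multiple of
  \<open>log N\<close>, which is of order \<open>k^2\<close>. At the same time \<open>M \<kappa> = 4^(-k)\<close> is summable, and by the mean value
  property this forces the product over a scale to be close to 1 in \<open>L^1\<close>; so the
  infinite product converges almost everywhere to a nonzero function (\<open>product_density_not_AE_0\<close>). This
  function times a fixed window is the density of the desired measure, and since it lives on the sieved
  set, that set has positive Lebesgue measure.

  Both halves fit together because \<open>M \<delta> = 2^(-3 k)\<close> is small compared with \<open>M \<kappa>\<close>, which the product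
  needs, but decays slower than every negative power of \<open>M\<close>, which the first argument needs for \<open>q\<close> close to 2.
\<close>

section \<open>Characters and Fourier integrals\<close>

definition character :: "real \<Rightarrow> real \<Rightarrow> complex" where
  "character \<xi> x = exp (- \<i> * complex_of_real (x * \<xi>))"

lemma norm_character [simp]: "norm (character \<xi> x) = 1"
  by (simp add: character_def)

lemma character_measurable [measurable]: "character \<xi> \<in> borel_measurable borel"
  unfolding character_def by measurable

lemma character_add: "character (\<xi> + \<eta>) x = character \<xi> x * character \<eta> x"
  by (simp add: character_def distrib_left exp_add algebra_simps flip: exp_add)

lemma character_eq_cis: "character \<xi> x = cis (- (\<xi> * x))"
  by (simp add: character_def cis_conv_exp mult.commute)

definition fourier_of :: "(real \<Rightarrow> complex) \<Rightarrow> real \<Rightarrow> complex" where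
  "fourier_of v \<xi> = (\<integral>x. v x * character \<xi> x \<partial>lborel)"

lemma fourier_transform_character: "fourier_transform \<mu> \<xi> = complex_measure_integral \<mu> (character \<xi>)"
  by (simp add: fourier_transform_def character_def[abs_def])

section \<open>Jordan decomposition of a signed Borel measure\<close>

definition signed_measure :: "(real set \<Rightarrow> real) \<Rightarrow> bool" where
  "signed_measure \<nu> \<longleftrightarrow>
     (\<forall>A :: nat \<Rightarrow> real set. range A \<subseteq> sets borel \<longrightarrow> disjoint_family A \<longrightarrow>
        (\<lambda>i. \<nu> (A i)) sums \<nu> (\<Union>i. A i))"

lemma signed_measureD:
  assumes "signed_measure \<nu>" "\<And>i::nat. A i \<in> sets borel" "disjoint_family A"
  shows "(\<lambda>i. \<nu> (A i)) sums \<nu> (\<Union>i. A i)"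
  using assms by (auto simp: signed_measure_def)

lemma signed_measure_empty:
  assumes "signed_measure \<nu>" shows "\<nu> {} = 0"
proof -
  have "(\<lambda>i::nat. \<nu> {}) sums \<nu> (\<Union>i::nat. {})"
    using assms by (rule signed_measureD) (auto simp: disjoint_family_on_def)
  then have "(\<lambda>i::nat. \<nu> {}) \<longlonglongrightarrow> 0"
    using summable_LIMSEQ_zero sums_summable by blast
  then show ?thesis by (simp add: LIMSEQ_const_iff)
qed

lemma signed_measure_Un:
  assumes "signed_measure \<nu>" "A \<in> sets borel" "B \<in> sets borel" "A \<inter> B = {}"
  shows "\<nu> (A \<union> B) = \<nu> A + \<nu> B"
proof -
  have "(\<lambda>i. \<nu> (binaryset A B i)) sums \<nu> (\<Union>i. binaryset A B i)"
    using assms by (intro signed_measureD) (auto simp: binaryset_def disjoint_family_on_def)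
  moreover have "(\<lambda>i. \<nu> (binaryset A B i)) sums (\<nu> A + \<nu> B)"
    by (rule binaryset_sums) (rule signed_measure_empty[OF assms(1)])
  ultimately show ?thesis
    by (simp add: UN_binaryset_eq sums_unique2)
qed

lemma signed_measure_Diff:
  assumes "signed_measure \<nu>" "A \<in> sets borel" "B \<in> sets borel" "B \<subseteq> A"
  shows "\<nu> (A - B) = \<nu> A - \<nu> B"
  using signed_measure_Un[OF assms(1), of B "A - B"] assms
  by (auto simp: Un_absorb1)

lemma signed_measure_minus: "signed_measure \<nu> \<Longrightarrow> signed_measure (\<lambda>A. - \<nu> A)"
  by (auto simp: signed_measure_def intro!: sums_minus)

text \<open>
  If the values on subsets of a set are unbounded, the set splits into two pieces one of which is again
  such a set while the other carries mass at least 1; iterating this yields infinitely many disjoint sets of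
  mass at least 1, against countable additivity.
\<close>

lemma signed_measure_bounded:
  assumes "signed_measure \<nu>"
  shows "\<exists>C. \<forall>B\<in>sets borel. \<bar>\<nu> B\<bar> \<le> C"
proof (rule ccontr)
  define unb where "unb X \<longleftrightarrow> X \<in> sets borel \<and> (\<forall>C. \<exists>B\<in>sets borel. B \<subseteq> X \<and> \<bar>\<nu> B\<bar> > C)" for X
  assume "\<not> ?thesis"
  then have start: "unb UNIV" by (auto simp: unb_def not_le)
  have step: "\<exists>Y. unb Y \<and> Y \<subseteq> X \<and> \<bar>\<nu> (X - Y)\<bar> \<ge> 1" if X: "unb X" for X
  proof -
    obtain B where B: "B \<in> sets borel" "B \<subseteq> X" "\<bar>\<nu> B\<bar> > \<bar>\<nu> X\<bar> + 1"
      using X by (auto simp: unb_def)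
    have Xb: "X \<in> sets borel" using X by (simp add: unb_def)
    have 1: "\<bar>\<nu> (X - B)\<bar> \<ge> 1"
      using signed_measure_Diff[OF assms Xb B(1,2)] B(3) by linarith
    have 2: "\<bar>\<nu> (X - (X - B))\<bar> \<ge> 1"
      using B by (simp add: double_diff)
    have "unb B \<or> unb (X - B)"
    proof (rule ccontr)
      assume "\<not> ?thesis"
      then have "\<not> unb B" "\<not> unb (X - B)" by auto
      moreover have "X - B \<in> sets borel" using B Xb by auto
      ultimately have "\<exists>C. \<forall>D\<in>sets borel. D \<subseteq> B \<longrightarrow> \<bar>\<nu> D\<bar> \<le> C"
        "\<exists>C. \<forall>D\<in>sets borel. D \<subseteq> X - B \<longrightarrow> \<bar>\<nu> D\<bar> \<le> C"
        using B(1) unfolding unb_def by (meson not_less)+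
      then obtain C1 C2 where
        C: "\<And>D. D \<in> sets borel \<Longrightarrow> D \<subseteq> B \<Longrightarrow> \<bar>\<nu> D\<bar> \<le> C1"
           "\<And>D. D \<in> sets borel \<Longrightarrow> D \<subseteq> X - B \<Longrightarrow> \<bar>\<nu> D\<bar> \<le> C2"
        by metis
      obtain D where D: "D \<in> sets borel" "D \<subseteq> X" "\<bar>\<nu> D\<bar> > C1 + C2"
        using X by (auto simp: unb_def)
      have "\<nu> ((D \<inter> B) \<union> (D - B)) = \<nu> (D \<inter> B) + \<nu> (D - B)"
        using D B by (intro signed_measure_Un[OF assms]) auto
      then have "\<nu> D = \<nu> (D \<inter> B) + \<nu> (D - B)"
        by (simp add: Int_Diff_Un)
      moreover have "\<bar>\<nu> (D \<inter> B)\<bar> \<le> C1" using D B by (intro C) auto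
      moreover have "\<bar>\<nu> (D - B)\<bar> \<le> C2" using D B by (intro C) auto
      ultimately show False using D(3) by linarith
    qed
    then show ?thesis using 1 2 B(2) by blast
  qed
  have "\<exists>Y. \<forall>n. unb (Y n) \<and> (Y (Suc n) \<subseteq> Y n \<and> \<bar>\<nu> (Y n - Y (Suc n))\<bar> \<ge> 1)"
    using dependent_nat_choice[of "\<lambda>_. unb" "\<lambda>_ X Y. Y \<subseteq> X \<and> \<bar>\<nu> (X - Y)\<bar> \<ge> 1"] start step
    by blast
  then obtain Y where Y: "\<And>n::nat. unb (Y n)" "\<And>n. Y (Suc n) \<subseteq> Y n"
    "\<And>n. \<bar>\<nu> (Y n - Y (Suc n))\<bar> \<ge> 1" by blast
  have Yb: "Y n \<in> sets borel" for n using Y(1)[of n] by (simp add: unb_def)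
  have dec: "Y n \<subseteq> Y m" if "m \<le> n" for m n
    using lift_Suc_antimono_le[of Y, OF Y(2) that] .
  have "disjoint_family (\<lambda>n. Y n - Y (Suc n))"
  proof (unfold disjoint_family_on_def, intro ballI impI)
    fix m n :: nat assume "m \<noteq> n"
    then consider "Suc m \<le> n" | "Suc n \<le> m" by linarith
    then show "(Y m - Y (Suc m)) \<inter> (Y n - Y (Suc n)) = {}"
      by cases (use dec in blast)+
  qed
  then have "(\<lambda>n. \<nu> (Y n - Y (Suc n))) sums \<nu> (\<Union>n. Y n - Y (Suc n))"
    using Yb by (intro signed_measureD[OF assms]) auto
  then have "(\<lambda>n. \<nu> (Y n - Y (Suc n))) \<longlonglongrightarrow> 0"
    using summable_LIMSEQ_zero sums_summable by blast
  then have "\<forall>\<^sub>F n in sequentially. \<bar>\<nu> (Y n - Y (Suc n))\<bar> < 1"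
    by (auto dest!: tendstoD[of _ 0 sequentially 1] simp: dist_real_def)
  then obtain n where "\<bar>\<nu> (Y n - Y (Suc n))\<bar> < 1"
    by (auto simp: eventually_sequentially)
  then show False using Y(3)[of n] by linarith
qed

lemma ennreal_add_le: "ennreal (x + y) \<le> ennreal x + ennreal y"
proof -
  have "ennreal (x + y) \<le> ennreal (max 0 x + max 0 y)" by (intro ennreal_leI) auto
  also have "\<dots> = ennreal x + ennreal y"
    by (subst ennreal_plus) (auto simp: max_def ennreal_neg)
  finally show ?thesis .
qed

text \<open>
  Negative terms are truncated to 0 on the right, so only an inequality can hold.
\<close>

lemma ennreal_sums_le:
  assumes "x sums s"
  shows "ennreal s \<le> (\<Sum>i. ennreal (x i))"
proof (rule LIMSEQ_le_const2)
  show "(\<lambda>n. ennreal (\<Sum>i<n. x i)) \<longlonglongrightarrow> ennreal s"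
    using assms unfolding sums_def by (rule tendsto_ennrealI)
  have fin: "ennreal (\<Sum>i<n. x i) \<le> (\<Sum>i<n. ennreal (x i))" for n
    by (induction n) (auto intro: order_trans[OF ennreal_add_le] add_right_mono)
  show "\<exists>N. \<forall>n\<ge>N. ennreal (\<Sum>i<n. x i) \<le> (\<Sum>i. ennreal (x i))"
    by (intro exI allI impI order_trans[OF fin] sum_le_suminf) auto
qed

text \<open>
  The supremum is superadditive because subsets of two disjoint sets can be united, and countably
  subadditive because a subset of a disjoint union splits into its traces.
\<close>

lemma pos_variation_measure_space:
  assumes nu: "signed_measure \<nu>"
  shows "measure_space UNIV (sets borel) (\<lambda>A. SUP B \<in> {B \<in> sets borel. B \<subseteq> A}. ennreal (\<nu> B))"
    (is "measure_space _ _ ?p")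
proof -
  have up: "ennreal (\<nu> B) \<le> ?p A" if "B \<in> sets borel" "B \<subseteq> A" for A B
    using that by (intro SUP_upper) auto
  have mono: "?p A \<le> ?p B" if "A \<subseteq> B" for A B
    using that by (intro SUP_subset_mono) auto
  have add: "?p A + ?p B \<le> ?p (A \<union> B)" if AB: "A \<inter> B = {}" for A B
  proof -
    have "ennreal (\<nu> C) + ennreal (\<nu> D) \<le> ?p (A \<union> B)"
      if C: "C \<in> sets borel" "C \<subseteq> A" and D: "D \<in> sets borel" "D \<subseteq> B" for C D
    proof (cases "\<nu> C < 0 \<or> \<nu> D < 0")
      case True
      then have "ennreal (\<nu> C) + ennreal (\<nu> D) = ennreal (\<nu> D) \<or>
          ennreal (\<nu> C) + ennreal (\<nu> D) = ennreal (\<nu> C)"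
        by (auto simp: ennreal_neg)
      moreover have "ennreal (\<nu> C) \<le> ?p (A \<union> B)" "ennreal (\<nu> D) \<le> ?p (A \<union> B)"
        using C D by (auto intro!: up)
      ultimately show ?thesis by metis
    next
      case False
      have disj: "C \<inter> D = {}" using C D AB by blast
      have "ennreal (\<nu> C) + ennreal (\<nu> D) = ennreal (\<nu> (C \<union> D))"
        using False signed_measure_Un[OF nu C(1) D(1) disj] by simp
      also have "\<dots> \<le> ?p (A \<union> B)" using C D by (intro up) auto
      finally show ?thesis .
    qed
    then have 1: "ennreal (\<nu> C) + ?p B \<le> ?p (A \<union> B)" if C: "C \<in> sets borel" "C \<subseteq> A" for C
      using C by (subst ennreal_SUP_add_right) (auto intro!: SUP_least)
    have "?p A + ?p B = (SUP C \<in> {C \<in> sets borel. C \<subseteq> A}. ennreal (\<nu> C) + ?p B)"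
      by (rule ennreal_SUP_add_left[symmetric]) auto
    also have "\<dots> \<le> ?p (A \<union> B)" using 1 by (intro SUP_least) auto
    finally show ?thesis .
  qed
  have "countably_additive (sets borel) ?p"
  proof (rule countably_additiveI)
    fix A :: "nat \<Rightarrow> real set"
    assume A: "range A \<subseteq> sets borel" "disjoint_family A" "(\<Union>i. A i) \<in> sets borel"
    show "(\<Sum>i. ?p (A i)) = ?p (\<Union>i. A i)"
    proof (rule antisym)
      have fin: "(\<Sum>i<n. ?p (A i)) \<le> ?p (\<Union>i<n. A i)" for n
      proof (induction n)
        case 0
        show ?case by simp
      next
        case (Suc n)
        have "(\<Sum>i<Suc n. ?p (A i)) \<le> ?p (\<Union>i<n. A i) + ?p (A n)"
          using Suc by (simp add: add_right_mono)
        also have "\<dots> \<le> ?p ((\<Union>i<n. A i) \<union> A n)"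
        proof (rule add)
          have "A i \<inter> A n = {}" if "i < n" for i
            using A(2) that unfolding disjoint_family_on_def by (metis UNIV_I less_irrefl)
          then show "(\<Union>i<n. A i) \<inter> A n = {}" by blast
        qed
        also have "(\<Union>i<n. A i) \<union> A n = (\<Union>i<Suc n. A i)"
          by (auto simp: less_Suc_eq)
        finally show ?case .
      qed
      show "(\<Sum>i. ?p (A i)) \<le> ?p (\<Union>i. A i)"
      proof (rule suminf_le_const)
        show "(\<Sum>i<n. ?p (A i)) \<le> ?p (\<Union>i. A i)" for n
          by (rule order_trans[OF fin mono]) auto
      qed auto
      show "?p (\<Union>i. A i) \<le> (\<Sum>i. ?p (A i))"
      proof (rule SUP_least)
        fix B assume B: "B \<in> {B \<in> sets borel. B \<subseteq> \<Union> (range A)}"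
        have "(\<lambda>i. \<nu> (B \<inter> A i)) sums \<nu> (\<Union>i. B \<inter> A i)"
          using A B by (intro signed_measureD[OF nu]) (auto simp: disjoint_family_on_def)
        moreover have "(\<Union>i. B \<inter> A i) = B" using B by auto
        ultimately have "ennreal (\<nu> B) \<le> (\<Sum>i. ennreal (\<nu> (B \<inter> A i)))"
          by (intro ennreal_sums_le) simp
        also have "\<dots> \<le> (\<Sum>i. ?p (A i))"
          using A B by (intro suminf_le up) auto
        finally show "ennreal (\<nu> B) \<le> (\<Sum>i. ?p (A i))" .
      qed
    qed
  qed
  moreover have "positive (sets borel) ?p"
    using signed_measure_empty[OF nu] by (auto simp: positive_def)
  ultimately show ?thesis
    using sets.sigma_algebra_axioms[of "borel :: real measure"] by (simp add: measure_space_def)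
qed

lemma sets_pos_variation [simp, measurable_cong]: "sets (pos_variation \<nu>) = sets borel"
  using sets.sigma_sets_eq[of "borel :: real measure"]
  by (simp add: pos_variation_def sets_measure_of_conv)

lemma space_pos_variation [simp]: "space (pos_variation \<nu>) = UNIV"
  by (simp add: pos_variation_def space_measure_of_conv)

lemma emeasure_pos_variation:
  assumes "signed_measure \<nu>" "A \<in> sets borel"
  shows "emeasure (pos_variation \<nu>) A = (SUP B \<in> {B \<in> sets borel. B \<subseteq> A}. ennreal (\<nu> B))"
  using pos_variation_measure_space[OF assms(1)] assms(2)
  by (intro emeasure_measure_of[OF pos_variation_def])
     (auto simp: measure_space_def)

lemma finite_measure_pos_variation:
  assumes "signed_measure \<nu>"
  shows "finite_measure (pos_variation \<nu>)"
proof
  obtain C where C: "\<And>B. B \<in> sets borel \<Longrightarrow> \<bar>\<nu> B\<bar> \<le> C"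
    using signed_measure_bounded[OF assms] by blast
  have ub: "(UNIV :: real set) \<in> sets borel" by simp
  have "emeasure (pos_variation \<nu>) UNIV \<le> ennreal C"
    unfolding emeasure_pos_variation[OF assms ub]
  proof (rule SUP_least)
    fix B assume "B \<in> {B \<in> sets borel. B \<subseteq> (UNIV :: real set)}"
    then show "ennreal (\<nu> B) \<le> ennreal C"
      using C[of B] by (intro ennreal_leI) auto
  qed
  then show "emeasure (pos_variation \<nu>) (space (pos_variation \<nu>)) \<noteq> \<infinity>"
    by (auto simp: top_unique)
qed

text \<open>
  For \<open>B \<subseteq> A\<close> one has \<open>\<nu> B = \<nu> A + (- \<nu>) (A - B)\<close>; taking suprema over \<open>B\<close> bounds the positive variation by
  \<open>\<nu> A\<close> plus the negative one, and the reverse bound is the same statement for \<open>- \<nu>\<close>.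
\<close>

lemma Jordan_decomposition:
  assumes nu: "signed_measure \<nu>" and A: "A \<in> sets borel"
  shows "\<nu> A = measure (pos_variation \<nu>) A - measure (pos_variation (\<lambda>A. - \<nu> A)) A"
proof -
  have le: "measure (pos_variation \<mu>) A \<le> \<mu> A + measure (pos_variation (\<lambda>A. - \<mu> A)) A"
    if mu: "signed_measure \<mu>" for \<mu>
  proof -
    note mu' = signed_measure_minus[OF mu]
    interpret P: finite_measure "pos_variation \<mu>" by (rule finite_measure_pos_variation[OF mu])
    interpret N: finite_measure "pos_variation (\<lambda>A. - \<mu> A)"
      by (rule finite_measure_pos_variation[OF mu'])
    let ?n = "measure (pos_variation (\<lambda>A. - \<mu> A)) A"
    have "\<mu> B \<le> \<mu> A + ?n" if B: "B \<in> sets borel" "B \<subseteq> A" for B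
    proof -
      have "ennreal (- \<mu> (A - B)) \<le> emeasure (pos_variation (\<lambda>A. - \<mu> A)) A"
        unfolding emeasure_pos_variation[OF mu' A] using A B by (intro SUP_upper) auto
      then have "- \<mu> (A - B) \<le> ?n"
        unfolding N.emeasure_eq_measure by (auto simp: ennreal_le_iff2 intro: order_trans[OF _ measure_nonneg])
      then show ?thesis using signed_measure_Diff[OF mu A B] by linarith
    qed
    then have "emeasure (pos_variation \<mu>) A \<le> ennreal (\<mu> A + ?n)"
      unfolding emeasure_pos_variation[OF mu A] by (intro SUP_least ennreal_leI) auto
    moreover have "0 \<le> \<mu> A + ?n"
      using \<open>\<And>B. B \<in> sets borel \<Longrightarrow> B \<subseteq> A \<Longrightarrow> \<mu> B \<le> \<mu> A + ?n\<close>[of "{}"]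
        signed_measure_empty[OF mu] by simp
    ultimately show ?thesis
      unfolding P.emeasure_eq_measure by simp
  qed
  from le[OF nu] le[OF signed_measure_minus[OF nu]] show ?thesis by simp
qed

section \<open>Continuity and uniqueness of the Fourier transform of a complex measure\<close>

lemma continuous_on_fourier_finite_measure:
  fixes M :: "real measure"
  assumes "finite_measure M" and [measurable_cong, simp]: "sets M = sets borel"
  shows "continuous_on UNIV (\<lambda>\<xi>. \<integral>x. exp (- \<i> * complex_of_real (x * \<xi>)) \<partial>M)"
proof -
  interpret finite_measure M by fact
  have "(\<lambda>n. \<integral>x. exp (- \<i> * complex_of_real (x * X n)) \<partial>M)
      \<longlonglongrightarrow> (\<integral>x. exp (- \<i> * complex_of_real (x * \<xi>)) \<partial>M)"
    if "X \<longlonglongrightarrow> \<xi>" for X and \<xi> :: real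
    by (rule integral_dominated_convergence[where w = "\<lambda>_. 1"])
       (use that in \<open>auto intro!: tendsto_intros\<close>)
  then show ?thesis
    by (auto simp: continuous_on_sequentially comp_def)
qed

text \<open>
  Equality at frequency 0 says that the masses agree, so normalisation reduces the claim to the uniqueness
  theorem for characteristic functions of probability distributions.
\<close>

lemma finite_measure_eqI_fourier:
  fixes M1 M2 :: "real measure"
  assumes fin: "finite_measure M1" "finite_measure M2"
    and sets [measurable_cong, simp]: "sets M1 = sets borel" "sets M2 = sets borel"
    and eq: "\<And>\<xi>. (\<integral>x. exp (- \<i> * complex_of_real (x * \<xi>)) \<partial>M1)
                  = (\<integral>x. exp (- \<i> * complex_of_real (x * \<xi>)) \<partial>M2)"
    and A: "A \<in> sets borel"
  shows "measure M1 A = measure M2 A"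
proof -
  interpret M1: finite_measure M1 by fact
  interpret M2: finite_measure M2 by fact
  have sp [simp]: "space M1 = UNIV" "space M2 = UNIV"
    using sets_eq_imp_space_eq[OF sets(1)] sets_eq_imp_space_eq[OF sets(2)] by simp_all
  have mass: "measure M1 UNIV = measure M2 UNIV"
    using eq[of 0] by simp
  define m where "m = measure M1 UNIV"
  show ?thesis
  proof (cases "m = 0")
    case True
    have "measure M1 A \<le> 0" "measure M2 A \<le> 0"
      using M1.bounded_measure[of A] M2.bounded_measure[of A] True mass by (auto simp: m_def)
    then show ?thesis by (simp add: measure_le_0_iff)
  next
    case False
    then have m: "m > 0" using measure_nonneg[of M1 UNIV] by (auto simp: m_def less_le)
    define D where "D M = density M (\<lambda>_. ennreal (1 / m))" for M :: "real measure"
    have dist: "real_distribution (D M)"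
      if "finite_measure M" "sets M = sets borel" "measure M UNIV = m" for M
    proof -
      interpret M: finite_measure M by fact
      have "space M = UNIV" using that(2) sets_eq_imp_space_eq[of M borel] by simp
      then have "emeasure (D M) (space (D M)) = ennreal (1 / m) * ennreal m"
        using that by (simp add: D_def emeasure_density_const M.emeasure_eq_measure)
      also have "\<dots> = 1"
        using m by (simp flip: ennreal_mult)
      finally have "emeasure (D M) (space (D M)) = 1" .
      then have "prob_space (D M)" by (rule prob_spaceI)
      then show ?thesis
        using that(2) sets_eq_imp_space_eq[OF that(2)]
        by (simp add: real_distribution_def real_distribution_axioms_def D_def)
    qed
    have char: "char (D M) t = complex_of_real (1 / m) * (\<integral>x. exp (- \<i> * complex_of_real (x * (- t))) \<partial>M)"
      if "sets M = sets borel" for M t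
    proof -
      have [measurable_cong]: "sets M = sets borel" by fact
      have "char (D M) t = (\<integral>x. (1 / m) *\<^sub>R exp (\<i> * complex_of_real (t * x)) \<partial>M)"
        unfolding char_def D_def using m by (subst integral_density) auto
      also have "\<dots> = (1 / m) *\<^sub>R (\<integral>x. exp (\<i> * complex_of_real (t * x)) \<partial>M)"
        by (rule integral_scaleR_right)
      finally show ?thesis by (simp add: scaleR_conv_of_real mult.commute)
    qed
    have "D M1 = D M2"
    proof (rule Levy_uniqueness)
      show "real_distribution (D M1)" "real_distribution (D M2)"
        using mass by (auto intro!: dist fin sets simp: m_def)
      show "char (D M1) = char (D M2)"
        by (rule ext) (simp only: char[OF sets(1)] char[OF sets(2)] eq)
    qed
    then have "emeasure (D M1) A = emeasure (D M2) A" by simp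
    then have "ennreal (1 / m) * emeasure M1 A = ennreal (1 / m) * emeasure M2 A"
      using A by (simp add: D_def emeasure_density_const)
    then have "enn2real (ennreal (1 / m) * ennreal (measure M1 A))
        = enn2real (ennreal (1 / m) * ennreal (measure M2 A))"
      by (simp add: M1.emeasure_eq_measure M2.emeasure_eq_measure)
    then show ?thesis using m by (simp add: enn2real_mult)
  qed
qed

lemma signed_measure_Re:
  assumes "complex_borel_measure \<mu>" shows "signed_measure (\<lambda>A. Re (\<mu> A))"
  using assms by (auto simp: complex_borel_measure_def signed_measure_def intro!: sums_Re)

lemma signed_measure_Im:
  assumes "complex_borel_measure \<mu>" shows "signed_measure (\<lambda>A. Im (\<mu> A))"
  using assms by (auto simp: complex_borel_measure_def signed_measure_def intro!: sums_Im)

text \<open>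
  The transforms of the real and imaginary parts are conjugate symmetric, so the values at \<open>\<xi>\<close> and \<open>- \<xi>\<close>
  together determine both of them; uniqueness then applies to the Jordan parts.
\<close>

lemma complex_measure_eq_0_if_fourier_eq_0:
  assumes mu: "complex_borel_measure \<mu>" and zero: "\<And>\<xi>. fourier_transform \<mu> \<xi> = 0"
    and A: "A \<in> sets borel"
  shows "\<mu> A = 0"
proof -
  define F where "F \<nu> \<xi> = signed_integral \<nu> (\<lambda>x. exp (- \<i> * complex_of_real (x * \<xi>)))" for \<nu> \<xi>
  have F_cnj: "cnj (F \<nu> (- \<xi>)) = F \<nu> \<xi>" for \<nu> \<xi>
    by (simp add: F_def signed_integral_def exp_cnj flip: Bochner_Integration.integral_cnj)
  have "F (\<lambda>A. Re (\<mu> A)) \<xi> + \<i> * F (\<lambda>A. Im (\<mu> A)) \<xi> = 0" for \<xi>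
    using zero[of \<xi>] by (simp add: fourier_transform_def complex_measure_integral_def F_def)
  note eq = this
  have eq': "F (\<lambda>A. Re (\<mu> A)) \<xi> - \<i> * F (\<lambda>A. Im (\<mu> A)) \<xi> = 0" for \<xi>
    using arg_cong[OF eq[of "- \<xi>"], of cnj] by (simp add: F_cnj)
  have F0: "F (\<lambda>A. Re (\<mu> A)) \<xi> = 0" "F (\<lambda>A. Im (\<mu> A)) \<xi> = 0" for \<xi>
    using eq[of \<xi>] eq'[of \<xi>] by (auto simp: algebra_simps)
  have zero_if: "\<nu> A = 0" if nu: "signed_measure \<nu>" and F: "\<And>\<xi>. F \<nu> \<xi> = 0" for \<nu>
  proof -
    have "measure (pos_variation \<nu>) A = measure (pos_variation (\<lambda>A. - \<nu> A)) A"
      using F A by (intro finite_measure_eqI_fourier finite_measure_pos_variation nu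
          signed_measure_minus) (auto simp: F_def signed_integral_def)
    then show ?thesis using Jordan_decomposition[OF nu A] by simp
  qed
  have "Re (\<mu> A) = 0" by (rule zero_if[OF signed_measure_Re[OF mu] F0(1)])
  moreover have "Im (\<mu> A) = 0" by (rule zero_if[OF signed_measure_Im[OF mu] F0(2)])
  ultimately show ?thesis by (simp add: complex_eq_iff)
qed

lemma continuous_on_fourier_transform:
  assumes "complex_borel_measure \<mu>"
  shows "continuous_on UNIV (fourier_transform \<mu>)"
proof -
  note sm = signed_measure_Re[OF assms] signed_measure_Im[OF assms]
  show ?thesis
    unfolding fourier_transform_def complex_measure_integral_def signed_integral_def
    by (intro continuous_intros continuous_on_fourier_finite_measure
        finite_measure_pos_variation sm signed_measure_minus) auto
qed

lemma AE_pos_variation_in: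
  assumes nu: "signed_measure \<nu>" and E: "E \<in> sets borel"
    and null: "\<And>A. A \<in> sets borel \<Longrightarrow> A \<inter> E = {} \<Longrightarrow> \<nu> A = 0"
  shows "AE x in pos_variation \<nu>. x \<in> E"
proof (rule AE_I)
  have "emeasure (pos_variation \<nu>) (- E) = (SUP B \<in> {B \<in> sets borel. B \<subseteq> - E}. ennreal (\<nu> B))"
    using E by (intro emeasure_pos_variation nu) auto
  also have "\<dots> \<le> 0"
  proof (rule SUP_least)
    fix B assume "B \<in> {B \<in> sets borel. B \<subseteq> - E}"
    then have "\<nu> B = 0" by (intro null) auto
    then show "ennreal (\<nu> B) \<le> 0" by simp
  qed
  finally show "emeasure (pos_variation \<nu>) (- E) = 0" by simp
qed (use E in auto)

lemma norm_integral_le_mass: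
  fixes f :: "real \<Rightarrow> complex"
  assumes "finite_measure M" and [measurable_cong]: "sets M = sets borel"
    and [measurable]: "f \<in> borel_measurable borel"
    and "AE x in M. norm (f x) \<le> B"
  shows "norm (integral\<^sup>L M f) \<le> measure M UNIV * B"
proof -
  interpret finite_measure M by fact
  have sp: "space M = UNIV" using sets_eq_imp_space_eq[OF assms(2)] by simp
  have int: "integrable M f"
    using assms(4) by (intro integrable_const_bound) auto
  have "norm (integral\<^sup>L M f) \<le> (\<integral>x. norm (f x) \<partial>M)" by (rule integral_norm_bound)
  also have "\<dots> \<le> (\<integral>x. B \<partial>M)"
    using int assms(4) by (intro integral_mono_AE) auto
  finally show ?thesis by (simp add: sp)
qed

text \<open>
  The constant is the sum of the masses of the four Jordan parts. Only values of the integrand on the support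
  matter; this is what makes functions that are tiny on \<open>E\<close> useful as test functions.
\<close>

lemma complex_measure_integral_bound:
  assumes mu: "\<mu> \<in> measures_on E" and E: "E \<in> sets borel"
  obtains V where "V \<ge> 0"
    and "\<And>f B. f \<in> borel_measurable borel \<Longrightarrow> (\<And>x. x \<in> E \<Longrightarrow> norm (f x) \<le> B)
           \<Longrightarrow> norm (complex_measure_integral \<mu> f) \<le> V * B"
proof -
  have cm: "complex_borel_measure \<mu>" and null: "\<And>A. A \<in> sets borel \<Longrightarrow> A \<inter> E = {} \<Longrightarrow> \<mu> A = 0"
    using mu by (auto simp: measures_on_def)
  define m where "m \<nu> = measure (pos_variation \<nu>) UNIV" for \<nu>
  have one: "norm (signed_integral \<nu> f) \<le> (m \<nu> + m (\<lambda>A. - \<nu> A)) * B"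
    if nu: "signed_measure \<nu>" "\<And>A. A \<in> sets borel \<Longrightarrow> A \<inter> E = {} \<Longrightarrow> \<nu> A = 0"
      and f: "f \<in> borel_measurable borel" "\<And>x. x \<in> E \<Longrightarrow> norm (f x) \<le> B" for \<nu> f B
  proof -
    have "norm (integral\<^sup>L (pos_variation \<nu>) f) \<le> m \<nu> * B"
      unfolding m_def using f AE_pos_variation_in[OF nu(1) E nu(2)]
      by (intro norm_integral_le_mass finite_measure_pos_variation nu) auto
    moreover have "norm (integral\<^sup>L (pos_variation (\<lambda>A. - \<nu> A)) f) \<le> m (\<lambda>A. - \<nu> A) * B"
      unfolding m_def using f AE_pos_variation_in[OF signed_measure_minus[OF nu(1)] E] nu(2)
      by (intro norm_integral_le_mass finite_measure_pos_variation signed_measure_minus nu) auto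
    ultimately show ?thesis
      unfolding signed_integral_def
      by (intro order_trans[OF norm_triangle_ineq4]) (simp add: algebra_simps)
  qed
  define R I where "R = (\<lambda>A. Re (\<mu> A))" and "I = (\<lambda>A. Im (\<mu> A))"
  define V where "V = m R + m (\<lambda>A. - R A) + m I + m (\<lambda>A. - I A)"
  show ?thesis
  proof (rule that[of V])
    show "V \<ge> 0" by (simp add: V_def m_def)
    fix f :: "real \<Rightarrow> complex" and B
    assume f: "f \<in> borel_measurable borel" "\<And>x. x \<in> E \<Longrightarrow> norm (f x) \<le> B"
    have "norm (signed_integral R f) \<le> (m R + m (\<lambda>A. - R A)) * B"
      by (rule one[OF _ _ f]) (use signed_measure_Re[OF cm] null in \<open>auto simp: R_def\<close>)
    moreover have "norm (signed_integral I f) \<le> (m I + m (\<lambda>A. - I A)) * B"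
      by (rule one[OF _ _ f]) (use signed_measure_Im[OF cm] null in \<open>auto simp: I_def\<close>)
    moreover have "norm (complex_measure_integral \<mu> f)
        \<le> norm (signed_integral R f) + norm (signed_integral I f)"
      unfolding complex_measure_integral_def R_def I_def
      by (intro order_trans[OF norm_triangle_ineq]) (simp add: norm_mult)
    ultimately show "norm (complex_measure_integral \<mu> f) \<le> V * B"
      by (simp add: V_def algebra_simps)
  qed
qed

lemma complex_measure_integral_sum:
  assumes mu: "complex_borel_measure \<mu>" and "finite I"
    and f [measurable]: "\<And>i. i \<in> I \<Longrightarrow> f i \<in> borel_measurable borel"
    and bd: "\<And>i x. i \<in> I \<Longrightarrow> norm (f i x) \<le> 1"
  shows "complex_measure_integral \<mu> (\<lambda>x. \<Sum>i\<in>I. c i * f i x)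
           = (\<Sum>i\<in>I. c i * complex_measure_integral \<mu> (f i))"
proof -
  have one: "signed_integral \<nu> (\<lambda>x. \<Sum>i\<in>I. c i * f i x) = (\<Sum>i\<in>I. c i * signed_integral \<nu> (f i))"
    if nu: "signed_measure \<nu>" for \<nu>
  proof -
    have two: "(\<integral>x. (\<Sum>i\<in>I. c i * f i x) \<partial>pos_variation \<nu>)
        = (\<Sum>i\<in>I. c i * (\<integral>x. f i x \<partial>pos_variation \<nu>))" if nu: "signed_measure \<nu>" for \<nu>
    proof -
      interpret finite_measure "pos_variation \<nu>" by (rule finite_measure_pos_variation[OF nu])
      have "integrable (pos_variation \<nu>) (f i)" if "i \<in> I" for i
        using that f[OF that] bd[OF that] by (intro integrable_const_bound[where B = 1]) auto
      then show ?thesis by (subst Bochner_Integration.integral_sum) auto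
    qed
    show ?thesis
      by (simp add: signed_integral_def two[OF nu] two[OF signed_measure_minus[OF nu]]
          sum_subtractf algebra_simps)
  qed
  show ?thesis
    by (simp add: complex_measure_integral_def one[OF signed_measure_Re[OF mu]]
        one[OF signed_measure_Im[OF mu]] sum.distrib sum_distrib_left algebra_simps)
qed

section \<open>Complex measures with an integrable density\<close>

lemma signed_measure_density:
  fixes u :: "real \<Rightarrow> real"
  assumes u: "integrable lborel u"
  shows "signed_measure (\<lambda>A. \<integral>x. indicator A x * u x \<partial>lborel)"
  unfolding signed_measure_def
proof (intro allI impI)
  fix A :: "nat \<Rightarrow> real set" assume A: "range A \<subseteq> sets borel" "disjoint_family A"
  have [measurable]: "A i \<in> sets borel" for i using A(1) by auto
  have ind: "(\<lambda>i. indicator (A i) x) sums (indicator (\<Union>i. A i) x :: real)" for x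
    using A(2) by (intro indicator_sums) (auto simp: disjoint_family_on_def)
  have int: "integrable lborel (\<lambda>x. indicator B x * u x)" if "B \<in> sets borel" for B
    using integrable_mult_indicator[of B lborel u] that u by simp
  have "(\<lambda>i. \<integral>x. indicator (A i) x * u x \<partial>lborel) sums (\<integral>x. (\<Sum>i. indicator (A i) x * u x) \<partial>lborel)"
  proof (rule sums_integral)
    show "integrable lborel (\<lambda>x. indicator (A i) x * u x)" for i by (rule int) simp
    have "summable (\<lambda>i. indicator (A i) x * \<bar>u x\<bar>)" for x
      by (rule summable_mult2[OF sums_summable[OF ind]])
    then show "AE x in lborel. summable (\<lambda>i. norm (indicator (A i) x * u x))"
      by (intro AE_I2) (simp add: abs_mult)
    show "summable (\<lambda>i. \<integral>x. norm (indicator (A i) x * u x) \<partial>lborel)"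
    proof (rule bounded_imp_summable)
      fix n
      have "(\<Sum>i\<le>n. \<integral>x. norm (indicator (A i) x * u x) \<partial>lborel)
          = (\<integral>x. (\<Sum>i\<le>n. norm (indicator (A i) x * u x)) \<partial>lborel)"
        by (rule Bochner_Integration.integral_sum[symmetric]) (intro integrable_norm int, simp)
      also have "\<dots> \<le> (\<integral>x. \<bar>u x\<bar> \<partial>lborel)"
      proof (rule integral_mono)
        show "integrable lborel (\<lambda>x. \<Sum>i\<le>n. norm (indicator (A i) x * u x))"
          by (intro Bochner_Integration.integrable_sum integrable_norm int) simp
        show "integrable lborel (\<lambda>x. \<bar>u x\<bar>)" using u by (rule integrable_abs)
        fix x
        have "(\<Sum>i\<le>n. indicator (A i) x :: real) \<le> (\<Sum>i. indicator (A i) x)"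
          by (rule sum_le_suminf[OF sums_summable[OF ind]]) auto
        also have "\<dots> \<le> 1" using sums_unique[OF ind[of x], symmetric] by (simp add: indicator_def)
        finally have "(\<Sum>i\<le>n. indicator (A i) x) * \<bar>u x\<bar> \<le> 1 * \<bar>u x\<bar>"
          by (rule mult_right_mono) simp
        then show "(\<Sum>i\<le>n. norm (indicator (A i) x * u x)) \<le> \<bar>u x\<bar>"
          by (simp add: abs_mult sum_distrib_right)
      qed
      finally show "(\<Sum>i\<le>n. \<integral>x. norm (indicator (A i) x * u x) \<partial>lborel) \<le> (\<integral>x. \<bar>u x\<bar> \<partial>lborel)" .
    qed simp
  qed
  also have "(\<lambda>x. \<Sum>i. indicator (A i) x * u x) = (\<lambda>x. indicator (\<Union>i. A i) x * u x)"
    by (intro ext sums_unique[symmetric] sums_mult2 ind)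
  finally show "(\<lambda>i. \<integral>x. indicator (A i) x * u x \<partial>lborel) sums (\<integral>x. indicator (\<Union>i. A i) x * u x \<partial>lborel)" .
qed

text \<open>
  The supremum over subsets of \<open>A\<close> is attained at the part of \<open>A\<close> where the density is positive.
\<close>

lemma pos_variation_density:
  fixes u :: "real \<Rightarrow> real"
  assumes u: "integrable lborel u"
  shows "pos_variation (\<lambda>A. \<integral>x. indicator A x * u x \<partial>lborel) = density lborel (\<lambda>x. ennreal (u x))"
proof (rule measure_eqI)
  show "sets (pos_variation (\<lambda>A. \<integral>x. indicator A x * u x \<partial>lborel)) = sets (density lborel (\<lambda>x. ennreal (u x)))"
    by simp
  fix A assume "A \<in> sets (pos_variation (\<lambda>A. \<integral>x. indicator A x * u x \<partial>lborel))"
  then have A [measurable]: "A \<in> sets borel" by simp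
  have [measurable]: "u \<in> borel_measurable borel" using u by auto
  have le: "ennreal (\<integral>x. indicator B x * u x \<partial>lborel) \<le> (\<integral>\<^sup>+x. ennreal (u x) * indicator B x \<partial>lborel)"
    and eq: "(\<And>x. x \<in> B \<Longrightarrow> u x \<ge> 0) \<Longrightarrow> ennreal (\<integral>x. indicator B x * u x \<partial>lborel) = (\<integral>\<^sup>+x. ennreal (u x) * indicator B x \<partial>lborel)"
    if [measurable]: "B \<in> sets borel" for B
  proof -
    have int: "integrable lborel (\<lambda>x. indicator B x * u x)" "integrable lborel (\<lambda>x. indicator B x * max 0 (u x))"
      using integrable_mult_indicator[of B lborel u] integrable_mult_indicator[of B lborel "\<lambda>x. max 0 (u x)"] u by simp_all
    have "(\<integral>\<^sup>+x. ennreal (u x) * indicator B x \<partial>lborel) = (\<integral>\<^sup>+x. ennreal (indicator B x * max 0 (u x)) \<partial>lborel)"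
      by (intro nn_integral_cong) (auto simp: indicator_def max_def ennreal_neg)
    also have "\<dots> = ennreal (\<integral>x. indicator B x * max 0 (u x) \<partial>lborel)"
      using int by (intro nn_integral_eq_integral) auto
    finally have *: "(\<integral>\<^sup>+x. ennreal (u x) * indicator B x \<partial>lborel) = ennreal (\<integral>x. indicator B x * max 0 (u x) \<partial>lborel)" .
    show "ennreal (\<integral>x. indicator B x * u x \<partial>lborel) \<le> (\<integral>\<^sup>+x. ennreal (u x) * indicator B x \<partial>lborel)"
      unfolding * using int by (intro ennreal_leI integral_mono) (auto simp: indicator_def)
    show "ennreal (\<integral>x. indicator B x * u x \<partial>lborel) = (\<integral>\<^sup>+x. ennreal (u x) * indicator B x \<partial>lborel)"
      if "\<And>x. x \<in> B \<Longrightarrow> u x \<ge> 0"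
      unfolding * using that by (intro arg_cong[of _ _ ennreal] Bochner_Integration.integral_cong) (auto simp: indicator_def max_def)
  qed
  have "emeasure (pos_variation (\<lambda>A. \<integral>x. indicator A x * u x \<partial>lborel)) A
      = (SUP B \<in> {B \<in> sets borel. B \<subseteq> A}. ennreal (\<integral>x. indicator B x * u x \<partial>lborel))"
    by (rule emeasure_pos_variation[OF signed_measure_density[OF u] A])
  also have "\<dots> = (\<integral>\<^sup>+x. ennreal (u x) * indicator A x \<partial>lborel)"
  proof (rule antisym)
    show "(SUP B \<in> {B \<in> sets borel. B \<subseteq> A}. ennreal (\<integral>x. indicator B x * u x \<partial>lborel)) \<le> (\<integral>\<^sup>+x. ennreal (u x) * indicator A x \<partial>lborel)"
    proof (rule SUP_least)
      fix B assume B: "B \<in> {B \<in> sets borel. B \<subseteq> A}"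
      then have "ennreal (\<integral>x. indicator B x * u x \<partial>lborel) \<le> (\<integral>\<^sup>+x. ennreal (u x) * indicator B x \<partial>lborel)"
        by (intro le) auto
      also have "\<dots> \<le> (\<integral>\<^sup>+x. ennreal (u x) * indicator A x \<partial>lborel)"
        using B by (intro nn_integral_mono) (auto simp: indicator_def)
      finally show "ennreal (\<integral>x. indicator B x * u x \<partial>lborel) \<le> (\<integral>\<^sup>+x. ennreal (u x) * indicator A x \<partial>lborel)" .
    qed
    let ?B = "A \<inter> {x. u x > 0}"
    have B: "?B \<in> sets borel" by measurable
    have "(\<integral>\<^sup>+x. ennreal (u x) * indicator A x \<partial>lborel) = (\<integral>\<^sup>+x. ennreal (u x) * indicator ?B x \<partial>lborel)"
      by (intro nn_integral_cong) (auto simp: indicator_def ennreal_neg)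
    also have "\<dots> = ennreal (\<integral>x. indicator ?B x * u x \<partial>lborel)"
      by (rule eq[OF B, symmetric]) auto
    also have "\<dots> \<le> (SUP B \<in> {B \<in> sets borel. B \<subseteq> A}. ennreal (\<integral>x. indicator B x * u x \<partial>lborel))"
      using B by (intro SUP_upper) auto
    finally show "(\<integral>\<^sup>+x. ennreal (u x) * indicator A x \<partial>lborel) \<le> (SUP B \<in> {B \<in> sets borel. B \<subseteq> A}. ennreal (\<integral>x. indicator B x * u x \<partial>lborel))" .
  qed
  also have "\<dots> = emeasure (density lborel (\<lambda>x. ennreal (u x))) A"
    by (rule emeasure_density[symmetric]) auto
  finally show "emeasure (pos_variation (\<lambda>A. \<integral>x. indicator A x * u x \<partial>lborel)) A = emeasure (density lborel (\<lambda>x. ennreal (u x))) A" .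
qed

lemma signed_integral_density:
  fixes u :: "real \<Rightarrow> real" and h :: "real \<Rightarrow> complex"
  assumes u: "integrable lborel u" and [measurable]: "h \<in> borel_measurable borel" and bd: "\<And>x. norm (h x) \<le> 1"
  shows "signed_integral (\<lambda>A. \<integral>x. indicator A x * u x \<partial>lborel) h = (\<integral>x. of_real (u x) * h x \<partial>lborel)"
proof -
  have one: "integral\<^sup>L (density lborel (\<lambda>x. ennreal (v x))) h = (\<integral>x. max 0 (v x) *\<^sub>R h x \<partial>lborel)"
    and int: "integrable lborel (\<lambda>x. max 0 (v x) *\<^sub>R h x)"
    if v: "integrable lborel v" for v :: "real \<Rightarrow> real"
  proof -
    have [measurable]: "v \<in> borel_measurable borel" using v by auto
    have "(\<lambda>x. ennreal (v x)) = (\<lambda>x. ennreal (max 0 (v x)))" by (auto simp: max_def ennreal_neg)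
    then have "density lborel (\<lambda>x. ennreal (v x)) = density lborel (\<lambda>x. ennreal (max 0 (v x)))"
      by (rule arg_cong)
    then show "integral\<^sup>L (density lborel (\<lambda>x. ennreal (v x))) h = (\<integral>x. max 0 (v x) *\<^sub>R h x \<partial>lborel)"
      using integral_density[of h lborel "\<lambda>x. max 0 (v x)"] by simp
    show "integrable lborel (\<lambda>x. max 0 (v x) *\<^sub>R h x)"
    proof (rule Bochner_Integration.integrable_bound)
      show "integrable lborel (\<lambda>x. max 0 (v x))" using v by simp
      show "AE x in lborel. norm (max 0 (v x) *\<^sub>R h x) \<le> norm (max 0 (v x))"
        using bd by (intro AE_I2) (auto intro: mult_left_le)
    qed measurable
  qed
  have m: "(\<lambda>A. - (\<integral>x. indicator A x * u x \<partial>lborel)) = (\<lambda>A. \<integral>x. indicator A x * (- u x) \<partial>lborel)"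
    by simp
  have u': "integrable lborel (\<lambda>x. - u x)" using u by simp
  have "signed_integral (\<lambda>A. \<integral>x. indicator A x * u x \<partial>lborel) h
      = (\<integral>x. max 0 (u x) *\<^sub>R h x \<partial>lborel) - (\<integral>x. max 0 (- u x) *\<^sub>R h x \<partial>lborel)"
    unfolding signed_integral_def m pos_variation_density[OF u] pos_variation_density[OF u'] one[OF u] one[OF u'] ..
  also have "\<dots> = (\<integral>x. max 0 (u x) *\<^sub>R h x - max 0 (- u x) *\<^sub>R h x \<partial>lborel)"
    by (rule Bochner_Integration.integral_diff[symmetric]) (rule int[OF u] int[OF u'])+
  also have "\<dots> = (\<integral>x. of_real (u x) * h x \<partial>lborel)"
    by (intro Bochner_Integration.integral_cong refl) (auto simp: max_def scaleR_conv_of_real)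
  finally show ?thesis .
qed

definition density_measure :: "(real \<Rightarrow> complex) \<Rightarrow> real set \<Rightarrow> complex" where
  "density_measure f A = (\<integral>x. indicator A x *\<^sub>R f x \<partial>lborel)"

lemma Re_Im_density_measure:
  assumes f: "integrable lborel f" and A: "A \<in> sets borel"
  shows "Re (density_measure f A) = (\<integral>x. indicator A x * Re (f x) \<partial>lborel)"
    "Im (density_measure f A) = (\<integral>x. indicator A x * Im (f x) \<partial>lborel)"
proof -
  have int: "integrable lborel (\<lambda>x. indicator A x *\<^sub>R f x)"
    using integrable_mult_indicator[of A lborel f] f A by simp
  show "Re (density_measure f A) = (\<integral>x. indicator A x * Re (f x) \<partial>lborel)"
    "Im (density_measure f A) = (\<integral>x. indicator A x * Im (f x) \<partial>lborel)"
    unfolding density_measure_def integral_Re[OF int, symmetric] integral_Im[OF int, symmetric] by simp_all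
qed

lemma complex_borel_measure_density:
  assumes f: "integrable lborel f"
  shows "complex_borel_measure (density_measure f)"
  unfolding complex_borel_measure_def
proof (intro allI impI)
  fix A :: "nat \<Rightarrow> real set" assume A: "range A \<subseteq> sets borel" "disjoint_family A"
  then have Ai: "A i \<in> sets borel" "(\<Union>i. A i) \<in> sets borel" for i by auto
  have "(\<lambda>i. Re (density_measure f (A i))) sums Re (density_measure f (\<Union>i. A i))"
    unfolding Re_Im_density_measure[OF f Ai(1)] Re_Im_density_measure[OF f Ai(2)]
    by (rule signed_measureD[OF signed_measure_density]) (use f A Ai in auto)
  moreover have "(\<lambda>i. Im (density_measure f (A i))) sums Im (density_measure f (\<Union>i. A i))"
    unfolding Re_Im_density_measure[OF f Ai(1)] Re_Im_density_measure[OF f Ai(2)]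
    by (rule signed_measureD[OF signed_measure_density]) (use f A Ai in auto)
  ultimately show "(\<lambda>i. density_measure f (A i)) sums density_measure f (\<Union>i. A i)"
    by (simp add: sums_complex_iff)
qed

text \<open>
  Two set functions that agree on Borel sets may differ elsewhere as functions, hence the need for a
  congruence rule.
\<close>

lemma pos_variation_cong:
  assumes "\<And>A. A \<in> sets borel \<Longrightarrow> \<nu> A = \<nu>' A"
  shows "pos_variation \<nu> = pos_variation \<nu>'"
proof -
  have "(SUP B \<in> {B \<in> sets borel. B \<subseteq> A}. ennreal (\<nu> B)) = (SUP B \<in> {B \<in> sets borel. B \<subseteq> A}. ennreal (\<nu>' B))" for A
    using assms by (intro SUP_cong) auto
  then show ?thesis by (simp add: pos_variation_def)
qed

lemma fourier_transform_density_measure: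
  assumes f: "integrable lborel f"
  shows "fourier_transform (density_measure f) \<xi> = (\<integral>x. f x * character \<xi> x \<partial>lborel)"
proof -
  have si: "signed_integral (\<lambda>A. Re (density_measure f A)) h = signed_integral (\<lambda>A. \<integral>x. indicator A x * Re (f x) \<partial>lborel) h"
    "signed_integral (\<lambda>A. Im (density_measure f A)) h = signed_integral (\<lambda>A. \<integral>x. indicator A x * Im (f x) \<partial>lborel) h" for h
    unfolding signed_integral_def
    by (intro arg_cong2[of _ _ _ _ "(-)"] arg_cong[of _ _ "\<lambda>M. integral\<^sup>L M h"] pos_variation_cong;
        simp add: Re_Im_density_measure[OF f])+
  have int: "integrable lborel (\<lambda>x. of_real (u x) * character \<xi> x)" if u: "integrable lborel u" for u :: "real \<Rightarrow> real"
    by (rule Bochner_Integration.integrable_bound[OF u]) (use u in \<open>auto simp: norm_mult\<close>)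
  have re: "integrable lborel (\<lambda>x. Re (f x))" and im: "integrable lborel (\<lambda>x. Im (f x))" using f by auto
  have "fourier_transform (density_measure f) \<xi> = (\<integral>x. of_real (Re (f x)) * character \<xi> x \<partial>lborel)
      + \<i> * (\<integral>x. of_real (Im (f x)) * character \<xi> x \<partial>lborel)"
    unfolding fourier_transform_character complex_measure_integral_def si
    using re im by (simp add: signed_integral_density)
  also have "\<dots> = (\<integral>x. of_real (Re (f x)) * character \<xi> x + \<i> * (of_real (Im (f x)) * character \<xi> x) \<partial>lborel)"
    using int[OF re] int[OF im] by simp
  also have "\<dots> = (\<integral>x. f x * character \<xi> x \<partial>lborel)"
  proof (intro Bochner_Integration.integral_cong refl)
    fix x
    have "f x = of_real (Re (f x)) + \<i> * of_real (Im (f x))" by (rule complex_eq)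
    then have "f x * character \<xi> x = (of_real (Re (f x)) + \<i> * of_real (Im (f x))) * character \<xi> x" by simp
    then show "of_real (Re (f x)) * character \<xi> x + \<i> * (of_real (Im (f x)) * character \<xi> x) = f x * character \<xi> x"
      by (simp add: algebra_simps)
  qed
  finally show ?thesis .
qed

lemma AE_0_if_set_integrals_0:
  fixes u :: "real \<Rightarrow> real"
  assumes u: "integrable lborel u" and z: "\<And>A. A \<in> sets borel \<Longrightarrow> (\<integral>x. indicator A x * u x \<partial>lborel) = 0"
  shows "AE x in lborel. u x = 0"
proof -
  have le: "AE x in lborel. v x \<le> 0"
    if v: "integrable lborel v" and z: "\<And>A. A \<in> sets borel \<Longrightarrow> (\<integral>x. indicator A x * v x \<partial>lborel) = 0" for v :: "real \<Rightarrow> real"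
  proof -
    have [measurable]: "v \<in> borel_measurable borel" using v by auto
    let ?A = "{x. v x > 0}"
    have A: "?A \<in> sets borel" by measurable
    have "integrable lborel (\<lambda>x. indicator ?A x * v x)"
      using integrable_mult_indicator[of ?A lborel v] v A by simp
    moreover have "AE x in lborel. 0 \<le> indicator ?A x * v x" by (intro AE_I2) (auto simp: indicator_def)
    ultimately have "AE x in lborel. indicator ?A x * v x = 0"
      using integral_nonneg_eq_0_iff_AE[of lborel "\<lambda>x. indicator ?A x * v x"] z[OF A] by simp
    then show ?thesis by eventually_elim (auto simp: indicator_def split: if_splits)
  qed
  have "AE x in lborel. u x \<le> 0" by (rule le[OF u z])
  moreover have "AE x in lborel. - u x \<le> 0" by (rule le) (use u z in auto)
  ultimately show ?thesis by eventually_elim auto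
qed

lemma nontrivial_density_measure:
  assumes f: "integrable lborel f" and ne: "\<not> (AE x in lborel. f x = 0)"
  shows "nontrivial_measure (density_measure f)"
proof (rule ccontr)
  assume "\<not> ?thesis"
  then have z: "density_measure f A = 0" if "A \<in> sets borel" for A
    using that by (auto simp: nontrivial_measure_def)
  have "AE x in lborel. Re (f x) = 0"
    using f z by (intro AE_0_if_set_integrals_0) (auto simp flip: Re_Im_density_measure[OF f])
  moreover have "AE x in lborel. Im (f x) = 0"
    using f z by (intro AE_0_if_set_integrals_0) (auto simp flip: Re_Im_density_measure[OF f])
  ultimately have "AE x in lborel. f x = 0" by eventually_elim (simp add: complex_eq_iff)
  then show False using ne by contradiction
qed

lemma density_measure_on:
  assumes f: "integrable lborel f" and "\<And>x. x \<notin> E \<Longrightarrow> f x = 0"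
  shows "density_measure f \<in> measures_on E"
proof -
  have "density_measure f A = 0" if "A \<inter> E = {}" for A
  proof -
    have "indicator A x *\<^sub>R f x = 0" for x
      using that assms(2)[of x] by (cases "x \<in> A") auto
    then have "(\<lambda>x. indicator A x *\<^sub>R f x) = (\<lambda>x. 0)" by (rule ext)
    then show ?thesis unfolding density_measure_def by (simp only: integral_zero)
  qed
  then show ?thesis using complex_borel_measure_density[OF f] by (simp add: measures_on_def)
qed

lemma emeasure_pos_if_density:
  assumes ne: "\<not> (AE x in lborel. f x = 0)" and E: "E \<in> sets borel" and "\<And>x. x \<notin> E \<Longrightarrow> f x = (0::complex)"
  shows "emeasure lborel E > 0"
proof (rule ccontr)
  assume "\<not> ?thesis"
  then have "E \<in> null_sets lborel" using E by (simp add: null_sets_def)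
  then have "AE x in lborel. x \<notin> E" by (rule AE_not_in)
  then have "AE x in lborel. f x = 0" by eventually_elim (rule assms(3))
  then show False using ne by contradiction
qed

section \<open>Concentrated trigonometric polynomials\<close>

text \<open>
  The polynomial is the normalised square modulus of the \<open>m\<close>-th power of the geometric sum
  \<open>1 + z + \<dots> + z^(n-1)\<close>. At \<open>z = 1\<close> that power equals \<open>n^m\<close>, which by Cauchy-Schwarz makes the constant
  coefficient of the square modulus large; away from 1 the geometric sum is bounded by \<open>2 / |1 - z|\<close>. The constant
  coefficient is the sum of the squares of the coefficients of the power, so it dominates all the others.
\<close>

lemma concentrated_trig_polynomial:
  fixes n m :: nat
  assumes n: "n \<ge> 1" and m: "m \<ge> 1"
  obtains c :: "int \<Rightarrow> complex" where "c 0 = 1" "\<And>l. norm (c l) \<le> 1"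
    "\<And>z. norm z = 1 \<Longrightarrow> z \<noteq> 1 \<Longrightarrow>
       norm (\<Sum>l\<in>{- int (n * m)..int (n * m)}. c l * z powi l)
         \<le> real (n * m) * (2 / (real n * norm (1 - z))) ^ (2 * m)"
proof -
  define L where "L = n * m"
  define p :: "complex poly" where "p = (\<Sum>i<n. monom 1 i) ^ m"
  define \<alpha> where "\<alpha> = coeff p"
  have "degree (\<Sum>i<n. monom (1::complex) i) \<le> n - 1"
    by (intro degree_sum_le) (auto intro!: order_trans[OF degree_monom_le])
  then have "degree p \<le> (n - 1) * m"
    unfolding p_def by (intro order_trans[OF degree_power_le] mult_right_mono) auto
  moreover have "(n - 1) * m < L" using n m by (simp add: L_def)
  ultimately have deg: "degree p < L" by linarith
  have pz: "poly p z = (\<Sum>a<L. \<alpha> a * z ^ a)" for z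
  proof -
    have "poly p z = (\<Sum>a\<le>degree p. \<alpha> a * z ^ a)" by (simp add: poly_altdef \<alpha>_def)
    also have "\<dots> = (\<Sum>a<L. \<alpha> a * z ^ a)"
      using deg by (intro sum.mono_neutral_left) (auto simp: \<alpha>_def coeff_eq_0)
    finally show ?thesis .
  qed
  have pz': "poly p z = (\<Sum>i<n. z ^ i) ^ m" for z
    by (simp add: p_def poly_sum poly_monom)
  define S where "S = (\<Sum>a<L. (norm (\<alpha> a))\<^sup>2)"
  have "real n ^ m = norm (poly p 1)" by (simp add: pz' norm_power)
  also have "\<dots> \<le> (\<Sum>a<L. norm (\<alpha> a) * 1)" unfolding pz by (intro order_trans[OF norm_sum]) simp
  finally have "(real n ^ m)\<^sup>2 \<le> (\<Sum>a<L. norm (\<alpha> a) * 1)\<^sup>2" by (intro power_mono) auto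
  also have "\<dots> \<le> S * (\<Sum>a<L. 1\<^sup>2)" unfolding S_def by (rule Cauchy_Schwarz_ineq_sum)
  finally have S: "real n ^ (2 * m) \<le> S * real L"
    by (simp add: mult.commute[of 2 m] power_mult)
  have L: "L \<ge> 1" using n m by (simp add: L_def)
  have Spos: "S > 0"
  proof (rule ccontr)
    assume "\<not> S > 0"
    then have "S * real L \<le> 0" using L by (simp add: mult_nonpos_nonneg)
    moreover have "real n ^ (2 * m) > 0" using n by simp
    ultimately show False using S by linarith
  qed
  define D where "D l = {x \<in> {..<L} \<times> {..<L}. int (fst x) - int (snd x) = l}" for l
  define h where "h x = \<alpha> (fst x) * cnj (\<alpha> (snd x))" for x :: "nat \<times> nat"
  define c where "c l = (\<Sum>x\<in>D l. h x) / of_real S" for l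
  have finD: "finite (D l)" for l by (simp add: D_def)
  have norm_c: "norm (\<Sum>x\<in>D l. h x) \<le> S" for l
  proof -
    have "norm (\<Sum>x\<in>D l. h x) \<le> (\<Sum>x\<in>D l. ((norm (\<alpha> (fst x)))\<^sup>2 + (norm (\<alpha> (snd x)))\<^sup>2) / 2)"
    proof (rule sum_norm_le)
      fix x
      show "norm (h x) \<le> ((norm (\<alpha> (fst x)))\<^sup>2 + (norm (\<alpha> (snd x)))\<^sup>2) / 2"
        using sum_squares_bound[of "norm (\<alpha> (fst x))" "norm (\<alpha> (snd x))"]
        by (simp add: h_def norm_mult)
    qed
    also have "\<dots> = ((\<Sum>x\<in>D l. (norm (\<alpha> (fst x)))\<^sup>2) + (\<Sum>x\<in>D l. (norm (\<alpha> (snd x)))\<^sup>2)) / 2"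
      by (simp add: sum.distrib flip: sum_divide_distrib)
    also have "(\<Sum>x\<in>D l. (norm (\<alpha> (fst x)))\<^sup>2) = (\<Sum>a\<in>fst ` D l. (norm (\<alpha> a))\<^sup>2)"
      by (subst sum.reindex) (auto simp: D_def inj_on_def)
    also have "\<dots> \<le> S" unfolding S_def by (intro sum_mono2) (auto simp: D_def)
    also have "(\<Sum>x\<in>D l. (norm (\<alpha> (snd x)))\<^sup>2) = (\<Sum>a\<in>snd ` D l. (norm (\<alpha> a))\<^sup>2)"
      by (subst sum.reindex) (auto simp: D_def inj_on_def)
    also have "\<dots> \<le> S" unfolding S_def by (intro sum_mono2) (auto simp: D_def)
    finally show ?thesis by simp
  qed
  show ?thesis
  proof (rule that[of c])
    have "(\<Sum>x\<in>D 0. h x) = (\<Sum>a<L. \<alpha> a * cnj (\<alpha> a))"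
      by (rule sum.reindex_bij_witness[of _ "\<lambda>a. (a, a)" fst]) (auto simp: D_def h_def)
    also have "\<dots> = of_real S" by (simp add: S_def flip: complex_norm_square)
    finally show "c 0 = 1" using Spos by (simp add: c_def)
    show "norm (c l) \<le> 1" for l
      using norm_c[of l] Spos by (simp add: c_def norm_divide)
    fix z :: complex assume z: "norm z = 1" "z \<noteq> 1"
    then have z0: "z \<noteq> 0" by auto
    have cnjz: "cnj z = inverse z"
      using complex_div_cnj[of 1 z] z(1) by (simp add: inverse_eq_divide)
    have "poly p z * cnj (poly p z) = (\<Sum>a<L. \<Sum>b<L. \<alpha> a * z ^ a * (cnj (\<alpha> b) * cnj z ^ b))"
      unfolding pz by (simp add: sum_product)
    also have "\<dots> = (\<Sum>x\<in>{..<L} \<times> {..<L}. h x * z powi (int (fst x) - int (snd x)))"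
      unfolding sum.cartesian_product
      by (intro sum.cong) (auto simp: h_def cnjz power_int_diff z0 field_simps)
    also have "\<dots> = (\<Sum>l\<in>{- int L..int L}. \<Sum>x\<in>D l. h x * z powi (int (fst x) - int (snd x)))"
      unfolding D_def by (rule sum.group[symmetric]) auto
    also have "\<dots> = (\<Sum>l\<in>{- int L..int L}. of_real S * (c l * z powi l))"
      using Spos by (intro sum.cong refl) (auto simp: c_def D_def sum_distrib_right)
    finally have eq: "of_real S * (\<Sum>l\<in>{- int L..int L}. c l * z powi l) = poly p z * cnj (poly p z)"
      by (simp add: sum_distrib_left)
    have geo: "norm (\<Sum>i<n. z ^ i) \<le> 2 / norm (1 - z)"
    proof -
      have "(\<Sum>i<n. z ^ i) = (1 - z ^ n) / (1 - z)" using z by (simp add: sum_gp_strict)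
      moreover have "norm (1 - z ^ n) \<le> 1 + 1"
        by (intro order_trans[OF norm_triangle_ineq4]) (simp add: norm_power z)
      ultimately show ?thesis using z by (simp add: norm_divide divide_right_mono)
    qed
    have "S * norm (\<Sum>l\<in>{- int L..int L}. c l * z powi l) = norm (poly p z) ^ 2"
      using arg_cong[OF eq, of norm] Spos by (simp add: norm_mult power2_eq_square)
    also have "\<dots> = norm (\<Sum>i<n. z ^ i) ^ (2 * m)"
      by (simp add: pz' norm_power mult.commute flip: power_mult)
    also have "\<dots> \<le> (2 / norm (1 - z)) ^ (2 * m)" by (intro power_mono geo) auto
    finally have "norm (\<Sum>l\<in>{- int L..int L}. c l * z powi l) \<le> (2 / norm (1 - z)) ^ (2 * m) / S"
      using Spos by (simp add: pos_le_divide_eq mult.commute)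
    also have "\<dots> \<le> (2 / norm (1 - z)) ^ (2 * m) / (real n ^ (2 * m) / real L)"
      using S L n Spos by (intro divide_left_mono) (auto simp: field_simps)
    also have "\<dots> = real L * (2 / (real n * norm (1 - z))) ^ (2 * m)"
      by (simp add: power_divide power_mult_distrib mult.commute)
    finally show "norm (\<Sum>l\<in>{- int (n * m)..int (n * m)}. c l * z powi l)
         \<le> real (n * m) * (2 / (real n * norm (1 - z))) ^ (2 * m)"
      by (simp add: L_def)
  qed
qed

text \<open>
  A substitute for the Hoelder inequality: summed over \<open>n\<close> values it costs \<open>n \<tau>\<close> and \<open>\<tau> powr (1 - q)\<close> times the
  sum of the \<open>q\<close>-th powers.
\<close>

lemma le_threshold_plus_powr:
  fixes a \<tau> q :: real
  assumes "a \<ge> 0" "\<tau> > 0" "q \<ge> 1"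
  shows "a \<le> \<tau> + \<tau> powr (1 - q) * a powr q"
proof (cases "a \<le> \<tau>")
  case True
  then show ?thesis by (simp add: add_increasing2)
next
  case False
  then have a: "a > \<tau>" "a > 0" using assms by auto
  have "a = a powr (1 - q) * a powr q" using a by (simp flip: powr_add)
  also have "\<dots> \<le> \<tau> powr (1 - q) * a powr q"
    using a assms by (intro mult_right_mono powr_mono2') auto
  finally show ?thesis using assms by simp
qed

section \<open>A criterion for non-integrability of the Fourier transform\<close>

text \<open>
  Integrating the average of the functions \<open>\<Sum>l. c l e^(i l N_j x)\<close>, times \<open>e^(-i t x)\<close>, isolates the value
  at \<open>t\<close> (the terms \<open>l = 0\<close>) up to a weighted sum of values at translates, each with weight at most \<open>1 / card J\<close>.
\<close>

lemma fourier_translates_estimate: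
  assumes mu: "complex_borel_measure \<mu>"
    and V: "\<And>f B. f \<in> borel_measurable borel \<Longrightarrow> (\<And>x. x \<in> E \<Longrightarrow> norm (f x) \<le> B)
           \<Longrightarrow> norm (complex_measure_integral \<mu> f) \<le> V * B"
    and c: "c 0 = 1" "\<And>l. norm (c l) \<le> 1"
    and J: "finite J" "J \<noteq> {}"
    and small: "\<And>x j. x \<in> E \<Longrightarrow> j \<in> J \<Longrightarrow>
       norm (\<Sum>l\<in>{- int L..int L}. c l * character (- (real_of_int l * real (N j))) x) \<le> \<epsilon>"
    and q: "q \<ge> 1" and \<tau>: "\<tau> > 0"
  shows "norm (fourier_transform \<mu> t) \<le> V * \<epsilon> + 2 * real L * \<tau> + \<tau> powr (1 - q) / real (card J) *
     (\<Sum>(l, j)\<in>({- int L..int L} - {0}) \<times> J. norm (fourier_transform \<mu> (t - real_of_int l * real (N j))) powr q)"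
proof -
  let ?I = "{- int L..int L}" and ?K = "({- int L..int L} - {0}) \<times> J"
  let ?M = "real (card J)"
  let ?F = "fourier_transform \<mu>"
  let ?s = "\<lambda>l j. real_of_int l * real (N j)"
  have M: "?M > 0" using J by (simp add: card_gt_0_iff)
  \<comment> \<open>The test function \<open>G(x) e^(-i t x)\<close>, expanded into characters.\<close>
  define f where "f = (\<lambda>x. \<Sum>(l, j)\<in>?I \<times> J. (c l / ?M) * character (t - ?s l j) x)"
  have f_eq: "f x = character t x * (\<Sum>j\<in>J. \<Sum>l\<in>?I. c l * character (- ?s l j) x) / ?M" for x
  proof -
    have "f x = (\<Sum>l\<in>?I. \<Sum>j\<in>J. (c l / ?M) * character (t - ?s l j) x)"
      by (simp add: f_def sum.cartesian_product)
    also have "\<dots> = (\<Sum>j\<in>J. \<Sum>l\<in>?I. (c l / ?M) * character (t - ?s l j) x)"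
      by (rule sum.swap)
    also have "\<dots> = (\<Sum>j\<in>J. \<Sum>l\<in>?I. character t x * (c l * character (- ?s l j) x) / ?M)"
      using character_add[of t "- ?s _ _" x] by (intro sum.cong refl) (simp add: algebra_simps)
    finally show ?thesis by (simp add: sum_distrib_left flip: sum_divide_distrib)
  qed
  have "norm (f x) \<le> \<epsilon>" if "x \<in> E" for x
  proof -
    have "norm (\<Sum>j\<in>J. \<Sum>l\<in>?I. c l * character (- ?s l j) x) \<le> (\<Sum>j\<in>J. \<epsilon>)"
      by (rule sum_norm_le) (rule small[OF that])
    then show ?thesis using M unfolding f_eq by (simp add: norm_mult norm_divide field_simps)
  qed
  then have 1: "norm (complex_measure_integral \<mu> f) \<le> V * \<epsilon>"
    by (intro V) (auto simp: f_def)
  have "complex_measure_integral \<mu> f = (\<Sum>(l, j)\<in>?I \<times> J. (c l / ?M) * ?F (t - ?s l j))"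
    unfolding f_def split_def fourier_transform_character
    using J by (intro complex_measure_integral_sum mu) auto
  also have "?I \<times> J = ({0} \<times> J) \<union> ?K" by auto
  also have "(\<Sum>(l, j)\<in>({0} \<times> J) \<union> ?K. (c l / ?M) * ?F (t - ?s l j))
      = (\<Sum>(l, j)\<in>{0} \<times> J. (c l / ?M) * ?F (t - ?s l j)) + (\<Sum>(l, j)\<in>?K. (c l / ?M) * ?F (t - ?s l j))"
    using J by (intro sum.union_disjoint) auto
  also have "(\<Sum>(l, j)\<in>{0} \<times> J. (c l / ?M) * ?F (t - ?s l j)) = ?F t"
    using M c(1) by (simp add: sum.cartesian_product[symmetric])
  finally have eq: "?F t = complex_measure_integral \<mu> f - (\<Sum>(l, j)\<in>?K. (c l / ?M) * ?F (t - ?s l j))"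
    by simp
  have cardK: "real (card ?K) = 2 * real L * ?M"
  proof -
    have "card ({- int L..int L} - {0}) = 2 * L" by (subst card_Diff_subset) auto
    then show ?thesis by (simp add: card_cartesian_product)
  qed
  have "norm (\<Sum>(l, j)\<in>?K. (c l / ?M) * ?F (t - ?s l j))
      \<le> (\<Sum>(l, j)\<in>?K. (\<tau> + \<tau> powr (1 - q) * norm (?F (t - ?s l j)) powr q) / ?M)"
    unfolding split_def
  proof (rule sum_norm_le)
    fix x
    let ?a = "norm (?F (t - ?s (fst x) (snd x)))"
    have "norm (c (fst x) / ?M * ?F (t - ?s (fst x) (snd x))) = norm (c (fst x)) * ?a / ?M"
      by (simp add: norm_mult norm_divide)
    also have "\<dots> \<le> ?a / ?M"
      using M mult_right_mono[OF c(2)[of "fst x"], of ?a] by (intro divide_right_mono) auto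
    also have "\<dots> \<le> (\<tau> + \<tau> powr (1 - q) * ?a powr q) / ?M"
      using le_threshold_plus_powr[OF _ \<tau> q, of ?a] M by (intro divide_right_mono) auto
    finally show "norm (c (fst x) / ?M * ?F (t - ?s (fst x) (snd x))) \<le> \<dots>" .
  qed
  also have "\<dots> = real (card ?K) * \<tau> / ?M
      + \<tau> powr (1 - q) / ?M * (\<Sum>(l, j)\<in>?K. norm (?F (t - ?s l j)) powr q)"
    by (simp add: split_def add_divide_distrib sum.distrib sum_distrib_left flip: sum_divide_distrib)
  also have "real (card ?K) * \<tau> / ?M = 2 * real L * \<tau>" using M by (simp add: cardK)
  finally show ?thesis
    using 1 unfolding eq by (intro order_trans[OF norm_triangle_ineq4]) linarith
qed

text \<open>
  Distinct integer shifts move a half-open unit interval to disjoint intervals.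
\<close>

lemma nn_integral_translates_le:
  fixes f :: "real \<Rightarrow> ennreal"
  assumes [measurable]: "f \<in> borel_measurable borel"
    and "finite K" and inj: "inj_on s K"
  shows "(\<Sum>i\<in>K. \<integral>\<^sup>+t. f (t - real_of_int (s i)) * indicator {u..<u + 1} t \<partial>lborel) \<le> (\<integral>\<^sup>+t. f t \<partial>lborel)"
proof -
  have "(\<Sum>i\<in>K. \<integral>\<^sup>+t. f (t - real_of_int (s i)) * indicator {u..<u + 1} t \<partial>lborel)
      = (\<Sum>i\<in>K. \<integral>\<^sup>+t. f t * indicator {u - real_of_int (s i)..<u - real_of_int (s i) + 1} t \<partial>lborel)"
  proof (intro sum.cong refl)
    fix i
    let ?s = "real_of_int (s i)"
    have "(\<integral>\<^sup>+t. f t * indicator {u - ?s..<u - ?s + 1} t \<partial>lborel)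
        = ennreal \<bar>1\<bar> * (\<integral>\<^sup>+t. f (- ?s + 1 * t) * indicator {u - ?s..<u - ?s + 1} (- ?s + 1 * t) \<partial>lborel)"
      by (rule nn_integral_real_affine) auto
    also have "\<dots> = (\<integral>\<^sup>+t. f (t - ?s) * indicator {u..<u + 1} t \<partial>lborel)"
      by (auto intro!: nn_integral_cong simp: indicator_def)
    finally show "(\<integral>\<^sup>+t. f (t - ?s) * indicator {u..<u + 1} t \<partial>lborel)
        = (\<integral>\<^sup>+t. f t * indicator {u - ?s..<u - ?s + 1} t \<partial>lborel)" ..
  qed
  also have "\<dots> = (\<integral>\<^sup>+t. (\<Sum>i\<in>K. f t * indicator {u - real_of_int (s i)..<u - real_of_int (s i) + 1} t) \<partial>lborel)"
    by (rule nn_integral_sum[symmetric]) auto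
  also have "\<dots> \<le> (\<integral>\<^sup>+t. f t \<partial>lborel)"
  proof (rule nn_integral_mono)
    fix t
    let ?A = "\<lambda>i. {u - real_of_int (s i)..<u - real_of_int (s i) + 1}"
    have dis: "disjoint_family_on ?A K"
    proof (unfold disjoint_family_on_def, intro ballI impI)
      fix i j assume "i \<in> K" "j \<in> K" "i \<noteq> j"
      then have "s i \<noteq> s j" using inj by (auto simp: inj_on_def)
      then consider "s i + 1 \<le> s j" | "s j + 1 \<le> s i" by linarith
      then show "?A i \<inter> ?A j = {}" by cases auto
    qed
    have "(\<Sum>i\<in>K. f t * indicator (?A i) t) = f t * indicator (\<Union>i\<in>K. ?A i) t"
      by (subst indicator_UN_disjoint[OF assms(2) dis]) (simp add: sum_distrib_left)
    also have "\<dots> \<le> f t * 1" by (intro mult_left_mono) (auto simp: indicator_def)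
    finally show "(\<Sum>i\<in>K. f t * indicator (?A i) t) \<le> f t" by simp
  qed
  finally show ?thesis .
qed

text \<open>
  The pointwise estimate is integrated over a unit interval in \<open>t\<close>. As the shifts \<open>l N_j\<close> are distinct integers, the
  \<open>q\<close>-th powers contribute at most the full \<open>L^q\<close> integral, multiplied by a factor that tends to 0; hence
  the transform vanishes almost everywhere, and everywhere by continuity.
\<close>

lemma fourier_transform_eq_0_criterion:
  assumes mu: "\<mu> \<in> measures_on E" and E: "E \<in> sets borel"
    and q: "q \<ge> 1"
    and Lq: "(\<integral>\<^sup>+ \<xi>. ennreal (norm (fourier_transform \<mu> \<xi>) powr q) \<partial>lborel) < \<infinity>"
    and c: "\<And>k. c k 0 = 1" "\<And>k l. norm (c k l) \<le> 1"
    and J: "\<And>k. finite (J k)" "\<And>k. J k \<noteq> {}"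
    and inj: "\<And>k. inj_on (\<lambda>(l, j). l * int (N k j)) (({- int (L k)..int (L k)} - {0}) \<times> J k)"
    and small: "\<And>k x j. x \<in> E \<Longrightarrow> j \<in> J k \<Longrightarrow>
       norm (\<Sum>l\<in>{- int (L k)..int (L k)}. c k l * character (- (real_of_int l * real (N k j))) x) \<le> \<epsilon> k"
    and \<tau>: "\<And>k. \<tau> k > 0"
    and lim: "\<epsilon> \<longlonglongrightarrow> 0" "(\<lambda>k. real (L k) * \<tau> k) \<longlonglongrightarrow> 0"
      "(\<lambda>k. \<tau> k powr (1 - q) / real (card (J k))) \<longlonglongrightarrow> 0"
  shows "fourier_transform \<mu> t = 0"
proof -
  have cm: "complex_borel_measure \<mu>" using mu by (simp add: measures_on_def)
  let ?F = "fourier_transform \<mu>"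
  have contF: "continuous_on UNIV ?F" by (rule continuous_on_fourier_transform[OF cm])
  then have [measurable]: "?F \<in> borel_measurable borel" by (rule borel_measurable_continuous_onI)
  obtain V where V0: "V \<ge> 0" and V: "\<And>f B. f \<in> borel_measurable borel \<Longrightarrow> (\<And>x. x \<in> E \<Longrightarrow> norm (f x) \<le> B)
           \<Longrightarrow> norm (complex_measure_integral \<mu> f) \<le> V * B"
    using complex_measure_integral_bound[OF mu E] by blast
  define X where "X = (\<integral>\<^sup>+ \<xi>. ennreal (norm (?F \<xi>) powr q) \<partial>lborel)"
  obtain x where x: "X = ennreal x" "x \<ge> 0" using Lq by (cases X) (auto simp: X_def)
  have zero: "(\<integral>\<^sup>+t. ennreal (norm (?F t)) * indicator {u..<u + 1} t \<partial>lborel) = 0" for u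
  proof -
    define r where "r k = \<bar>V * \<epsilon> k\<bar> + 2 * (real (L k) * \<tau> k) + \<tau> k powr (1 - q) / real (card (J k)) * x" for k
    have bound: "(\<integral>\<^sup>+t. ennreal (norm (?F t)) * indicator {u..<u + 1} t \<partial>lborel) \<le> ennreal (r k)" for k
    proof -
      define K where "K = ({- int (L k)..int (L k)} - {0}) \<times> J k"
      define s where "s = (\<lambda>(l, j). l * int (N k j))"
      have finK: "finite K" using J by (simp add: K_def)
      have s_inj: "inj_on s K" using inj by (simp add: K_def s_def)
      define C where "C = \<bar>V * \<epsilon> k\<bar> + 2 * (real (L k) * \<tau> k)"
      define D where "D = \<tau> k powr (1 - q) / real (card (J k))"
      have C0: "C \<ge> 0" and D0: "D \<ge> 0" using \<tau>[of k] by (auto simp: C_def D_def)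
      let ?g = "\<lambda>t. ennreal (norm (?F t) powr q)"
      let ?ind = "\<lambda>t. indicator {u..<u + 1} t :: ennreal"
      have pt: "ennreal (norm (?F t)) \<le> ennreal C + ennreal D * (\<Sum>i\<in>K. ?g (t - real_of_int (s i)))" for t
      proof -
        have "norm (?F t) \<le> V * \<epsilon> k + 2 * real (L k) * \<tau> k + D *
            (\<Sum>(l, j)\<in>K. norm (?F (t - real_of_int l * real (N k j))) powr q)"
          unfolding K_def D_def
          by (rule fourier_translates_estimate[OF cm V c J small q \<tau>])
        also have "\<dots> \<le> C + D * (\<Sum>i\<in>K. norm (?F (t - real_of_int (s i))) powr q)"
          by (simp add: C_def s_def split_def)
        finally have "ennreal (norm (?F t)) \<le> ennreal (C + D * (\<Sum>i\<in>K. norm (?F (t - real_of_int (s i))) powr q))"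
          by (rule ennreal_leI)
        also have "\<dots> = ennreal C + ennreal D * (\<Sum>i\<in>K. ?g (t - real_of_int (s i)))"
          using C0 D0 by (subst ennreal_plus) (auto simp: ennreal_mult sum_nonneg)
        finally show ?thesis .
      qed
      have "(\<integral>\<^sup>+t. ennreal (norm (?F t)) * ?ind t \<partial>lborel)
          \<le> (\<integral>\<^sup>+t. ennreal C * ?ind t + ennreal D * (\<Sum>i\<in>K. ?g (t - real_of_int (s i)) * ?ind t) \<partial>lborel)"
        by (intro nn_integral_mono) (use pt in \<open>auto simp: indicator_def\<close>)
      also have "\<dots> = ennreal C * (\<integral>\<^sup>+t. ?ind t \<partial>lborel)
          + ennreal D * (\<Sum>i\<in>K. \<integral>\<^sup>+t. ?g (t - real_of_int (s i)) * ?ind t \<partial>lborel)"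
        by (simp add: nn_integral_add nn_integral_cmult nn_integral_sum)
      also have "\<dots> \<le> ennreal C * 1 + ennreal D * X"
        unfolding X_def
        by (intro add_mono mult_left_mono nn_integral_translates_le finK s_inj) auto
      also have "\<dots> = ennreal (r k)"
      proof -
        have "ennreal C * 1 + ennreal D * X = ennreal (C + D * x)"
          using C0 D0 x(2) unfolding x(1) by (subst ennreal_plus) (auto simp: ennreal_mult)
        then show ?thesis by (simp add: r_def C_def D_def)
      qed
      finally show ?thesis .
    qed
    have "r \<longlonglongrightarrow> \<bar>V * 0\<bar> + 2 * 0 + 0 * x"
      unfolding r_def by (intro tendsto_intros lim)
    then have "(\<lambda>k. ennreal (r k)) \<longlonglongrightarrow> ennreal 0" by (intro tendsto_ennrealI) simp
    then have "(\<integral>\<^sup>+t. ennreal (norm (?F t)) * indicator {u..<u + 1} t \<partial>lborel) \<le> ennreal 0"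
      by (rule LIMSEQ_le_const) (use bound in auto)
    then show ?thesis by simp
  qed
  define U where "U = {s. ?F s \<noteq> 0} \<inter> {t - 1/2<..<t + 1/2}"
  have "open {s. ?F s \<noteq> 0}"
    using contF by (intro open_Collect_neq continuous_intros)
  then have "open U" by (simp add: U_def open_Int)
  have "AE s in lborel. ennreal (norm (?F s)) * indicator {t - 1/2..<t - 1/2 + 1} s = 0"
    using zero[of "t - 1/2"] by (subst (asm) nn_integral_0_iff_AE) auto
  then have "AE s in lborel. s \<notin> U"
    by eventually_elim (auto simp: U_def)
  then have "emeasure lborel U = 0"
    using \<open>open U\<close> by (subst (asm) AE_iff_measurable[of U]) auto
  then have "negligible U"
    using \<open>open U\<close> by (simp add: negligible_iff_emeasure0 completion.complete emeasure_completion)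
  then have "U = {}" using \<open>open U\<close> open_not_negligible by blast
  then show ?thesis by (auto simp: U_def)
qed

text \<open>
  This reduces exponents \<open>q < 1\<close> to \<open>q = 1\<close>, where the threshold inequality is available.
\<close>

lemma powr_integrable_larger_exponent:
  fixes f :: "real \<Rightarrow> complex"
  assumes [measurable]: "f \<in> borel_measurable borel" and bd: "\<And>x. norm (f x) \<le> B"
    and q: "0 < q" "q \<le> p"
    and fin: "(\<integral>\<^sup>+x. ennreal (norm (f x) powr q) \<partial>lborel) < \<infinity>"
  shows "(\<integral>\<^sup>+x. ennreal (norm (f x) powr p) \<partial>lborel) < \<infinity>"
proof -
  have "norm (f x) powr p \<le> B powr (p - q) * norm (f x) powr q" for x
  proof -
    have "norm (f x) powr p = norm (f x) powr (p - q) * norm (f x) powr q"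
      by (simp flip: powr_add)
    also have "\<dots> \<le> B powr (p - q) * norm (f x) powr q"
      using bd q by (intro mult_right_mono powr_mono2) auto
    finally show ?thesis .
  qed
  then have "(\<integral>\<^sup>+x. ennreal (norm (f x) powr p) \<partial>lborel)
      \<le> (\<integral>\<^sup>+x. ennreal (B powr (p - q)) * ennreal (norm (f x) powr q) \<partial>lborel)"
    by (intro nn_integral_mono) (auto simp flip: ennreal_mult intro!: ennreal_leI)
  also have "\<dots> = ennreal (B powr (p - q)) * (\<integral>\<^sup>+x. ennreal (norm (f x) powr q) \<partial>lborel)"
    by (rule nn_integral_cmult) auto
  also have "\<dots> < \<infinity>" using fin by (simp add: ennreal_mult_less_top)
  finally show ?thesis .
qed

section \<open>Bounded analytic functions on the disc and one-sided spectra\<close>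

text \<open>
  Finitely many boundary discontinuities are admitted, because the functions used below take a default value at isolated
  points of the circle.
\<close>

definition disc_functions :: "(complex \<Rightarrow> complex) set" where
  "disc_functions = {G. G holomorphic_on ball 0 1 \<and> (\<forall>z\<in>cball 0 1. norm (G z) \<le> 1) \<and>
     (\<exists>S. finite S \<and> continuous_on (cball 0 1 - S) G)}"

lemma disc_functions_one: "(\<lambda>_. 1) \<in> disc_functions"
  by (auto simp: disc_functions_def)

lemma disc_functions_mult:
  assumes "F \<in> disc_functions" "G \<in> disc_functions"
  shows "(\<lambda>z. F z * G z) \<in> disc_functions"
proof -
  obtain S T where S: "finite S" "continuous_on (cball 0 1 - S) F"
    and T: "finite T" "continuous_on (cball 0 1 - T) G"
    using assms by (auto simp: disc_functions_def)
  have "continuous_on (cball 0 1 - (S \<union> T)) (\<lambda>z. F z * G z)"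
    by (intro continuous_on_mult continuous_on_subset[OF S(2)] continuous_on_subset[OF T(2)]) auto
  moreover have "norm (F z * G z) \<le> 1" if "norm z \<le> 1" for z
    using assms that mult_mono[of "norm (F z)" 1 "norm (G z)" 1]
    by (auto simp: disc_functions_def norm_mult)
  ultimately show ?thesis
    using assms S(1) T(1) unfolding disc_functions_def
    by (auto intro!: holomorphic_on_mult exI[of _ "S \<union> T"])
qed

lemma disc_functions_power:
  assumes "G \<in> disc_functions" and N: "N > 0"
  shows "(\<lambda>z. G (z ^ N)) \<in> disc_functions"
proof -
  obtain S where S: "finite S" "continuous_on (cball 0 1 - S) G"
    using assms by (auto simp: disc_functions_def)
  let ?S = "(\<lambda>z. z ^ N) -` S"
  have "?S = (\<Union>w\<in>S. {z. z ^ N = w})" by auto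
  then have fin: "finite ?S" using S(1) finite_nth_roots[OF N] by simp
  have le: "norm z ^ N \<le> 1" if "norm z \<le> 1" for z :: complex
    using that by (simp add: power_le_one)
  have lt: "norm z ^ N < 1" if "norm z < 1" for z :: complex
    using that N power_strict_mono[of "norm z" 1 N] by simp
  have "continuous_on (cball 0 1 - ?S) (G \<circ> (\<lambda>z. z ^ N))"
    by (intro continuous_on_compose continuous_intros continuous_on_subset[OF S(2)])
       (auto simp: norm_power le)
  moreover have "(G \<circ> (\<lambda>z. z ^ N)) holomorphic_on ball 0 1"
  proof (rule holomorphic_on_compose_gen)
    show "G holomorphic_on ball 0 1" using assms by (simp add: disc_functions_def)
  qed (auto intro!: holomorphic_intros simp: norm_power lt)
  ultimately show ?thesis
    using assms(1) fin le by (auto simp: disc_functions_def o_def norm_power)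
qed

lemma disc_functions_prod:
  assumes "finite I" "\<And>i. i \<in> I \<Longrightarrow> F i \<in> disc_functions"
  shows "(\<lambda>z. \<Prod>i\<in>I. F i z) \<in> disc_functions"
  using assms by (induction rule: finite_induct) (auto intro!: disc_functions_one disc_functions_mult)

definition radius_seq :: "nat \<Rightarrow> real" where "radius_seq n = 1 - 1 / real (Suc n)"

lemma radius_seq_nonneg: "radius_seq n \<ge> 0" and radius_seq_less_1: "radius_seq n < 1"
  by (auto simp: radius_seq_def)

lemma norm_radius_seq_character [simp]: "norm (of_real (radius_seq n) * character \<xi> x) = radius_seq n"
  using radius_seq_nonneg[of n] by (simp add: norm_mult)

lemma radius_seq_tendsto: "radius_seq \<longlonglongrightarrow> 1"
  unfolding radius_seq_def using tendsto_diff[OF tendsto_const LIMSEQ_inverse_real_of_nat]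
  by (simp add: inverse_eq_divide)

text \<open>
  Continuity on the closed disc fails only at finitely many boundary points, and each is
  hit by countably many parameters.
\<close>

lemma disc_functions_boundary_limit:
  assumes G: "G \<in> disc_functions"
  shows "AE x in lborel. (\<lambda>n. G (of_real (radius_seq n) * character 1 x)) \<longlonglongrightarrow> G (character 1 x)"
proof -
  obtain S where S: "finite S" "continuous_on (cball 0 1 - S) G"
    using assms by (auto simp: disc_functions_def)
  have "countable (\<Union>z\<in>S. {x. character 1 x = z})"
  proof (intro countable_UN countable_finite[OF S(1)])
    fix z
    show "countable {x. character 1 x = z}"
    proof (cases "\<exists>y. character 1 y = z")
      case True
      then obtain y where y: "character 1 y = z" by blast
      have "{x. character 1 x = z} \<subseteq> range (\<lambda>n::int. y + 2 * pi * of_int n)"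
      proof
        fix x assume "x \<in> {x. character 1 x = z}"
        then have "character 1 x = character 1 y" using y by simp
        then obtain n :: int where "- \<i> * complex_of_real x = - \<i> * complex_of_real y + (of_int (2 * n) * pi) * \<i>"
          unfolding character_def by (auto simp: exp_eq)
        then have "x = y + 2 * pi * of_int (- n)"
          by (auto simp: complex_eq_iff algebra_simps)
        then show "x \<in> range (\<lambda>n::int. y + 2 * pi * of_int n)" by blast
      qed
      then show ?thesis by (rule countable_subset) auto
    qed auto
  qed
  then have "AE x in lborel. x \<notin> (\<Union>z\<in>S. {x. character 1 x = z})"
    by (intro AE_not_in countable_imp_null_set_lborel)
  then show ?thesis
  proof eventually_elim
    case (elim x)
    let ?z = "\<lambda>n. of_real (radius_seq n) * character 1 x"
    have lim: "?z \<longlonglongrightarrow> of_real 1 * character 1 x"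
      by (intro tendsto_intros radius_seq_tendsto)
    then have lim: "?z \<longlonglongrightarrow> character 1 x" by simp
    have mem: "?z n \<in> cball 0 1" for n
      using radius_seq_less_1[of n] by simp
    have nz: "character 1 x \<in> cball 0 1 - S" using elim by auto
    have "open (- S)" using S(1) by (simp add: finite_imp_closed open_Compl)
    then have "\<forall>\<^sub>F n in sequentially. ?z n \<in> - S"
      using lim nz by (intro topological_tendstoD[OF lim]) auto
    then have ev: "\<forall>\<^sub>F n in sequentially. ?z n \<in> cball 0 1 - S"
      by eventually_elim (use mem in auto)
    show ?case
      by (rule continuous_on_tendsto_compose[OF S(2) lim nz ev])
  qed
qed

lemma disc_functions_boundary_measurable:
  assumes G: "G \<in> disc_functions"
  shows "(\<lambda>x. G (character 1 x)) \<in> borel_measurable borel"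
proof -
  obtain S where S: "finite S" "continuous_on (cball 0 1 - S) G"
    using assms by (auto simp: disc_functions_def)
  have Sb: "cball 0 1 - S \<in> sets borel" using S(1) by (auto simp: finite_imp_closed)
  have 1: "(\<lambda>z. indicator (cball 0 1 - S) z *\<^sub>R G z) \<in> borel_measurable borel"
    by (rule borel_measurable_continuous_on_indicator[OF Sb S(2)])
  have "(\<lambda>z. (\<Sum>s\<in>S. indicator {s} z *\<^sub>R G s)) \<in> borel_measurable borel" by measurable
  then have "(\<lambda>x. indicator (cball 0 1 - S) (character 1 x) *\<^sub>R G (character 1 x) +
      (\<Sum>s\<in>S. indicator {s} (character 1 x) *\<^sub>R G s)) \<in> borel_measurable borel"
    using measurable_compose[OF character_measurable 1] by measurable
  also have "(\<lambda>x. indicator (cball 0 1 - S) (character 1 x) *\<^sub>R G (character 1 x) +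
      (\<Sum>s\<in>S. indicator {s} (character 1 x) *\<^sub>R G s)) = (\<lambda>x. G (character 1 x))"
  proof
    fix x
    have "(\<Sum>s\<in>S. indicator {s} (character 1 x) *\<^sub>R G s)
        = (\<Sum>s\<in>S. if s = character 1 x then G s else 0)"
      by (intro sum.cong) (auto simp: indicator_def)
    then show "indicator (cball 0 1 - S) (character 1 x) *\<^sub>R G (character 1 x) +
      (\<Sum>s\<in>S. indicator {s} (character 1 x) *\<^sub>R G s) = G (character 1 x)"
      using S(1) by (auto simp: indicator_def)
  qed
  finally show ?thesis .
qed

lemma character_power: "character \<xi> x ^ n = character (real n * \<xi>) x"
  by (simp add: character_def algebra_simps flip: exp_of_nat_mult)

text \<open>
  On smaller circles a function of the class is given by its power series, whose coefficients are bounded by 1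
  by Cauchy's inequality. So its integral against \<open>v\<close> involves only the values of the transform of \<open>v\<close> at
  nonnegative integers.
\<close>

lemma disc_function_pairing_limit:
  fixes v :: "real \<Rightarrow> complex"
  assumes G: "G \<in> disc_functions" and v: "integrable lborel v"
  obtains a where "a 0 = G 0" "\<And>m. norm (a m) \<le> 1"
    "\<And>n. (\<lambda>m. a m * of_real (radius_seq n) ^ m * fourier_of v (real m)) sums
        (\<integral>x. G (of_real (radius_seq n) * character 1 x) * v x \<partial>lborel)"
    "(\<lambda>n. \<integral>x. G (of_real (radius_seq n) * character 1 x) * v x \<partial>lborel)
        \<longlonglongrightarrow> (\<integral>x. G (character 1 x) * v x \<partial>lborel)"
proof -
  define a where "a m = (deriv ^^ m) G 0 / fact m" for m
  have hol: "G holomorphic_on ball 0 1" and bd: "\<And>z. norm z \<le> 1 \<Longrightarrow> norm (G z) \<le> 1"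
    using G by (auto simp: disc_functions_def)
  have a1: "norm (a m) \<le> 1" for m
  proof -
    have "norm (a m) * r ^ m \<le> 1" if r: "0 < r" "r < 1" for r
    proof -
      have "norm ((deriv ^^ m) G 0) \<le> fact m * 1 / r ^ m"
      proof (rule Cauchy_inequality)
        show "G holomorphic_on ball 0 r" using hol r by (rule_tac holomorphic_on_subset) auto
        show "continuous_on (cball 0 r) G"
          using hol r by (intro holomorphic_on_imp_continuous_on holomorphic_on_subset[OF hol]) auto
        show "norm (G x) \<le> 1" if "norm (0 - x) = r" for x using that r bd by auto
      qed (use r in auto)
      then show ?thesis using r by (simp add: a_def norm_divide field_simps)
    qed
    moreover have "((\<lambda>r. norm (a m) * r ^ m) \<longlongrightarrow> norm (a m) * 1 ^ m) (at_left 1)"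
      by (intro tendsto_intros)
    moreover have "\<forall>\<^sub>F r in at_left (1::real). 0 < r \<and> r < 1"
      unfolding eventually_at_left[OF zero_less_one] by (intro exI[of _ 0]) auto
    ultimately show ?thesis
      by (intro tendsto_upperbound[of "\<lambda>r. norm (a m) * r ^ m" _ "at_left 1"])
         (auto elim!: eventually_mono)
  qed
  have ser: "(\<lambda>m. a m * z ^ m) sums G z" if "norm z < 1" for z
    using holomorphic_power_series[OF hol, of z] that by (simp add: a_def)
  have [measurable]: "v \<in> borel_measurable borel" using v by auto
  show ?thesis
  proof (rule that[of a])
    show "a 0 = G 0" by (simp add: a_def)
    show "norm (a m) \<le> 1" for m by (rule a1)
    fix n
    define r where "r = radius_seq n"
    have r: "0 \<le> r" "r < 1" by (auto simp: r_def radius_seq_nonneg radius_seq_less_1)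
    define f where "f m x = a m * of_real r ^ m * (v x * character (real m) x)" for m x
    have int_f: "integrable lborel (f m)" for m
      unfolding f_def
      by (intro integrable_mult_right, rule Bochner_Integration.integrable_bound[OF v])
         (auto simp: norm_mult)
    have norm_f: "norm (f m x) \<le> norm (v x) * r ^ m" for m x
      using a1[of m] r mult_mono[of "norm (a m)" 1 "r ^ m * norm (v x)" "r ^ m * norm (v x)"]
      by (simp add: f_def norm_mult norm_power algebra_simps)
    have sum_r: "summable (\<lambda>m. norm (v x) * r ^ m)" for x
      using r by (intro summable_mult summable_geometric) auto
    have "(\<lambda>m. \<integral>x. f m x \<partial>lborel) sums (\<integral>x. (\<Sum>m. f m x) \<partial>lborel)"
    proof (rule sums_integral[OF int_f])
      show "AE x in lborel. summable (\<lambda>m. norm (f m x))"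
        by (intro AE_I2 summable_comparison_test'[OF sum_r]) (use norm_f in auto)
      show "summable (\<lambda>m. \<integral>x. norm (f m x) \<partial>lborel)"
      proof (rule summable_comparison_test')
        show "summable (\<lambda>m. (\<integral>x. norm (v x) \<partial>lborel) * r ^ m)"
          using r by (intro summable_mult summable_geometric) auto
        show "norm (\<integral>x. norm (f m x) \<partial>lborel) \<le> (\<integral>x. norm (v x) \<partial>lborel) * r ^ m" for m
        proof -
          have "(\<integral>x. norm (f m x) \<partial>lborel) \<le> (\<integral>x. norm (v x) * r ^ m \<partial>lborel)"
            using norm_f int_f v by (intro integral_mono) auto
          then show ?thesis by simp
        qed
      qed
    qed
    also have "(\<integral>x. (\<Sum>m. f m x) \<partial>lborel) = (\<integral>x. G (of_real r * character 1 x) * v x \<partial>lborel)"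
    proof (intro Bochner_Integration.integral_cong refl)
      fix x
      have "(\<lambda>m. a m * (of_real r * character 1 x) ^ m * v x) sums (G (of_real r * character 1 x) * v x)"
        using r by (intro sums_mult2 ser) (simp add: norm_mult)
      moreover have "a m * (of_real r * character 1 x) ^ m * v x = f m x" for m
        by (simp add: f_def power_mult_distrib character_power)
      ultimately show "(\<Sum>m. f m x) = G (of_real r * character 1 x) * v x"
        by (simp add: sums_iff)
    qed
    also have "(\<lambda>m. \<integral>x. f m x \<partial>lborel) = (\<lambda>m. a m * of_real r ^ m * fourier_of v (real m))"
      by (simp add: f_def fourier_of_def)
    finally show "(\<lambda>m. a m * of_real (radius_seq n) ^ m * fourier_of v (real m)) sums
        (\<integral>x. G (of_real (radius_seq n) * character 1 x) * v x \<partial>lborel)"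
      by (simp add: r_def)
  next
    have meas: "(\<lambda>x. G (of_real (radius_seq n) * character 1 x) * v x) \<in> borel_measurable lborel" for n
    proof -
      have "continuous_on UNIV (\<lambda>x. G (of_real (radius_seq n) * character 1 x))"
        unfolding character_def
        by (intro continuous_on_compose2[OF holomorphic_on_imp_continuous_on[OF hol]] continuous_intros)
           (use radius_seq_less_1[of n] norm_radius_seq_character[of n 1, unfolded character_def] in auto)
      then have "(\<lambda>x. G (of_real (radius_seq n) * character 1 x)) \<in> borel_measurable borel"
        by (rule borel_measurable_continuous_onI)
      then show ?thesis by measurable
    qed
    show "(\<lambda>n. \<integral>x. G (of_real (radius_seq n) * character 1 x) * v x \<partial>lborel)
        \<longlonglongrightarrow> (\<integral>x. G (character 1 x) * v x \<partial>lborel)"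
    proof (rule integral_dominated_convergence[where w = "\<lambda>x. norm (v x)"])
      show "(\<lambda>x. G (character 1 x) * v x) \<in> borel_measurable lborel"
        using disc_functions_boundary_measurable[OF G] by measurable
      show "AE x in lborel. (\<lambda>n. G (of_real (radius_seq n) * character 1 x) * v x)
          \<longlonglongrightarrow> G (character 1 x) * v x"
        using disc_functions_boundary_limit[OF G] by eventually_elim (intro tendsto_intros)
      show "AE x in lborel. norm (G (of_real (radius_seq n) * character 1 x) * v x) \<le> norm (v x)" for n
      proof (intro AE_I2)
        fix x
        have "norm (G (of_real (radius_seq n) * character 1 x)) \<le> 1"
          using radius_seq_less_1[of n] by (intro bd) simp
        then show "norm (G (of_real (radius_seq n) * character 1 x) * v x) \<le> norm (v x)"
          using mult_right_mono[of _ 1 "norm (v x)"] by (simp add: norm_mult)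
      qed
    qed (use v meas in auto)
  qed
qed

lemma disc_function_pairing_bound:
  fixes v :: "real \<Rightarrow> complex"
  assumes G: "G \<in> disc_functions" and v: "integrable lborel v"
    and sm: "(\<lambda>m. b m) sums B" and b: "\<And>m. norm (fourier_of v (real m)) \<le> b m"
  shows "norm (\<integral>x. G (character 1 x) * v x \<partial>lborel) \<le> B"
proof -
  obtain a where "a 0 = G 0" and a: "\<And>m. norm (a m) \<le> 1"
    and s: "\<And>n. (\<lambda>m. a m * of_real (radius_seq n) ^ m * fourier_of v (real m)) sums
        (\<integral>x. G (of_real (radius_seq n) * character 1 x) * v x \<partial>lborel)"
    and l: "(\<lambda>n. \<integral>x. G (of_real (radius_seq n) * character 1 x) * v x \<partial>lborel)
        \<longlonglongrightarrow> (\<integral>x. G (character 1 x) * v x \<partial>lborel)"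
    by (rule disc_function_pairing_limit[OF G v], rule that)
  have "norm (\<integral>x. G (of_real (radius_seq n) * character 1 x) * v x \<partial>lborel) \<le> B" for n
  proof -
    let ?r = "radius_seq n"
    have le: "norm (a m * of_real ?r ^ m * fourier_of v (real m)) \<le> b m" for m
    proof -
      have "norm (a m) * (\<bar>?r\<bar> ^ m * norm (fourier_of v (real m))) \<le> 1 * (1 * b m)"
        using a b radius_seq_nonneg[of n] radius_seq_less_1[of n] by (intro mult_mono power_le_one) auto
      then show ?thesis by (simp only: norm_mult norm_power norm_of_real mult_1 mult.assoc)
    qed
    have "norm (\<Sum>m. a m * of_real ?r ^ m * fourier_of v (real m)) \<le> (\<Sum>m. b m)"
      using le sm by (intro norm_suminf_le) (auto simp: sums_iff)
    then show ?thesis using s[of n] sm by (simp add: sums_iff)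
  qed
  then show ?thesis
    by (intro LIMSEQ_le_const2[OF tendsto_norm[OF l]]) auto
qed

lemma integral_character_period:
  "(\<integral>x. indicator {-pi..pi} x *\<^sub>R character (of_int n) x \<partial>lborel) = (if n = 0 then of_real (2 * pi) else 0)"
proof -
  have "set_integrable lborel {-pi..pi} (character (of_int n))"
    unfolding set_integrable_def character_def
    by (intro borel_integrable_atLeastAtMost'[unfolded set_integrable_def] continuous_intros)
  then have "(\<integral>x. indicator {-pi..pi} x *\<^sub>R character (of_int n) x \<partial>lborel)
      = integral {-pi..pi} (character (of_int n))"
    using set_borel_integral_eq_integral(2) by (simp add: set_lebesgue_integral_def)
  also have "\<dots> = (if n = 0 then of_real (2 * pi) else 0)"
  proof (cases "n = 0")
    case True
    have "character (of_int n) = (\<lambda>x. 1)" using True by (simp add: character_def fun_eq_iff)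
    then show ?thesis using True by (simp add: scaleR_conv_of_real)
  next
    case False
    have "(character (of_int n) has_integral
        (\<i> / of_int n * character (of_int n) pi - \<i> / of_int n * character (of_int n) (- pi))) {-pi..pi}"
    proof (rule fundamental_theorem_of_calculus)
      fix x :: real
      have "((\<lambda>z. \<i> / of_int n * exp (- \<i> * (of_int n * z))) has_field_derivative
          exp (- \<i> * (of_int n * complex_of_real x))) (at (of_real x))"
        using False by (auto intro!: derivative_eq_intros)
      from has_vector_derivative_real_field[OF this, of "{-pi..pi}"]
      show "((\<lambda>x. \<i> / of_int n * character (of_int n) x) has_vector_derivative character (of_int n) x)
          (at x within {-pi..pi})"
        by (simp add: character_def mult.commute)
    qed simp
    moreover have "character (of_int n) pi = character (of_int n) (- pi)"
      using sin_integer_2pi[of n] sin_npi_int[of n] by (simp add: character_eq_cis cis.code complex_eq_iff mult.commute)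
    ultimately show ?thesis using False by (simp add: integral_unique)
  qed
  finally show ?thesis .
qed

text \<open>
  The transform of the indicator of a full period vanishes at all nonzero integers, so only
  the constant coefficient survives in the pairing.
\<close>

lemma disc_function_mean_value:
  assumes G: "G \<in> disc_functions"
  shows "(\<integral>x. indicator {-pi..pi} x *\<^sub>R G (character 1 x) \<partial>lborel) = of_real (2 * pi) * G 0"
proof -
  define v :: "real \<Rightarrow> complex" where "v = (\<lambda>x. of_real (indicator {-pi..pi} x))"
  have v: "integrable lborel v"
    unfolding v_def by (intro integrable_of_real integrable_real_indicator) auto
  have v0: "fourier_of v (real m) = (if m = 0 then of_real (2 * pi) else 0)" for m
  proof -
    have "fourier_of v (real m) = (\<integral>x. indicator {-pi..pi} x *\<^sub>R character (of_int (int m)) x \<partial>lborel)"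
      unfolding fourier_of_def v_def by (intro Bochner_Integration.integral_cong) (auto simp: indicator_def)
    then show ?thesis by (simp only: integral_character_period of_nat_eq_0_iff)
  qed
  obtain a where a0: "a 0 = G 0" and "\<And>m. norm (a m) \<le> 1"
    and s: "\<And>n. (\<lambda>m. a m * of_real (radius_seq n) ^ m * fourier_of v (real m)) sums
        (\<integral>x. G (of_real (radius_seq n) * character 1 x) * v x \<partial>lborel)"
    and l: "(\<lambda>n. \<integral>x. G (of_real (radius_seq n) * character 1 x) * v x \<partial>lborel)
        \<longlonglongrightarrow> (\<integral>x. G (character 1 x) * v x \<partial>lborel)"
    by (rule disc_function_pairing_limit[OF G v], rule that)
  have "(\<integral>x. G (of_real (radius_seq n) * character 1 x) * v x \<partial>lborel) = of_real (2 * pi) * G 0" for n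
  proof -
    have "(\<lambda>m. a m * of_real (radius_seq n) ^ m * fourier_of v (real m))
        = (\<lambda>m. if m = 0 then of_real (2 * pi) * G 0 else 0)"
      by (auto simp: v0 a0)
    then show ?thesis using s[of n] sums_single[of 0 "\<lambda>_. of_real (2 * pi) * G 0"]
      by (metis (no_types, lifting) sums_unique2)
  qed
  then have "(\<integral>x. G (character 1 x) * v x \<partial>lborel) = of_real (2 * pi) * G 0"
    using l by (simp add: LIMSEQ_const_iff)
  moreover have "(\<integral>x. G (character 1 x) * v x \<partial>lborel) = (\<integral>x. indicator {-pi..pi} x *\<^sub>R G (character 1 x) \<partial>lborel)"
    unfolding v_def by (intro Bochner_Integration.integral_cong) (auto simp: indicator_def)
  ultimately show ?thesis by simp
qed

section \<open>A bounded analytic function that is tiny on an arc\<close>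

text \<open>
  The exponent is, up to sign, \<open>\<kappa>\<close> times a function of positive real part and of mean 1 over the circle that blows up
  like an inverse square root at the points \<open>e^(i \<delta>)\<close> and \<open>e^(-i \<delta>)\<close> and is positive of size at least about \<open>1 / \<delta>\<close>, up to a
  small rotation, on the arc between them. At the two points themselves the value is 1, by the convention for division
  by zero.
\<close>

definition arc_function :: "real \<Rightarrow> real \<Rightarrow> complex \<Rightarrow> complex" where
  "arc_function \<kappa> \<delta> z =
     exp (- (of_real \<kappa> / (csqrt (1 - cis \<delta> * z) * csqrt (1 - cis (- \<delta>) * z))))"

text \<open>
  Principal square roots of the right half plane lie in the sector \<open>|arg| < \<pi>/4\<close>.
\<close>

lemma Re_csqrt_mult_csqrt_pos:
  assumes "Re w1 > 0" "Re w2 > 0"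
  shows "Re (csqrt w1 * csqrt w2) > 0"
proof -
  have *: "\<bar>Im (csqrt w)\<bar> < Re (csqrt w)" if "Re w > 0" for w
  proof -
    have "Re w = (Re (csqrt w))\<^sup>2 - (Im (csqrt w))\<^sup>2"
      using arg_cong[OF power2_csqrt[of w], of Re] by (simp add: power2_eq_square del: csqrt.simps)
    then have "\<bar>Im (csqrt w)\<bar>\<^sup>2 < (Re (csqrt w))\<^sup>2" unfolding power2_abs using that by linarith
    then show ?thesis using Re_csqrt[of w] by (rule power2_less_imp_less)
  qed
  have "\<bar>Im (csqrt w1)\<bar> * \<bar>Im (csqrt w2)\<bar> < Re (csqrt w1) * Re (csqrt w2)"
    using *[OF assms(1)] *[OF assms(2)] by (intro mult_strict_mono; linarith)
  then have "Im (csqrt w1) * Im (csqrt w2) < Re (csqrt w1) * Re (csqrt w2)"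
    by (metis abs_ge_self abs_mult order.strict_trans1)
  then show ?thesis by (simp del: csqrt.simps)
qed

lemma one_minus_not_nonpos:
  fixes z :: complex
  assumes "norm z \<le> 1" "z \<noteq> 1"
  shows "Re (1 - z) > 0"
proof (rule ccontr)
  assume "\<not> ?thesis"
  then have "Re z \<ge> 1" by simp
  moreover have "(Re z)\<^sup>2 + (Im z)\<^sup>2 \<le> 1"
    using assms(1) by (simp add: cmod_def)
  ultimately have "Re z = 1" "Im z = 0"
    by (smt (verit) one_le_power power2_less_0 zero_eq_power2 le_add_same_cancel1
        power2_eq_1_iff zero_le_power2)+
  then show False using assms(2) by (simp add: complex_eq_iff)
qed

lemma Re_inverse_pos: "Re (w::complex) > 0 \<Longrightarrow> Re (inverse w) > 0"
  by (auto simp: complex_eq_iff sum_power2_gt_zero_iff intro!: divide_pos_pos)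

lemma arc_function_disc:
  assumes "\<kappa> \<ge> 0"
  shows "arc_function \<kappa> \<delta> \<in> disc_functions"
proof -
  let ?u = "\<lambda>z. 1 - cis \<delta> * z" and ?v = "\<lambda>z. 1 - cis (- \<delta>) * z"
  let ?S = "{cis (- \<delta>), cis \<delta>}"
  have ne: "cis \<delta> * z \<noteq> 1" "cis (- \<delta>) * z \<noteq> 1" if "z \<notin> ?S" for z
  proof -
    have "z = cis (- \<delta>)" if "cis \<delta> * z = 1"
      using arg_cong[OF that, of "(*) (cis (- \<delta>))"] by (simp add: cis_mult flip: mult.assoc)
    moreover have "z = cis \<delta>" if "cis (- \<delta>) * z = 1"
      using arg_cong[OF that, of "(*) (cis \<delta>)"] by (simp add: cis_mult flip: mult.assoc)
    ultimately show "cis \<delta> * z \<noteq> 1" "cis (- \<delta>) * z \<noteq> 1" using that by blast+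
  qed
  have pos: "Re (?u z) > 0" "Re (?v z) > 0" if "norm z \<le> 1" "z \<notin> ?S" for z
    using that(1) ne[OF that(2)] by (intro one_minus_not_nonpos; simp add: norm_mult)+
  have nn: "?u z \<notin> \<real>\<^sub>\<le>\<^sub>0" "?v z \<notin> \<real>\<^sub>\<le>\<^sub>0" if "norm z \<le> 1" "z \<notin> ?S" for z
    using pos[OF that] unfolding complex_nonpos_Reals_iff by linarith+
  have "continuous_on (cball 0 1 - ?S) (arc_function \<kappa> \<delta>)"
    unfolding arc_function_def[abs_def]
    by (intro continuous_intros continuous_on_compose2[OF continuous_on_csqrt])
       (use ne nn in \<open>auto simp del: csqrt.simps\<close>)
  moreover have "arc_function \<kappa> \<delta> holomorphic_on ball 0 1"
  proof -
    have S: "z \<notin> ?S" if "z \<in> ball 0 1" for z using that by auto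
    show ?thesis
      unfolding arc_function_def[abs_def]
    proof (intro holomorphic_intros)
      fix z :: complex assume z: "z \<in> ball 0 1"
      show "?u z \<notin> \<real>\<^sub>\<le>\<^sub>0" "?v z \<notin> \<real>\<^sub>\<le>\<^sub>0" using nn[of z] S[OF z] z by auto
      show "csqrt (?u z) * csqrt (?v z) \<noteq> 0" using ne[OF S[OF z]] by simp
    qed
  qed
  moreover have "norm (arc_function \<kappa> \<delta> z) \<le> 1" if "norm z \<le> 1" for z
  proof (cases "z \<in> ?S")
    case True
    then have "?u z = 0 \<or> ?v z = 0" by (auto simp: cis_mult)
    then have "arc_function \<kappa> \<delta> z = 1" by (auto simp: arc_function_def)
    then show ?thesis by simp
  next
    case False
    have "Re (inverse (csqrt (?u z) * csqrt (?v z))) > 0"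
      by (intro Re_inverse_pos Re_csqrt_mult_csqrt_pos pos that False)
    moreover have "Re (of_real \<kappa> / (csqrt (?u z) * csqrt (?v z)))
        = \<kappa> * Re (inverse (csqrt (?u z) * csqrt (?v z)))"
      by (simp only: divide_inverse scaleR_conv_of_real[symmetric] scaleR_complex.sel)
    ultimately show ?thesis using assms by (simp add: arc_function_def)
  qed
  ultimately show ?thesis
    unfolding disc_functions_def by (auto intro!: exI[of _ ?S])
qed

lemma arc_function_0: "arc_function \<kappa> \<delta> 0 = of_real (exp (- \<kappa>))"
  by (simp add: arc_function_def flip: exp_of_real)

text \<open>
  The product of the two radicands at \<open>z = e^(-i y)\<close>, as an entire function of \<open>y\<close>.
\<close>

definition arc_quadratic :: "real \<Rightarrow> complex \<Rightarrow> complex" where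
  "arc_quadratic \<delta> y = exp (- \<i> * y) * (2 * cos y - 2 * cos (of_real \<delta>))"

text \<open>
  On the arc the two radicands have conjugate directions up to a small rotation, so their
  principal roots multiply to the principal root of the product. The right-hand side continues analytically to
  complex \<open>y\<close> near the arc.
\<close>

lemma arc_function_eq_quadratic:
  assumes "\<bar>x\<bar> < \<delta>" "\<delta> \<le> 1"
  shows "arc_function \<kappa> \<delta> (character 1 x) = exp (- (of_real \<kappa> / csqrt (arc_quadratic \<delta> (of_real x))))"
proof -
  let ?u = "1 - cis \<delta> * character 1 x" and ?v = "1 - cis (- \<delta>) * character 1 x"
  have u: "?u = 1 - cis (\<delta> - x)" and v: "?v = 1 - cis (- \<delta> - x)"
    by (simp_all add: character_eq_cis cis_mult)
  have lt1: "cos t < 1" if "0 < \<bar>t\<bar>" "\<bar>t\<bar> \<le> 2" for t :: real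
    using that cos_monotone_0_pi[of 0 "\<bar>t\<bar>"] pi_gt3 by (auto simp: abs_if split: if_splits)
  have "Re ?u > 0" "Re ?v > 0"
    unfolding u v using lt1[of "\<delta> - x"] lt1[of "- \<delta> - x"] assms by (auto simp: abs_if split: if_splits)
  then have pos: "Re (csqrt ?u * csqrt ?v) > 0" by (rule Re_csqrt_mult_csqrt_pos)
  have "(csqrt ?u * csqrt ?v)\<^sup>2 = ?u * ?v" by (simp add: power_mult_distrib)
  also have "\<dots> = arc_quadratic \<delta> (of_real x)"
  proof -
    have e: "exp (- \<i> * of_real x) = cis (- x)" "exp (\<i> * of_real x) = cis x"
      by (simp_all add: cis_conv_exp)
    have d: "cos (of_real t :: complex) = (cis t + cis (- t)) / 2" for t
      by (simp add: cos_exp_eq cis_conv_exp)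
    show ?thesis
    proof -
      have "cis \<delta> * cis (- \<delta>) = 1" "cis x * cis (- x) = 1" by (simp_all add: cis_mult)
      then have "(1 - cis \<delta> * cis (- x)) * (1 - cis (- \<delta>) * cis (- x))
          = cis (- x) * ((cis x + cis (- x)) - (cis \<delta> + cis (- \<delta>)))"
        by algebra
      then show ?thesis
        unfolding arc_quadratic_def d e character_eq_cis by (simp add: add_divide_distrib)
    qed
  qed
  finally have "csqrt (arc_quadratic \<delta> (of_real x)) = csqrt ?u * csqrt ?v"
    using pos by (intro csqrt_unique) auto
  then show ?thesis by (simp add: arc_function_def)
qed

lemma sin_ge_half:
  fixes x :: real assumes "0 \<le> x" "x \<le> 1" shows "x / 2 \<le> sin x"
proof (cases "x = 0")
  case False
  then have "x > 0" using assms by simp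
  then obtain z where z: "0 < z" "z < x" "sin x - sin 0 = (x - 0) * cos z"
    using MVT2[of 0 x sin cos] by auto
  have "cos (pi / 3) \<le> cos z"
    using z assms pi_gt3 by (intro cos_monotone_0_pi_le) auto
  then have "x * (1 / 2) \<le> x * cos z" using \<open>x > 0\<close> by (intro mult_left_mono) (auto simp: cos_60)
  then show ?thesis using z by simp
qed simp

lemma cos_diff_bounds:
  fixes a \<delta> :: real
  assumes "0 < \<delta>" "\<delta> \<le> 1" "\<bar>a\<bar> \<le> \<delta>"
  shows "\<delta> * (\<delta> - \<bar>a\<bar>) / 8 \<le> cos a - cos \<delta>" "cos a - cos \<delta> \<le> \<delta> * (\<delta> - \<bar>a\<bar>)"
proof -
  let ?s = "(\<bar>a\<bar> + \<delta>) / 2" and ?d = "(\<delta> - \<bar>a\<bar>) / 2"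
  have eq: "cos a - cos \<delta> = 2 * sin ?s * sin ?d"
    using cos_diff_cos[of "\<bar>a\<bar>" \<delta>] by simp
  have "?s / 2 * (?d / 2) \<le> sin ?s * sin ?d"
    using assms by (intro mult_mono sin_ge_half) (auto intro: order_trans[OF _ sin_ge_half])
  moreover have "\<delta> * (\<delta> - \<bar>a\<bar>) \<le> (\<bar>a\<bar> + \<delta>) * (\<delta> - \<bar>a\<bar>)"
    using assms by (intro mult_right_mono) auto
  ultimately show "\<delta> * (\<delta> - \<bar>a\<bar>) / 8 \<le> cos a - cos \<delta>" unfolding eq by (simp add: field_simps)
  have "sin ?s * sin ?d \<le> ?s * ?d"
    using assms by (intro mult_mono sin_x_le_x) (auto intro!: sin_ge_zero order_trans[OF _ less_imp_le[OF pi_gt3]])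
  moreover have "(\<bar>a\<bar> + \<delta>) * (\<delta> - \<bar>a\<bar>) \<le> (2 * \<delta>) * (\<delta> - \<bar>a\<bar>)"
    using assms by (intro mult_right_mono) auto
  ultimately show "cos a - cos \<delta> \<le> \<delta> * (\<delta> - \<bar>a\<bar>)" unfolding eq by (simp add: field_simps)
qed

lemma exp_small_bounds:
  fixes b :: real assumes "\<bar>b\<bar> \<le> 1 / 64"
  shows "1 \<le> (exp b + exp (- b)) / 2" "(exp b + exp (- b)) / 2 \<le> 1 + b\<^sup>2"
    "\<bar>exp (- b) - exp b\<bar> / 2 \<le> 2 * \<bar>b\<bar>" "exp b \<le> 2"
proof -
  have e: "1 + x \<le> exp x" for x :: real by (rule exp_ge_add_one_self)
  have u: "exp x \<le> 1 + x + x\<^sup>2" if "\<bar>x\<bar> \<le> 1 / 64" for x :: real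
  proof (cases "x \<ge> 0")
    case True then show ?thesis using exp_bound[of x] that by simp
  next
    case False
    then have x: "0 \<le> - x" "- x \<le> 1" using that by auto
    have "exp x = 1 / exp (- x)" by (simp add: exp_minus field_simps)
    also have "\<dots> \<le> 1 / (1 - x + x\<^sup>2 / 2)"
      using exp_lower_Taylor_quadratic[OF x(1)] x by (intro divide_left_mono) (auto intro!: add_pos_nonneg mult_pos_pos)
    also have "\<dots> \<le> 1 + x + x\<^sup>2"
    proof -
      have p: "1 - x + x\<^sup>2 / 2 > 0" using x by (intro add_pos_nonneg) auto
      have "1 \<le> (1 + x + x\<^sup>2) * (1 - x + x\<^sup>2 / 2)"
      proof -
        have "(1 + x + x\<^sup>2) * (1 - x + x\<^sup>2 / 2) = 1 + x\<^sup>2 * (1 / 2 + (- x) / 2 + x\<^sup>2 / 2)"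
          by (simp add: power2_eq_square field_simps)
        then show ?thesis using x by (simp add: mult_nonneg_nonneg)
      qed
      then show ?thesis using p by (simp add: pos_divide_le_eq)
    qed
    finally show ?thesis .
  qed
  show "1 \<le> (exp b + exp (- b)) / 2" using add_mono[OF e[of b] e[of "- b"]] by simp
  show "(exp b + exp (- b)) / 2 \<le> 1 + b\<^sup>2" using u[of b] u[of "- b"] assms by simp
  have "\<bar>b\<bar> * \<bar>b\<bar> \<le> 1 * \<bar>b\<bar>" using assms by (intro mult_right_mono) auto
  then have bb: "b\<^sup>2 \<le> \<bar>b\<bar>" by (simp add: power2_eq_square)
  show "\<bar>exp (- b) - exp b\<bar> / 2 \<le> 2 * \<bar>b\<bar>"
  proof -
    have *: "\<bar>r - p\<bar> / 2 \<le> 2 * \<bar>b\<bar>"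
      if "1 + b \<le> p" "1 + - b \<le> r" "p \<le> 1 + b + c" "r \<le> 1 + - b + c" "c \<le> \<bar>b\<bar>" for p r c
      using that by (auto simp: abs_if split: if_splits)
    show ?thesis
      by (rule *[OF e e u[OF assms] _ bb]) (use u[of "- b"] assms in simp)
  qed
  show "exp b \<le> 2" using u[of b] assms bb by linarith
qed

text \<open>
  On the real interval the quantity is \<open>2 e^(-i y) (cos y - cos \<delta>)\<close>, comparable to \<open>\<delta> d\<close> with a small rotation. The
  slope 1/64 is small enough that leaving the real axis does not destroy positivity of the real part.
\<close>

lemma arc_quadratic_bounds:
  assumes \<delta>: "0 < \<delta>" "\<delta> \<le> 1" and d: "d = \<delta> - \<bar>Re y\<bar>" "d \<ge> 0" and b: "\<bar>Im y\<bar> \<le> d / 64"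
  shows "d > 0 \<Longrightarrow> Re (arc_quadratic \<delta> y) > 0" "norm (arc_quadratic \<delta> y) \<le> 12 * (\<delta> * d)"
proof -
  define a b C S where "a = Re y" and "b = Im y" and "C = (exp b + exp (- b)) / 2"
    and "S = (exp (- b) - exp b) / 2"
  have a: "\<bar>a\<bar> \<le> \<delta>" and b1: "\<bar>b\<bar> \<le> d / 64" "\<bar>b\<bar> \<le> 1 / 64"
    using assms by (auto simp: a_def b_def)
  have C: "1 \<le> C" "C \<le> 1 + b\<^sup>2" and S: "\<bar>S\<bar> \<le> 2 * \<bar>b\<bar>" and eb: "exp b \<le> 2"
    using exp_small_bounds[OF b1(2)] by (auto simp: C_def S_def)
  define X where "X = cos a * C - cos \<delta>"
  have rc: "Re (2 * cos y - 2 * cos (of_real \<delta>)) = 2 * X"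
    by (simp add: X_def C_def a_def b_def Re_cos cos_of_real)
  have ic: "Im (2 * cos y - 2 * cos (of_real \<delta>)) = 2 * (sin a * S)"
    by (simp add: S_def a_def b_def Im_cos cos_of_real)
  have re: "Re (exp (- \<i> * y)) = exp b * cos a" and ie: "Im (exp (- \<i> * y)) = - (exp b * sin a)"
    by (simp_all add: Re_exp Im_exp a_def b_def)
  have cd: "\<delta> * d / 8 \<le> cos a - cos \<delta>" "cos a - cos \<delta> \<le> \<delta> * d"
    using cos_diff_bounds[OF \<delta> a] d by (auto simp: a_def)
  have dd: "d \<le> \<delta>" using d by simp
  have ca: "cos a \<ge> 1 / 2"
  proof -
    have "cos (pi / 3) \<le> cos \<bar>a\<bar>" using a \<delta> pi_gt3 by (intro cos_monotone_0_pi_le) auto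
    then show ?thesis by (simp add: cos_60)
  qed
  have sS: "(sin a)\<^sup>2 * \<bar>S\<bar> \<le> \<delta> * d / 32"
  proof -
    have "\<bar>sin a\<bar> \<le> \<delta>" using abs_sin_x_le_abs_x[of a] a by linarith
    then have "(sin a)\<^sup>2 \<le> \<delta>\<^sup>2" by (metis abs_ge_zero power2_abs power_mono)
    also have "\<delta>\<^sup>2 \<le> \<delta> * 1" unfolding power2_eq_square using \<delta> by (intro mult_left_mono) auto
    finally have "(sin a)\<^sup>2 * \<bar>S\<bar> \<le> \<delta> * (d / 32)"
      using S b1 \<delta> by (intro mult_mono) auto
    then show ?thesis by simp
  qed
  show "Re (arc_quadratic \<delta> y) > 0" if "d > 0"
  proof -
    have "X \<ge> cos a - cos \<delta>" using C(1) ca mult_left_mono[of 1 C "cos a"] by (simp add: X_def)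
    then have "X \<ge> \<delta> * d / 8" using cd(1) by simp
    moreover have d8: "\<delta> * d / 8 \<ge> 0" using \<delta> d(2) by simp
    ultimately have "X * cos a \<ge> \<delta> * d / 8 * (1 / 2)"
      using ca by (intro mult_mono) linarith+
    moreover have "(sin a)\<^sup>2 * S \<ge> - (\<delta> * d / 32)"
      using sS abs_le_D2[of "(sin a)\<^sup>2 * S" "\<delta> * d / 32"] by (simp add: abs_mult)
    moreover have "\<delta> * d > 0" using that \<delta> by simp
    ultimately have "X * cos a + (sin a)\<^sup>2 * S > 0" by linarith
    moreover have "Re (arc_quadratic \<delta> y) = 2 * exp b * (X * cos a + (sin a)\<^sup>2 * S)"
      unfolding arc_quadratic_def times_complex.sel(1) rc ic re ie
      by (simp add: algebra_simps power2_eq_square)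
    ultimately show ?thesis by simp
  qed
  have "norm (2 * cos y - 2 * cos (of_real \<delta>)) \<le> \<bar>2 * X\<bar> + \<bar>2 * (sin a * S)\<bar>"
    using cmod_le[of "2 * cos y - 2 * cos (of_real \<delta>)"] unfolding rc ic .
  also have "\<dots> \<le> 2 * (2 * (\<delta> * d)) + 2 * (\<delta> * d)"
  proof -
    have b2: "b\<^sup>2 \<le> \<delta> * d"
    proof -
      have "\<bar>b\<bar> * \<bar>b\<bar> \<le> \<delta> * d" using b1 dd d \<delta> by (intro mult_mono) auto
      then show ?thesis by (simp add: power2_eq_square)
    qed
    have "cos a * C \<le> cos a * (1 + b\<^sup>2)" using C ca by (intro mult_left_mono) auto
    also have "\<dots> \<le> cos a + b\<^sup>2" using mult_right_mono[OF cos_le_one, of "b\<^sup>2" a] by (simp add: algebra_simps)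
    finally have "X \<le> 2 * (\<delta> * d)" using cd b2 by (simp add: X_def)
    moreover have "X \<ge> 0"
    proof -
      have "0 \<le> \<delta> * d / 8" using \<delta> d by simp
      also have "\<dots> \<le> cos a - cos \<delta>" by (rule cd(1))
      also have "\<dots> \<le> X" using C(1) ca mult_left_mono[of 1 C "cos a"] by (simp add: X_def)
      finally show ?thesis .
    qed
    moreover have "\<bar>sin a * S\<bar> \<le> \<delta> * d"
    proof -
      have "\<bar>sin a\<bar> * \<bar>S\<bar> \<le> \<delta> * d"
        using abs_sin_x_le_abs_x[of a] a S b1 d \<delta> by (intro mult_mono) auto
      then show ?thesis by (simp add: abs_mult)
    qed
    ultimately show ?thesis by (simp add: abs_mult)
  qed
  finally have 1: "norm (2 * cos y - 2 * cos (of_real \<delta>)) \<le> 6 * (\<delta> * d)" by simp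
  have "norm (exp (- \<i> * y)) \<le> 2" using eb by (simp add: b_def)
  then have "norm (arc_quadratic \<delta> y) \<le> 2 * (6 * (\<delta> * d))"
    unfolding arc_quadratic_def norm_mult using 1 by (intro mult_mono) auto
  then show "norm (arc_quadratic \<delta> y) \<le> 12 * (\<delta> * d)" by simp
qed

section \<open>Fourier decay of the arc piece by a contour shift\<close>

text \<open>
  If \<open>w^2 = q\<close> and \<open>Re q > 0\<close>, then \<open>|w|^2 \<le> 2 (Re w)^2\<close>, so that \<open>Re (1 / w)\<close> is comparable to \<open>1 / |w|\<close>; the bound
  \<open>|q| \<le> 12 \<delta> d\<close> then gives the constant 5, as \<open>2 * 12 \<le> 5^2\<close>.
\<close>

lemma norm_arc_exponential_le:
  assumes \<delta>: "0 < \<delta>" "\<delta> \<le> 1" and \<kappa>: "\<kappa> \<ge> 0"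
    and d: "d = \<delta> - \<bar>Re y\<bar>" "d > 0" and b: "\<bar>Im y\<bar> \<le> d / 64"
  shows "norm (exp (- (of_real \<kappa> / csqrt (arc_quadratic \<delta> y)))) \<le> exp (- (\<kappa> / (5 * sqrt (\<delta> * d))))"
proof -
  define q where "q = arc_quadratic \<delta> y"
  define w where "w = csqrt q"
  have q: "Re q > 0" "norm q \<le> 12 * (\<delta> * d)"
    using arc_quadratic_bounds[OF \<delta> d(1) _ b] d(2) by (auto simp: q_def)
  have ww: "w\<^sup>2 = q" by (simp add: w_def)
  have rw0: "Re w \<ge> 0" unfolding w_def by (rule Re_csqrt)
  have "Re q = (Re w)\<^sup>2 - (Im w)\<^sup>2"
    using arg_cong[OF ww, of Re] by (simp add: power2_eq_square)
  then have le: "(norm w)\<^sup>2 \<le> 2 * (Re w)\<^sup>2" using q(1) by (simp add: cmod_power2)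
  have w0: "norm w > 0" using q(1) ww by auto
  have nw: "(norm w)\<^sup>2 \<le> 12 * (\<delta> * d)" using q(2) ww by (metis norm_power)
  have rw: "Re w > 0"
  proof (rule ccontr)
    assume "\<not> ?thesis"
    then have "Re w = 0" using rw0 by simp
    then show False using le w0 by simp
  qed
  have "1 / (5 * sqrt (\<delta> * d)) \<le> Re w / (norm w)\<^sup>2"
  proof -
    have dd: "\<delta> * d > 0" using \<delta> d by simp
    have "((norm w)\<^sup>2)\<^sup>2 \<le> (2 * (Re w)\<^sup>2) * (12 * (\<delta> * d))"
      unfolding power2_eq_square[of "(norm w)\<^sup>2"] using le nw by (intro mult_mono) auto
    also have "\<dots> \<le> (Re w * (5 * sqrt (\<delta> * d)))\<^sup>2"
      using dd mult_nonneg_nonneg[of "(Re w)\<^sup>2" "\<delta> * d"] by (simp add: power_mult_distrib algebra_simps)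
    finally have sq: "((norm w)\<^sup>2)\<^sup>2 \<le> (Re w * (5 * sqrt (\<delta> * d)))\<^sup>2" .
    have "(norm w)\<^sup>2 \<le> Re w * (5 * sqrt (\<delta> * d))"
      using rw dd by (intro power2_le_imp_le[OF sq] mult_nonneg_nonneg) auto
    then show ?thesis using dd w0 by (simp add: field_simps)
  qed
  moreover have "Re (of_real \<kappa> / w) = \<kappa> * (Re w / (norm w)\<^sup>2)"
  proof -
    have "of_real \<kappa> / w = \<kappa> *\<^sub>R inverse w" by (simp add: scaleR_conv_of_real divide_inverse)
    then show ?thesis by (simp add: cmod_power2)
  qed
  ultimately have "\<kappa> * (1 / (5 * sqrt (\<delta> * d))) \<le> Re (of_real \<kappa> / w)"
    using \<kappa> by (metis mult_left_mono)
  then show ?thesis by (simp add: w_def q_def)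
qed

lemma arc_exponential_differentiable:
  assumes \<delta>: "0 < \<delta>" "\<delta> \<le> 1"
    and d: "d = \<delta> - \<bar>Re y\<bar>" "d > 0" and b: "\<bar>Im y\<bar> \<le> d / 64"
  shows "(\<lambda>y. exp (- (of_real \<kappa> / csqrt (arc_quadratic \<delta> y)))) field_differentiable at y"
proof -
  have "Re (arc_quadratic \<delta> y) > 0"
    using arc_quadratic_bounds(1)[OF \<delta> d(1) _ b d(2)] d(2) by simp
  then have nz: "arc_quadratic \<delta> y \<notin> \<real>\<^sub>\<le>\<^sub>0" "arc_quadratic \<delta> y \<noteq> 0"
    by (auto simp: complex_nonpos_Reals_iff)
  have q: "arc_quadratic \<delta> field_differentiable at y"
    unfolding arc_quadratic_def[abs_def]
    by (auto simp: field_differentiable_def intro!: derivative_eq_intros exI)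
  have "(csqrt \<circ> arc_quadratic \<delta>) field_differentiable at y"
    by (rule field_differentiable_compose[OF q field_differentiable_at_csqrt[OF nz(1)]])
  then have "(\<lambda>y. - (of_real \<kappa> / csqrt (arc_quadratic \<delta> y))) field_differentiable at y"
    unfolding o_def using nz(2)
    by (intro field_differentiable_minus field_differentiable_divide field_differentiable_const) auto
  then have "(exp \<circ> (\<lambda>y. - (of_real \<kappa> / csqrt (arc_quadratic \<delta> y)))) field_differentiable at y"
    by (rule field_differentiable_compose) (auto simp: field_differentiable_def intro!: exI DERIV_exp)
  then show ?thesis by (simp add: o_def)
qed

lemma power_exp_minus_le:
  fixes x :: real assumes "x \<ge> 0" shows "exp (- x) * x ^ m \<le> fact m"
proof -
  \<comment> \<open>One term of the exponential series is bounded by its sum.\<close>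
  have "x ^ m /\<^sub>R fact m \<le> (\<Sum>n. x ^ n /\<^sub>R fact n)"
    using sum_le_suminf[of "\<lambda>n. x ^ n /\<^sub>R fact n" "{m}"] assms summable_exp_generic[of x] by simp
  then have "x ^ m / fact m \<le> exp x" by (simp add: exp_def divide_inverse mult.commute)
  then show ?thesis by (simp add: exp_minus field_simps)
qed

definition arc_bump :: "real \<Rightarrow> real \<Rightarrow> real \<Rightarrow> complex" where
  "arc_bump \<kappa> \<delta> x = (if \<bar>x\<bar> < \<delta> then arc_function \<kappa> \<delta> (character 1 x) else 0)"

lemma norm_arc_bump_le:
  assumes "0 < \<delta>" "\<delta> \<le> 1" "\<kappa> \<ge> 0"
  shows "norm (arc_bump \<kappa> \<delta> x) \<le> exp (- (\<kappa> / (5 * \<delta>)))"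
proof (cases "\<bar>x\<bar> < \<delta>")
  case True
  then have "norm (arc_bump \<kappa> \<delta> x) \<le> exp (- (\<kappa> / (5 * sqrt (\<delta> * (\<delta> - \<bar>x\<bar>)))))"
    using norm_arc_exponential_le[of \<delta> \<kappa> "\<delta> - \<bar>x\<bar>" "of_real x"] assms
    by (simp add: arc_bump_def arc_function_eq_quadratic)
  also have "\<dots> \<le> exp (- (\<kappa> / (5 * \<delta>)))"
  proof -
    have "sqrt (\<delta> * (\<delta> - \<bar>x\<bar>)) \<le> sqrt (\<delta> * \<delta>)"
      using assms by (intro real_sqrt_le_mono mult_left_mono) auto
    then have "sqrt (\<delta> * (\<delta> - \<bar>x\<bar>)) \<le> \<delta>" using assms by simp
    then have "\<kappa> / (5 * \<delta>) \<le> \<kappa> / (5 * sqrt (\<delta> * (\<delta> - \<bar>x\<bar>)))"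
      using assms True by (intro divide_left_mono) auto
    then show ?thesis by simp
  qed
  finally show ?thesis .
qed (auto simp: arc_bump_def)

lemma arc_bump_measurable [measurable]:
  assumes "\<kappa> \<ge> 0" shows "arc_bump \<kappa> \<delta> \<in> borel_measurable borel"
proof -
  have [measurable]: "(\<lambda>x. arc_function \<kappa> \<delta> (character 1 x)) \<in> borel_measurable borel"
    by (rule disc_functions_boundary_measurable[OF arc_function_disc[OF assms]])
  show ?thesis unfolding arc_bump_def[abs_def] by measurable
qed

text \<open>
  Half of the first exponent produces the tiny factor \<open>exp (- \<kappa> / (10 \<delta>))\<close>. The other half beats the powers of \<open>1 / d\<close>
  that arise when the second exponential is traded for \<open>|\<xi>|^(-m)\<close>.
\<close>

lemma arc_side_bound:
  assumes \<delta>: "0 < \<delta>" "\<delta> \<le> 1" and \<kappa>: "\<kappa> > 0" and \<xi>: "\<xi> \<noteq> 0"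
    and d: "0 < d" "d \<le> \<delta>"
  shows "exp (- (\<kappa> / (5 * sqrt (\<delta> * d)))) * exp (- (\<bar>\<xi>\<bar> * d / 64))
    \<le> fact m * fact (2 * m) * 6400 ^ m * exp (- (\<kappa> / (10 * \<delta>))) * (\<delta> / \<kappa>\<^sup>2) ^ m / \<bar>\<xi>\<bar> ^ m"
proof -
  define s where "s = sqrt (\<delta> * d)"
  have s: "s > 0" "s\<^sup>2 = \<delta> * d" using \<delta> d by (auto simp: s_def)
  have "s \<le> sqrt (\<delta> * \<delta>)" unfolding s_def using \<delta> d by (intro real_sqrt_le_mono mult_left_mono) auto
  then have s\<delta>: "s \<le> \<delta>" using \<delta> by simp
  define X where "X = \<kappa> / (10 * s)"
  define Y where "Y = \<bar>\<xi>\<bar> * d / 64"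
  have X: "X > 0" and Y: "Y > 0" using \<kappa> s \<xi> d by (auto simp: X_def Y_def)
  have eX: "exp (- X) \<le> fact (2 * m) / X ^ (2 * m)"
    using power_exp_minus_le[of X "2 * m"] X by (simp add: field_simps)
  have eY: "exp (- Y) \<le> fact m / Y ^ m"
    using power_exp_minus_le[of Y m] Y by (simp add: field_simps)
  have "exp (- (\<kappa> / (5 * s))) = exp (- X) * exp (- X)"
    by (simp add: X_def flip: exp_add)
  also have "\<dots> \<le> exp (- (\<kappa> / (10 * \<delta>))) * (fact (2 * m) / X ^ (2 * m))"
  proof (intro mult_mono eX)
    have "\<kappa> / (10 * \<delta>) \<le> X" unfolding X_def using s s\<delta> \<kappa> by (intro divide_left_mono) auto
    then show "exp (- X) \<le> exp (- (\<kappa> / (10 * \<delta>)))" by simp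
  qed auto
  finally have "exp (- (\<kappa> / (5 * s))) * exp (- Y)
      \<le> exp (- (\<kappa> / (10 * \<delta>))) * (fact (2 * m) / X ^ (2 * m)) * (fact m / Y ^ m)"
    using eY X by (intro mult_mono) auto
  also have "\<dots> = fact m * fact (2 * m) * exp (- (\<kappa> / (10 * \<delta>))) * (1 / (X\<^sup>2 * Y) ^ m)"
  proof -
    have "e * (F / A) * (G / C) = G * F * e * (1 / (A * C))" for e F A G C :: real by simp
    then show ?thesis by (simp only: power_mult power_mult_distrib)
  qed
  also have "1 / (X\<^sup>2 * Y) ^ m = (1 / (X\<^sup>2 * Y)) ^ m" by (simp add: power_divide)
  also have "1 / (X\<^sup>2 * Y) = 6400 * (\<delta> / \<kappa>\<^sup>2) / \<bar>\<xi>\<bar>"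
    using s \<kappa> \<delta> d \<xi> by (simp add: X_def Y_def power_divide power_mult_distrib field_simps)
  finally show ?thesis by (simp add: s_def Y_def power_divide power_mult_distrib algebra_simps)
qed

text \<open>
  The interval of integration is replaced by two sides of a flat triangle whose apex lies on the side of the real axis
  where \<open>e^(-i \<xi> y)\<close> decays. On these sides the imaginary part is proportional to the distance \<open>d\<close> to the
  endpoint, and the flatness of the function at the endpoints compensates for \<open>d\<close> being small.
\<close>

lemma arc_contour_shift:
  assumes \<delta>: "0 < \<delta>" "\<delta> \<le> 1" and \<kappa>: "\<kappa> > 0" and \<xi>: "\<xi> \<noteq> 0"
    and B: "\<And>d. 0 < d \<Longrightarrow> d \<le> \<delta> \<Longrightarrow> exp (- (\<kappa> / (5 * sqrt (\<delta> * d)))) * exp (- (\<bar>\<xi>\<bar> * d / 64)) \<le> B"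
  shows "norm (fourier_of (arc_bump \<kappa> \<delta>) \<xi>) \<le> 4 * B"
proof -
  define R where "R = {y :: complex. \<bar>Im y\<bar> + \<bar>Re y\<bar> / 64 \<le> \<delta> / 64}"
  define K where "K = {of_real (- \<delta>), complex_of_real \<delta>}"
  define \<Phi> where "\<Phi> y = (if y \<in> K then 0 else exp (- (of_real \<kappa> / csqrt (arc_quadratic \<delta> y))))" for y
  have B0: "B \<ge> 0" using B[of \<delta>] \<delta> by (meson exp_ge_zero mult_nonneg_nonneg order_refl order_trans)
  have convR: "convex R"
  proof (rule convexI)
    fix x y u v assume xy: "x \<in> R" "y \<in> R" "0 \<le> u" "0 \<le> v" "u + v = (1::real)"
    have "\<bar>u * Im x + v * Im y\<bar> + \<bar>u * Re x + v * Re y\<bar> / 64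
        \<le> u * (\<bar>Im x\<bar> + \<bar>Re x\<bar> / 64) + v * (\<bar>Im y\<bar> + \<bar>Re y\<bar> / 64)"
      using abs_triangle_ineq[of "u * Im x" "v * Im y"] abs_triangle_ineq[of "u * Re x" "v * Re y"] xy
      by (simp add: abs_mult algebra_simps)
    also have "\<dots> \<le> u * (\<delta> / 64) + v * (\<delta> / 64)"
      using xy by (intro add_mono mult_left_mono) (auto simp: R_def)
    also have "\<dots> = \<delta> / 64" using xy(5) by (simp flip: distrib_right)
    finally show "u *\<^sub>R x + v *\<^sub>R y \<in> R" by (simp add: R_def)
  qed
  have dpos: "\<delta> - \<bar>Re y\<bar> > 0" "\<bar>Im y\<bar> \<le> (\<delta> - \<bar>Re y\<bar>) / 64" if "y \<in> R" "y \<notin> K" for y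
  proof -
    show im: "\<bar>Im y\<bar> \<le> (\<delta> - \<bar>Re y\<bar>) / 64" using that by (simp add: R_def field_simps)
    show "\<delta> - \<bar>Re y\<bar> > 0"
    proof (rule ccontr)
      assume "\<not> ?thesis"
      then have "\<bar>Re y\<bar> = \<delta>" "Im y = 0" using im by auto
      then show False using that(2) by (auto simp: K_def complex_eq_iff abs_if split: if_splits)
    qed
  qed
  have bd: "norm (\<Phi> y) \<le> exp (- (\<kappa> / (5 * sqrt (\<delta> * (\<delta> - \<bar>Re y\<bar>)))))" if "y \<in> R" for y
    using norm_arc_exponential_le[OF \<delta> less_imp_le[OF \<kappa>] refl dpos[OF that]] by (simp add: \<Phi>_def)
  have diff: "\<Phi> field_differentiable at y" if "y \<in> R" "y \<notin> K" for y
  proof -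
    have "(\<lambda>y. exp (- (of_real \<kappa> / csqrt (arc_quadratic \<delta> y)))) field_differentiable at y"
      using arc_exponential_differentiable[OF \<delta> refl dpos[OF that]] .
    then obtain D where D: "((\<lambda>y. exp (- (of_real \<kappa> / csqrt (arc_quadratic \<delta> y)))) has_field_derivative D) (at y)"
      by (auto simp: field_differentiable_def)
    have oK: "open (- K)" by (simp add: K_def finite_imp_closed open_Compl)
    have "(\<Phi> has_field_derivative D) (at y)"
      by (rule has_field_derivative_transform_within_open[OF D oK]) (use that in \<open>auto simp: \<Phi>_def\<close>)
    then show ?thesis by (auto simp: field_differentiable_def)
  qed
  have contR: "continuous_on R \<Phi>"
    unfolding continuous_on_eq_continuous_within
  proof
    fix y assume y: "y \<in> R"
    show "continuous (at y within R) \<Phi>"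
    proof (cases "y \<in> K")
      case False
      show ?thesis
        by (rule continuous_at_imp_continuous_within[OF field_differentiable_imp_continuous_at[OF diff[OF y False]]])
    next
      case True
      \<comment> \<open>Continuity at the endpoints follows from \<open>exp (- X) \<le> 1 / X\<close>.\<close>
      let ?g = "\<lambda>z. 5 * sqrt (\<delta> * (\<delta> - \<bar>Re z\<bar>)) / \<kappa>"
      have le: "norm (\<Phi> z) \<le> ?g z" if z: "z \<in> R" for z
      proof (cases "z \<in> K")
        case True
        then show ?thesis using \<delta> \<kappa> by (auto simp: \<Phi>_def K_def)
      next
        case False
        define X where "X = \<kappa> / (5 * sqrt (\<delta> * (\<delta> - \<bar>Re z\<bar>)))"
        have X: "X > 0" using dpos[OF z False] \<delta> \<kappa> by (simp add: X_def)
        have "norm (\<Phi> z) \<le> exp (- X)" using bd[OF z] by (simp add: X_def)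
        also have "\<dots> \<le> 1 / X" using power_exp_minus_le[of X 1] X by (simp add: field_simps)
        finally show ?thesis by (simp add: X_def)
      qed
      have "(?g \<longlongrightarrow> ?g y) (at y within R)"
        using \<kappa> by (intro tendsto_intros) auto
      moreover have "?g y = 0" using True \<delta> by (auto simp: K_def)
      ultimately have "(?g \<longlongrightarrow> 0) (at y within R)" by simp
      moreover have "\<forall>\<^sub>F z in at y within R. norm (\<Phi> z) \<le> ?g z"
        using le by (auto simp: eventually_at_filter)
      ultimately have "(\<Phi> \<longlongrightarrow> 0) (at y within R)" by (rule Lim_null_comparison[rotated])
      then show ?thesis using True by (simp add: continuous_within \<Phi>_def)
    qed
  qed
  define f where "f y = \<Phi> y * exp (- \<i> * (y * of_real \<xi>))" for y
  have contf: "continuous_on R f" unfolding f_def by (intro continuous_intros contR)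
  have finK: "finite K" by (simp add: K_def)
  have difff: "f field_differentiable at y" if "y \<in> interior R - K" for y
  proof -
    have "y \<in> R" using that interior_subset by blast
    moreover have "(\<lambda>y. exp (- \<i> * (y * of_real \<xi>))) field_differentiable at y"
      by (auto simp: field_differentiable_def intro!: derivative_eq_intros exI)
    ultimately show ?thesis
      unfolding f_def using that by (intro field_differentiable_mult diff) auto
  qed
  obtain g where g: "\<And>y. y \<in> R \<Longrightarrow> (g has_field_derivative f y) (at y within R)"
    using holomorphic_convex_primitive[OF convR finK contf difff] by blast
  \<comment> \<open>The apex of the triangle, below the axis for \<open>\<xi> > 0\<close> and above it for \<open>\<xi> < 0\<close>.\<close>
  define p where "p = Complex 0 (- sgn \<xi> * \<delta> / 64)"
  define l r where "l = complex_of_real (- \<delta>)" and "r = complex_of_real \<delta>"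
  have sg: "\<bar>sgn \<xi>\<bar> = 1" using \<xi> by (simp add: sgn_if)
  have mem: "l \<in> R" "r \<in> R" "p \<in> R" using \<delta> sg by (auto simp: R_def l_def r_def p_def abs_mult)
  have seg: "closed_segment x y \<subseteq> R" if "x \<in> R" "y \<in> R" for x y
    using convR that by (rule closed_segment_subset[rotated 2])
  have ci: "(f has_contour_integral (g y - g x)) (linepath x y)" if "x \<in> R" "y \<in> R" for x y
    using contour_integral_primitive[of R g f "linepath x y"] g seg[OF that] by simp
  have side: "norm (g p - g x) \<le> B * (2 * \<delta>)" if x: "x = l \<or> x = r" for x
  proof -
    have xR: "x \<in> R" using x mem by auto
    have "norm (g p - g x) \<le> B * norm (p - x)"
    proof (rule has_contour_integral_bound_linepath[OF ci[OF xR mem(3)] B0])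
      fix y assume y: "y \<in> closed_segment x p"
      then have yR: "y \<in> R" using seg[OF xR mem(3)] by blast
      show "norm (f y) \<le> B"
      proof (cases "y \<in> K")
        case True then show ?thesis using B0 by (simp add: f_def \<Phi>_def)
      next
        case False
        define d where "d = \<delta> - \<bar>Re y\<bar>"
        have d: "0 < d" "d \<le> \<delta>" using dpos[OF yR False] by (auto simp: d_def)
        obtain u where u: "0 \<le> u" "u \<le> 1" "y = (1 - u) *\<^sub>R x + u *\<^sub>R p"
          using y by (auto simp: in_segment)
        have "Re y = (1 - u) * Re x" "Im x = 0" "\<bar>Re x\<bar> = \<delta>"
          using x \<delta> unfolding u(3) by (auto simp: p_def l_def r_def)
        then have "\<bar>Re y\<bar> = (1 - u) * \<delta>" using u(1,2) by (simp only: abs_mult)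
        then have "d = u * \<delta>" by (simp add: d_def algebra_simps)
        moreover have "Im y = u * (- sgn \<xi> * \<delta> / 64)"
          using \<open>Im x = 0\<close> unfolding u(3) by (simp add: p_def)
        ultimately have im: "Im y = - sgn \<xi> * (d / 64)" by simp
        have "norm (exp (- \<i> * (y * of_real \<xi>))) = exp (- (\<bar>\<xi>\<bar> * d / 64))"
          by (simp add: im abs_sgn[of \<xi>] algebra_simps)
        then have "norm (f y) \<le> exp (- (\<kappa> / (5 * sqrt (\<delta> * d)))) * exp (- (\<bar>\<xi>\<bar> * d / 64))"
          using bd[OF yR] by (simp add: f_def norm_mult d_def)
        also have "\<dots> \<le> B" by (rule B[OF d])
        finally show ?thesis .
      qed
    qed
    also have "norm (p - x) \<le> \<bar>Re (p - x)\<bar> + \<bar>Im (p - x)\<bar>" by (rule cmod_le)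
    also have "\<dots> \<le> 2 * \<delta>" using x \<delta> sg by (auto simp: l_def r_def p_def abs_mult)
    finally show ?thesis using B0 by (simp add: mult_left_mono)
  qed
  have "norm (g r - g l) \<le> norm (g p - g l) + norm (g p - g r)"
    using norm_triangle_ineq4[of "g p - g l" "g p - g r"] by simp
  also have "\<dots> \<le> B * (2 * \<delta>) + B * (2 * \<delta>)" by (intro add_mono side) auto
  also have "\<dots> \<le> 4 * B" using B0 \<delta> mult_left_mono[of \<delta> 1 B] by simp
  finally have gr: "norm (g r - g l) \<le> 4 * B" .
  have "((\<lambda>x. f (of_real x)) has_integral (g r - g l)) {-\<delta>..\<delta>}"
    using ci[OF mem(1,2)] \<delta> has_contour_integral_linepath_Reals_iff[of l r f "g r - g l"]
    by (simp add: l_def r_def)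
  moreover have "set_integrable lborel {-\<delta>..\<delta>} (\<lambda>x. f (of_real x))"
    unfolding set_integrable_def
    by (intro borel_integrable_atLeastAtMost'[unfolded set_integrable_def] continuous_on_compose2[OF contf] continuous_intros)
       (auto simp: R_def)
  ultimately have "(LINT x:{-\<delta>..\<delta>}|lborel. f (of_real x)) = g r - g l"
    by (simp add: set_borel_integral_eq_integral(2) integral_unique)
  moreover have "fourier_of (arc_bump \<kappa> \<delta>) \<xi> = (LINT x:{-\<delta>..\<delta>}|lborel. f (of_real x))"
    unfolding fourier_of_def set_lebesgue_integral_def
  proof (intro Bochner_Integration.integral_cong refl)
    fix x
    show "arc_bump \<kappa> \<delta> x * character \<xi> x = indicat_real {- \<delta>..\<delta>} x *\<^sub>R f (complex_of_real x)"
    proof (cases "\<bar>x\<bar> < \<delta>")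
      case True
      then have "of_real x \<notin> K" by (auto simp: K_def complex_eq_iff)
      moreover have "arc_bump \<kappa> \<delta> x = exp (- (of_real \<kappa> / csqrt (arc_quadratic \<delta> (of_real x))))"
        using True arc_function_eq_quadratic[OF True \<delta>(2)] by (simp add: arc_bump_def)
      ultimately show ?thesis
        using True by (auto simp: f_def \<Phi>_def character_def indicator_def)
    next
      case False
      then have "x \<in> {-\<delta>..\<delta>} \<Longrightarrow> of_real x \<in> K" by (auto simp: K_def abs_if split: if_splits)
      then show ?thesis using False by (auto simp: arc_bump_def f_def \<Phi>_def indicator_def)
    qed
  qed
  ultimately show ?thesis using gr by simp
qed

lemma fourier_arc_bump_decay:
  assumes "0 < \<delta>" "\<delta> \<le> 1" and "\<kappa> > 0" and "\<xi> \<noteq> 0"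
  shows "norm (fourier_of (arc_bump \<kappa> \<delta>) \<xi>)
    \<le> 4 * (fact m * fact (2 * m) * 6400 ^ m * exp (- (\<kappa> / (10 * \<delta>))) * (\<delta> / \<kappa>\<^sup>2) ^ m / \<bar>\<xi>\<bar> ^ m)"
  by (rule arc_contour_shift[OF assms arc_side_bound[OF assms]])

lemma arc_bump_integrable:
  assumes "0 < \<delta>" "\<delta> \<le> 1" and "\<kappa> > 0"
  shows "integrable lborel (arc_bump \<kappa> \<delta>)"
proof (rule Bochner_Integration.integrable_bound)
  show "integrable lborel (indicat_real {-\<delta>..\<delta>})" using assms by (intro integrable_real_indicator) auto
  show "arc_bump \<kappa> \<delta> \<in> borel_measurable lborel" using assms by simp
  show "AE x in lborel. norm (arc_bump \<kappa> \<delta> x) \<le> norm (indicat_real {- \<delta>..\<delta>} x)"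
  proof (intro AE_I2)
    fix x
    have "exp (- (\<kappa> / (5 * \<delta>))) \<le> 1" using assms by simp
    with norm_arc_bump_le[of \<delta> \<kappa> x] assms have "norm (arc_bump \<kappa> \<delta> x) \<le> 1"
      by linarith
    then show "norm (arc_bump \<kappa> \<delta> x) \<le> norm (indicat_real {- \<delta>..\<delta>} x)"
      by (auto simp: arc_bump_def indicator_def abs_less_iff)
  qed
qed

lemma norm_fourier_arc_bump_le:
  assumes "0 < \<delta>" "\<delta> \<le> 1" and "\<kappa> > 0"
  shows "norm (fourier_of (arc_bump \<kappa> \<delta>) \<xi>) \<le> 4 * exp (- (\<kappa> / (10 * \<delta>)))"
proof -
  have "norm (fourier_of (arc_bump \<kappa> \<delta>) \<xi>) \<le> (\<integral>x. norm (arc_bump \<kappa> \<delta> x * character \<xi> x) \<partial>lborel)"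
    unfolding fourier_of_def by (rule integral_norm_bound)
  also have "\<dots> \<le> (\<integral>x. exp (- (\<kappa> / (5 * \<delta>))) * indicat_real {-\<delta>..\<delta>} x \<partial>lborel)"
  proof (intro integral_mono)
    show "integrable lborel (\<lambda>x. norm (arc_bump \<kappa> \<delta> x * character \<xi> x))"
      using arc_bump_integrable[OF assms] by (simp add: norm_mult integrable_norm)
    show "norm (arc_bump \<kappa> \<delta> x * character \<xi> x) \<le> exp (- (\<kappa> / (5 * \<delta>))) * indicat_real {-\<delta>..\<delta>} x" for x
      using norm_arc_bump_le[of \<delta> \<kappa> x] assms by (auto simp: norm_mult arc_bump_def indicator_def abs_less_iff)
    show "integrable lborel (\<lambda>x. exp (- (\<kappa> / (5 * \<delta>))) * indicat_real {-\<delta>..\<delta>} x)"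
      using assms by (intro integrable_mult_right integrable_real_indicator) auto
  qed
  also have "\<dots> = exp (- (\<kappa> / (5 * \<delta>))) * (2 * \<delta>)" using assms by simp
  also have "\<dots> \<le> exp (- (\<kappa> / (10 * \<delta>))) * 4"
    using assms by (intro mult_mono) (auto simp: field_simps)
  finally show ?thesis by simp
qed

section \<open>Pointwise convergence of Fourier series\<close>

definition circle_measure :: "real measure" where
  "circle_measure = restrict_space lborel {-pi..pi}"

lemma space_circle_measure [simp]: "space circle_measure = {-pi..pi}"
  by (simp add: circle_measure_def space_restrict_space)

lemma measure_circle: "measure circle_measure {-pi..pi} = 2 * pi"
  by (simp add: circle_measure_def measure_restrict_space)

lemma finite_measure_circle: "finite_measure circle_measure"
  by (rule finite_measureI) (simp add: circle_measure_def emeasure_restrict_space space_restrict_space)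

lemma borel_measurable_circle [measurable (raw)]:
  "f \<in> borel_measurable borel \<Longrightarrow> f \<in> borel_measurable circle_measure"
  unfolding circle_measure_def by (intro measurable_restrict_space1) simp

lemma integral_circle: "(\<integral>x. f x \<partial>circle_measure) = (\<integral>x. indicator {-pi..pi} x *\<^sub>R f x \<partial>lborel)"
  for f :: "real \<Rightarrow> 'a::{banach, second_countable_topology}"
  unfolding circle_measure_def by (intro integral_restrict_space) auto

lemma integrable_circle_bounded:
  fixes f :: "real \<Rightarrow> 'a::{banach, second_countable_topology}"
  assumes "f \<in> borel_measurable borel" "\<And>x. x \<in> {-pi..pi} \<Longrightarrow> norm (f x) \<le> B"
  shows "integrable circle_measure f"
proof -
  interpret finite_measure circle_measure by (rule finite_measure_circle)
  show ?thesis
    by (intro integrable_const_bound[where B = B] borel_measurable_circle assms AE_I2)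
       (use assms(2) in simp)
qed

lemma integral_character_circle:
  "(\<integral>x. character (of_int n) x \<partial>circle_measure) = (if n = 0 then of_real (2 * pi) else 0)"
  unfolding integral_circle by (rule integral_character_period)

lemma integrable_character_circle: "integrable circle_measure (character \<xi>)"
  by (intro integrable_circle_bounded[where B = 1]) auto

lemma cnj_character: "cnj (character \<xi> x) = character (- \<xi>) x"
  by (simp add: character_eq_cis cis_cnj)

lemma cnj_measurable [measurable]: "cnj \<in> borel_measurable borel"
  by (intro borel_measurable_continuous_onI continuous_intros)

text \<open>
  The square of the distance of the function to its Fourier partial sum is nonnegative.
\<close>

lemma Bessel_inequality:
  fixes \<phi> :: "real \<Rightarrow> complex"
  assumes meas [measurable]: "\<phi> \<in> borel_measurable borel"
    and bd: "\<And>x. x \<in> {-pi..pi} \<Longrightarrow> norm (\<phi> x) \<le> B" and "finite F"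
  shows "(\<Sum>n\<in>F. (norm (\<integral>x. \<phi> x * character (of_int n) x \<partial>circle_measure))\<^sup>2)
    \<le> 2 * pi * (\<integral>x. (norm (\<phi> x))\<^sup>2 \<partial>circle_measure)"
proof -
  define g where "g n = (\<integral>x. \<phi> x * character (of_int n) x \<partial>circle_measure)" for n :: int
  define s where "s x = (\<Sum>n\<in>F. g n / of_real (2 * pi) * character (- of_int n) x)" for x
  have B0: "B \<ge> 0" using order_trans[OF norm_ge_zero bd[of 0]] by simp
  have s_meas [measurable]: "s \<in> borel_measurable borel" unfolding s_def by measurable
  define C where "C = (\<Sum>n\<in>F. norm (g n) / (2 * pi))"
  have s_bd: "norm (s x) \<le> C" for x
    unfolding s_def C_def by (rule sum_norm_le) (simp add: norm_mult norm_divide)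
  have C0: "C \<ge> 0" unfolding C_def by (intro sum_nonneg) auto
  have cnj_s: "cnj (s x) = (\<Sum>n\<in>F. cnj (g n) / of_real (2 * pi) * character (of_int n) x)" for x
    by (simp add: s_def cnj_character)
  have int: "integrable circle_measure (\<lambda>x. \<phi> x * cnj (\<phi> x))" "integrable circle_measure (\<lambda>x. \<phi> x * cnj (s x))"
      "integrable circle_measure (\<lambda>x. s x * cnj (\<phi> x))" "integrable circle_measure (\<lambda>x. s x * cnj (s x))"
  proof -
    have prod: "integrable circle_measure (\<lambda>x. u x * cnj (v x))"
      if "u \<in> borel_measurable borel" "v \<in> borel_measurable borel" "P \<ge> 0"
        "\<And>x. x \<in> {-pi..pi} \<Longrightarrow> norm (u x) \<le> P" "\<And>x. x \<in> {-pi..pi} \<Longrightarrow> norm (v x) \<le> Q"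
      for u v :: "real \<Rightarrow> complex" and P Q
    proof (rule integrable_circle_bounded)
      show "(\<lambda>x. u x * cnj (v x)) \<in> borel_measurable borel" using that(1,2) by measurable
      show "norm (u x * cnj (v x)) \<le> P * Q" if "x \<in> {-pi..pi}" for x
        using \<open>P \<ge> 0\<close> that \<open>\<And>x. x \<in> {-pi..pi} \<Longrightarrow> norm (u x) \<le> P\<close>
          \<open>\<And>x. x \<in> {-pi..pi} \<Longrightarrow> norm (v x) \<le> Q\<close>
        unfolding norm_mult complex_mod_cnj by (intro mult_mono) auto
    qed
    show "integrable circle_measure (\<lambda>x. \<phi> x * cnj (\<phi> x))" by (rule prod[OF meas meas B0 bd bd])
    show "integrable circle_measure (\<lambda>x. \<phi> x * cnj (s x))" by (rule prod[OF meas s_meas B0 bd s_bd])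
    show "integrable circle_measure (\<lambda>x. s x * cnj (\<phi> x))" by (rule prod[OF s_meas meas C0 s_bd bd])
    show "integrable circle_measure (\<lambda>x. s x * cnj (s x))" by (rule prod[OF s_meas s_meas C0 s_bd s_bd])
  qed
  have int_c: "integrable circle_measure (\<lambda>x. \<phi> x * character \<xi> x)" for \<xi>
    using bd by (intro integrable_circle_bounded[where B = B]) (auto simp: norm_mult)
  define T where "T = (\<Sum>n\<in>F. (norm (g n))\<^sup>2) / (2 * pi)"
  have 1: "(\<integral>x. \<phi> x * cnj (s x) \<partial>circle_measure) = of_real T"
  proof -
    have "(\<integral>x. \<phi> x * cnj (s x) \<partial>circle_measure)
        = (\<integral>x. (\<Sum>n\<in>F. cnj (g n) / of_real (2 * pi) * (\<phi> x * character (of_int n) x)) \<partial>circle_measure)"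
      by (intro Bochner_Integration.integral_cong refl) (simp add: cnj_s sum_distrib_left mult_ac)
    also have "\<dots> = (\<Sum>n\<in>F. cnj (g n) / of_real (2 * pi) * g n)"
      using int_c by (subst Bochner_Integration.integral_sum) (auto simp: g_def)
    also have "\<dots> = of_real T"
      by (simp add: T_def sum_divide_distrib mult.commute[of "cnj _"] flip: complex_norm_square)
    finally show ?thesis .
  qed
  have 2: "(\<integral>x. s x * cnj (\<phi> x) \<partial>circle_measure) = of_real T"
    using arg_cong[OF 1, of cnj] by (simp add: mult.commute flip: Bochner_Integration.integral_cnj)
  have 3: "(\<integral>x. s x * cnj (s x) \<partial>circle_measure) = of_real T"
  proof -
    have coef: "(\<integral>x. s x * character (of_int m) x \<partial>circle_measure) = g m" if "m \<in> F" for m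
    proof -
      have "s x * character (of_int m) x = (\<Sum>n\<in>F. g n / of_real (2 * pi) * character (of_int (m - n)) x)" for x
        unfolding s_def sum_distrib_right
      proof (intro sum.cong refl)
        fix n
        show "g n / of_real (2 * pi) * character (- of_int n) x * character (of_int m) x
            = g n / of_real (2 * pi) * character (of_int (m - n)) x"
          using character_add[of "of_int m" "- of_int n" x] by simp
      qed
      then have "(\<integral>x. s x * character (of_int m) x \<partial>circle_measure)
          = (\<Sum>n\<in>F. g n / of_real (2 * pi) * (\<integral>x. character (of_int (m - n)) x \<partial>circle_measure))"
        by (simp only:, subst Bochner_Integration.integral_sum)
           (auto simp only: integral_mult_right_zero intro!: integrable_mult_right integrable_character_circle)
      also have "\<dots> = (\<Sum>n\<in>F. if n = m then g n else 0)"
        unfolding integral_character_circle by (intro sum.cong) auto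
      finally show ?thesis using that \<open>finite F\<close> by simp
    qed
    have "(\<integral>x. s x * cnj (s x) \<partial>circle_measure)
        = (\<integral>x. (\<Sum>n\<in>F. cnj (g n) / of_real (2 * pi) * (s x * character (of_int n) x)) \<partial>circle_measure)"
      by (intro Bochner_Integration.integral_cong refl) (simp add: cnj_s sum_distrib_left mult_ac)
    also have "\<dots> = (\<Sum>n\<in>F. cnj (g n) / of_real (2 * pi) * (\<integral>x. s x * character (of_int n) x \<partial>circle_measure))"
    proof -
      have "integrable circle_measure (\<lambda>x. s x * character \<xi> x)" for \<xi>
        using s_bd by (intro integrable_circle_bounded[where B = C]) (auto simp: norm_mult)
      then show ?thesis
        by (subst Bochner_Integration.integral_sum)
           (auto intro!: integrable_mult_right simp del: times_divide_eq_left times_divide_eq_right)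
    qed
    also have "\<dots> = (\<Sum>n\<in>F. cnj (g n) / of_real (2 * pi) * g n)" by (simp add: coef)
    also have "\<dots> = of_real T"
      by (simp add: T_def sum_divide_distrib mult.commute[of "cnj _"] flip: complex_norm_square)
    finally show ?thesis .
  qed
  have "of_real (\<integral>x. (norm (\<phi> x - s x))\<^sup>2 \<partial>circle_measure)
      = (\<integral>x. (\<phi> x - s x) * cnj (\<phi> x - s x) \<partial>circle_measure)"
    by (simp only: complex_norm_square[symmetric] integral_complex_of_real)
  also have "\<dots> = (\<integral>x. \<phi> x * cnj (\<phi> x) - \<phi> x * cnj (s x) - (s x * cnj (\<phi> x) - s x * cnj (s x)) \<partial>circle_measure)"
    by (intro Bochner_Integration.integral_cong refl) (simp add: algebra_simps)
  also have "\<dots> = (\<integral>x. \<phi> x * cnj (\<phi> x) \<partial>circle_measure) - of_real T"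
    using int by (simp add: 1 2 3)
  also have "(\<integral>x. \<phi> x * cnj (\<phi> x) \<partial>circle_measure) = of_real (\<integral>x. (norm (\<phi> x))\<^sup>2 \<partial>circle_measure)"
    by (simp only: complex_norm_square[symmetric] integral_complex_of_real)
  finally have "(\<integral>x. (norm (\<phi> x - s x))\<^sup>2 \<partial>circle_measure) = (\<integral>x. (norm (\<phi> x))\<^sup>2 \<partial>circle_measure) - T"
    unfolding of_real_diff[symmetric] of_real_eq_iff .
  moreover have "(\<integral>x. (norm (\<phi> x - s x))\<^sup>2 \<partial>circle_measure) \<ge> 0" by simp
  ultimately have "T \<le> (\<integral>x. (norm (\<phi> x))\<^sup>2 \<partial>circle_measure)" by simp
  then show ?thesis by (simp add: T_def g_def[symmetric] field_simps)
qed

lemma Riemann_Lebesgue_bounded: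
  fixes \<phi> :: "real \<Rightarrow> complex"
  assumes meas: "\<phi> \<in> borel_measurable borel"
    and bd: "\<And>x. x \<in> {-pi..pi} \<Longrightarrow> norm (\<phi> x) \<le> B" and inj: "inj (j :: nat \<Rightarrow> int)"
  shows "(\<lambda>k. \<integral>x. \<phi> x * character (of_int (j k)) x \<partial>circle_measure) \<longlonglongrightarrow> 0"
proof -
  let ?g = "\<lambda>n. \<integral>x. \<phi> x * character (of_int n) x \<partial>circle_measure"
  have "summable (\<lambda>k. (norm (?g (j k)))\<^sup>2)"
  proof (rule bounded_imp_summable)
    fix K
    have "(\<Sum>k\<le>K. (norm (?g (j k)))\<^sup>2) = (\<Sum>n\<in>j ` {..K}. (norm (?g n))\<^sup>2)"
      using inj by (subst sum.reindex) (auto intro: inj_on_subset)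
    also have "\<dots> \<le> 2 * pi * (\<integral>x. (norm (\<phi> x))\<^sup>2 \<partial>circle_measure)"
      by (rule Bessel_inequality[OF meas bd]) auto
    finally show "(\<Sum>k\<le>K. (norm (?g (j k)))\<^sup>2) \<le> 2 * pi * (\<integral>x. (norm (\<phi> x))\<^sup>2 \<partial>circle_measure)" .
  qed simp
  then have "(\<lambda>k. (norm (?g (j k)))\<^sup>2) \<longlonglongrightarrow> 0" by (rule summable_LIMSEQ_zero)
  then have "(\<lambda>k. sqrt ((norm (?g (j k)))\<^sup>2)) \<longlonglongrightarrow> sqrt 0" by (rule tendsto_real_sqrt)
  then show ?thesis by (simp add: tendsto_norm_zero_iff)
qed

text \<open>
  Dividing \<open>f(x) - f(x0)\<close> by \<open>e^(i (x - x0)) - 1\<close> gives a bounded function, by the Lipschitz condition, and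
  the terms of the series become differences of consecutive coefficients of that function. The sum telescopes, and
  the boundary terms vanish by the Riemann-Lebesgue lemma.
\<close>

lemma Fourier_symmetric_partial_sums:
  fixes f :: "real \<Rightarrow> complex"
  assumes meas [measurable]: "f \<in> borel_measurable borel" and bd: "\<And>x. norm (f x) \<le> B"
    and x0: "-pi < x0" "x0 < pi"
    and lip: "\<eta> > 0" "\<And>x. \<bar>x - x0\<bar> < \<eta> \<Longrightarrow> norm (f x - f x0) \<le> L * \<bar>x - x0\<bar>"
  shows "(\<lambda>K. \<Sum>n\<in>{- int K..int K}. (\<integral>x. f x * character (of_int n) x \<partial>circle_measure) * character (- of_int n) x0)
    \<longlonglongrightarrow> of_real (2 * pi) * f x0"
proof -
  define \<phi> where "\<phi> x = (f x - f x0) / (character (-1) (x - x0) - 1)" for x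
  have B0: "B \<ge> 0" using bd[of 0] norm_ge_zero order_trans by blast
  have char_ne: "character (-1) (x - x0) \<noteq> 1" if "x \<in> {-pi..pi}" "x \<noteq> x0" for x
  proof
    assume "character (-1) (x - x0) = 1"
    then have "cos (x - x0) = 1" by (simp add: character_eq_cis cis.code complex_eq_iff)
    then obtain n :: int where n: "x - x0 = of_int n * 2 * pi" using cos_one_2pi_int by auto
    have "\<bar>x - x0\<bar> < 2 * pi" using that x0 by auto
    then have "\<bar>of_int n :: real\<bar> * (2 * pi) < 1 * (2 * pi)" unfolding n by (simp add: abs_mult)
    then have "\<bar>of_int n :: real\<bar> < 1" by (simp only: mult_less_cancel_right) simp
    then have "n = 0" by linarith
    then show False using n that by simp
  qed
  have char_cont: "continuous_on A (\<lambda>x. norm (character (-1) (x - x0) - 1))" for A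
    unfolding character_def by (intro continuous_intros)
  have \<phi>_meas [measurable]: "\<phi> \<in> borel_measurable borel"
    unfolding \<phi>_def by measurable
  obtain D where D: "\<And>x. x \<in> {-pi..pi} \<Longrightarrow> norm (\<phi> x) \<le> D"
  proof -
    \<comment> \<open>Near \<open>x0\<close> the Lipschitz bound applies; elsewhere the denominator is bounded below by compactness.\<close>
    define \<eta>' where "\<eta>' = min \<eta> 1"
    have \<eta>': "0 < \<eta>'" "\<eta>' \<le> \<eta>" "\<eta>' \<le> 1" using lip(1) by (auto simp: \<eta>'_def)
    have near: "norm (\<phi> x) \<le> 2 * \<bar>L\<bar>" if "\<bar>x - x0\<bar> < \<eta>'" for x
    proof (cases "x = x0")
      case True then show ?thesis by (simp add: \<phi>_def)
    next
      case False
      let ?u = "x - x0"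
      have u: "0 < \<bar>?u\<bar>" "\<bar>?u\<bar> \<le> 1" using False that \<eta>' by auto
      have "\<bar>sin ?u\<bar> \<le> norm (character (-1) ?u - 1)"
        using abs_Im_le_cmod[of "character (-1) ?u - 1"] by (simp add: character_eq_cis)
      moreover have "\<bar>sin ?u\<bar> \<ge> \<bar>?u\<bar> / 2"
      proof -
        have "\<bar>?u\<bar> / 2 \<le> sin \<bar>?u\<bar>" using u by (intro sin_ge_half) auto
        also have "sin \<bar>v\<bar> \<le> \<bar>sin v\<bar>" for v :: real by (cases "v \<ge> 0") auto
        finally show ?thesis .
      qed
      ultimately have ge: "norm (character (-1) ?u - 1) \<ge> \<bar>?u\<bar> / 2" by linarith
      have "norm (\<phi> x) \<le> (\<bar>L\<bar> * \<bar>?u\<bar>) / (\<bar>?u\<bar> / 2)"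
        unfolding \<phi>_def norm_divide
      proof (rule frac_le)
        have "norm (f x - f x0) \<le> L * \<bar>?u\<bar>" using that \<eta>' by (intro lip(2)) auto
        also have "\<dots> \<le> \<bar>L\<bar> * \<bar>?u\<bar>" by (intro mult_right_mono) auto
        finally show "norm (f x - f x0) \<le> \<bar>L\<bar> * \<bar>?u\<bar>" .
      qed (use u ge in auto)
      then show ?thesis using u by simp
    qed
    define A where "A = {-pi..pi} - {x0 - \<eta>'<..<x0 + \<eta>'}"
    have cA: "compact A" unfolding A_def by (intro compact_diff) auto
    show thesis
    proof (cases "A = {}")
      case True
      show ?thesis
      proof (rule that)
        fix x assume "x \<in> {-pi..pi}"
        moreover have "x \<notin> A" using True by simp
        ultimately have "\<bar>x - x0\<bar> < \<eta>'" by (auto simp: A_def)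
        then show "norm (\<phi> x) \<le> 2 * \<bar>L\<bar>" by (rule near)
      qed
    next
      case False
      obtain y where y: "y \<in> A" "\<And>x. x \<in> A \<Longrightarrow> norm (character (-1) (y - x0) - 1) \<le> norm (character (-1) (x - x0) - 1)"
        using continuous_attains_inf[OF cA False char_cont] by blast
      define m where "m = norm (character (-1) (y - x0) - 1)"
      have m: "m > 0" using char_ne[of y] y(1) \<eta>' by (auto simp: m_def A_def)
      show ?thesis
      proof (rule that)
        fix x assume x: "x \<in> {-pi..pi}"
        show "norm (\<phi> x) \<le> 2 * \<bar>L\<bar> + 2 * B / m"
        proof (cases "x \<in> A")
          case True
          have "norm (\<phi> x) \<le> (2 * B) / m"
            unfolding \<phi>_def norm_divide
          proof (rule frac_le)
            show "norm (f x - f x0) \<le> 2 * B"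
              using norm_triangle_ineq4[of "f x" "f x0"] bd[of x] bd[of x0] by linarith
          qed (use m y(2)[OF True] B0 in \<open>auto simp: m_def\<close>)
          then show ?thesis by simp
        next
          case False
          then have "\<bar>x - x0\<bar> < \<eta>'" using x by (auto simp: A_def)
          then have "norm (\<phi> x) \<le> 2 * \<bar>L\<bar>" by (rule near)
          moreover have "2 * B / m \<ge> 0" using m B0 by simp
          ultimately show ?thesis by linarith
        qed
      qed
    qed
  qed
  define g where "g n = (\<integral>x. \<phi> x * character (of_int n) x \<partial>circle_measure) * character (- of_int n) x0" for n :: int
  have g_lim: "(\<lambda>K. g (j K)) \<longlonglongrightarrow> 0" if "inj j" for j :: "nat \<Rightarrow> int"
  proof (rule tendsto_norm_zero_cancel)
    have "(\<lambda>k. norm (\<integral>x. \<phi> x * character (of_int (j k)) x \<partial>circle_measure)) \<longlonglongrightarrow> 0"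
      using Riemann_Lebesgue_bounded[OF \<phi>_meas D that] by (rule tendsto_norm_zero)
    then show "(\<lambda>k. norm (g (j k))) \<longlonglongrightarrow> 0" by (simp add: g_def norm_mult)
  qed
  have int_f: "integrable circle_measure (\<lambda>x. f x * character \<xi> x)" for \<xi>
    using bd by (intro integrable_circle_bounded[where B = B]) (auto simp: norm_mult)
  have int_\<phi>: "integrable circle_measure (\<lambda>x. \<phi> x * character \<xi> x)" for \<xi>
    using D by (intro integrable_circle_bounded[where B = D]) (auto simp: norm_mult)
  note int_c = integrable_character_circle
  \<comment> \<open>The coefficient of \<open>f\<close> as a difference of two consecutive coefficients of \<open>\<phi>\<close>, plus the constant \<open>f x0\<close> at \<open>n = 0\<close>.\<close>
  have tele: "(\<integral>x. f x * character (of_int n) x \<partial>circle_measure) * character (- of_int n) x0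
      = (if n = 0 then of_real (2 * pi) * f x0 else 0) + (g (n - 1) - g n)" for n
  proof -
    have "(\<integral>x. f x * character (of_int n) x - f x0 * character (of_int n) x \<partial>circle_measure)
        = (\<integral>x. character (- 1) (- x0) * (\<phi> x * character (of_int (n - 1)) x) - \<phi> x * character (of_int n) x \<partial>circle_measure)"
    proof (rule Bochner_Integration.integral_cong_AE)
      have "AE x in circle_measure. x \<noteq> x0"
        unfolding circle_measure_def by (subst AE_restrict_space_iff) (auto intro: AE_mp[OF AE_lborel_singleton[of x0]])
      moreover have "AE x in circle_measure. x \<in> {-pi..pi}" by (intro AE_I2) simp
      ultimately show "AE x in circle_measure. f x * character (of_int n) x - f x0 * character (of_int n) x
          = character (- 1) (- x0) * (\<phi> x * character (of_int (n - 1)) x) - \<phi> x * character (of_int n) x"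
      proof eventually_elim
        case (elim x)
        have eq: "f x - f x0 = \<phi> x * (character (-1) (x - x0) - 1)"
          using char_ne[of x] elim by (simp add: \<phi>_def)
        have ch: "character (-1) (x - x0) * character (of_int n) x = character (- 1) (- x0) * character (of_int (n - 1)) x"
          by (simp add: character_eq_cis cis_mult algebra_simps)
        have "f x * character (of_int n) x - f x0 * character (of_int n) x = (f x - f x0) * character (of_int n) x"
          by (simp add: algebra_simps)
        also have "\<dots> = \<phi> x * (character (-1) (x - x0) * character (of_int n) x) - \<phi> x * character (of_int n) x"
          unfolding eq by (simp add: algebra_simps)
        also have "\<dots> = character (- 1) (- x0) * (\<phi> x * character (of_int (n - 1)) x) - \<phi> x * character (of_int n) x"
          unfolding ch by (simp add: algebra_simps)
        finally show ?case .
      qed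
    qed measurable
    then have "(\<integral>x. f x * character (of_int n) x \<partial>circle_measure) - f x0 * (\<integral>x. character (of_int n) x \<partial>circle_measure)
        = character (- 1) (- x0) * (\<integral>x. \<phi> x * character (of_int (n - 1)) x \<partial>circle_measure)
          - (\<integral>x. \<phi> x * character (of_int n) x \<partial>circle_measure)"
      using int_f int_\<phi> int_c by simp
    then have "((\<integral>x. f x * character (of_int n) x \<partial>circle_measure) - f x0 * (\<integral>x. character (of_int n) x \<partial>circle_measure)) * character (- of_int n) x0
        = (character (- 1) (- x0) * (\<integral>x. \<phi> x * character (of_int (n - 1)) x \<partial>circle_measure)
          - (\<integral>x. \<phi> x * character (of_int n) x \<partial>circle_measure)) * character (- of_int n) x0"
      by simp
    also have "\<dots> = g (n - 1) - g n"
    proof -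
      have "character (- 1) (- x0) * character (- of_int n) x0 = character (- of_int (n - 1)) x0"
        by (simp add: character_eq_cis cis_mult algebra_simps)
      then show ?thesis by (simp add: g_def algebra_simps)
    qed
    finally have e: "(\<integral>x. f x * character (of_int n) x \<partial>circle_measure) * character (- of_int n) x0
      = f x0 * (\<integral>x. character (of_int n) x \<partial>circle_measure) * character (- of_int n) x0 + (g (n - 1) - g n)"
      by (simp add: algebra_simps)
    have "character 0 x0 = 1" by (simp add: character_def)
    then have "f x0 * (\<integral>x. character (of_int n) x \<partial>circle_measure) * character (- of_int n) x0
        = (if n = 0 then of_real (2 * pi) * f x0 else 0)"
      by (simp add: integral_character_circle)
    then show ?thesis using e by simp
  qed
  have part: "(\<Sum>n\<in>{- int K..int K}. (\<integral>x. f x * character (of_int n) x \<partial>circle_measure) * character (- of_int n) x0)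
      = of_real (2 * pi) * f x0 + (g (- int K - 1) - g (int K))" for K
  proof -
    have tel: "(\<Sum>n\<in>{- int K..int K}. g (n - 1) - g n) = g (- int K - 1) - g (int K)"
    proof (induction K)
      case (Suc K)
      have "{- int (Suc K)..int (Suc K)} = insert (- int K - 1) (insert (int K + 1) {- int K..int K})" by auto
      then show ?case using Suc by (simp add: algebra_simps)
    qed simp
    show ?thesis unfolding tele sum.distrib tel by simp
  qed
  have "(\<lambda>K. of_real (2 * pi) * f x0 + (g (- int K - 1) - g (int K))) \<longlonglongrightarrow> of_real (2 * pi) * f x0 + (0 - 0)"
    by (intro tendsto_intros g_lim) (auto simp: inj_def)
  then show ?thesis unfolding part by simp
qed

section \<open>Fourier series of the arc piece\<close>

text \<open>
  The order 0, -1, 1, -2, 2, ... makes symmetric partial sums over the integers a subsequence of the partial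
  sums over the natural numbers.
\<close>

definition enum_int :: "nat \<Rightarrow> int" where
  "enum_int j = (if even j then int (j div 2) else - int (j div 2) - 1)"

lemma sum_enum_int:
  fixes a :: "int \<Rightarrow> 'a::ab_group_add"
  shows "(\<Sum>j<2 * K + 1. a (enum_int j)) = (\<Sum>n\<in>{- int K..int K}. a n)"
proof (induction K)
  case 0
  show ?case by (simp add: enum_int_def)
next
  case (Suc K)
  have "{- int (Suc K)..int (Suc K)} = insert (- int K - 1) (insert (int K + 1) {- int K..int K})" by auto
  then have "(\<Sum>n\<in>{- int (Suc K)..int (Suc K)}. a n)
      = (\<Sum>n\<in>{- int K..int K}. a n) + a (- int K - 1) + a (int K + 1)"
    by (simp only:, subst sum.insert) (auto simp: algebra_simps)
  moreover have "enum_int (2 * K + 1) = - int K - 1" "enum_int (2 * K + 2) = int K + 1"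
    by (auto simp: enum_int_def)
  moreover have "(\<Sum>j<2 * Suc K + 1. a (enum_int j))
      = (\<Sum>j<2 * K + 1. a (enum_int j)) + a (enum_int (2 * K + 1)) + a (enum_int (2 * K + 2))"
    by (simp add: numeral_eq_Suc)
  ultimately show ?case using Suc by (simp only:)
qed

lemma abs_enum_int_ge: "real (Suc j) \<le> 4 * \<bar>real_of_int (enum_int j)\<bar>" if "j > 0"
proof -
  have "int (Suc j) \<le> 4 * \<bar>enum_int j\<bar>"
    using that by (auto simp: enum_int_def elim!: evenE oddE)
  then have "real_of_int (int (Suc j)) \<le> real_of_int (4 * \<bar>enum_int j\<bar>)"
    by (simp only: of_int_le_iff)
  then show ?thesis by simp
qed

definition arc_piece :: "real \<Rightarrow> real \<Rightarrow> real \<Rightarrow> complex" where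
  "arc_piece \<kappa> \<delta> y = (if cos y > cos \<delta> then arc_function \<kappa> \<delta> (character 1 y) else 0)"

definition arc_cutoff :: "real \<Rightarrow> real \<Rightarrow> real \<Rightarrow> complex" where
  "arc_cutoff \<kappa> \<delta> y = (if cos y > cos \<delta> then 0 else arc_function \<kappa> \<delta> (character 1 y))"

lemma arc_cutoff_eq: "arc_cutoff \<kappa> \<delta> y = arc_function \<kappa> \<delta> (character 1 y) - arc_piece \<kappa> \<delta> y"
  by (simp add: arc_cutoff_def arc_piece_def)

lemma arc_piece_eq_bump:
  assumes "0 < \<delta>" "\<delta> \<le> 1" "\<bar>y\<bar> \<le> pi"
  shows "arc_piece \<kappa> \<delta> y = arc_bump \<kappa> \<delta> y"
proof -
  have "cos y = cos \<bar>y\<bar>" by simp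
  then have "cos y > cos \<delta> \<longleftrightarrow> \<bar>y\<bar> < \<delta>"
    using assms cos_mono_less_eq[of \<delta> "\<bar>y\<bar>"] pi_gt3 by simp
  then show ?thesis by (simp add: arc_piece_def arc_bump_def)
qed

lemma character_int_periodic: "character (of_int n) (x + 2 * pi * of_int k) = character (of_int n) x"
proof -
  have "character (of_int n) (x + 2 * pi * of_int k) = character (of_int n) x * cis (2 * pi * of_int (- (n * k)))"
    by (simp add: character_eq_cis cis_mult algebra_simps)
  also have "cis (2 * pi * of_int (- (n * k))) = 1" by (rule cis_multiple_2pi) auto
  finally show ?thesis by simp
qed

lemma cos_int_periodic: "cos (x + 2 * pi * of_int k) = cos x"
  using arg_cong[OF character_int_periodic[of "-1" x k], of Re] by (simp add: character_eq_cis add.commute)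

lemma arc_piece_periodic: "arc_piece \<kappa> \<delta> (x + 2 * pi * of_int k) = arc_piece \<kappa> \<delta> x"
  using character_int_periodic[of 1 x k] by (simp add: arc_piece_def cos_int_periodic)

lemma period_representative:
  fixes y :: real
  obtains k :: int and x where "x = y + 2 * pi * of_int k" "-pi \<le> x" "x < pi"
proof -
  define k where "k = \<lfloor>(y + pi) / (2 * pi)\<rfloor>"
  have "of_int k \<le> (y + pi) / (2 * pi)" "(y + pi) / (2 * pi) < of_int k + 1"
    unfolding k_def by linarith+
  then have "of_int k * (2 * pi) \<le> y + pi" "y + pi < (of_int k + 1) * (2 * pi)"
    by (simp_all add: pos_le_divide_eq pos_divide_less_eq)
  then show ?thesis
    by (intro that[of "y + 2 * pi * of_int (- k)" "- k"]) (auto simp: algebra_simps)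
qed

text \<open>
  Away from the two endpoints the bump is either locally zero or the restriction of an analytic function.
\<close>

lemma arc_bump_locally_Lipschitz:
  assumes \<delta>: "0 < \<delta>" "\<delta> \<le> 1" and x0: "\<bar>x0\<bar> \<noteq> \<delta>"
  obtains \<eta> L where "\<eta> > 0" "\<And>x. \<bar>x - x0\<bar> < \<eta> \<Longrightarrow> norm (arc_bump \<kappa> \<delta> x - arc_bump \<kappa> \<delta> x0) \<le> L * \<bar>x - x0\<bar>"
proof (cases "\<bar>x0\<bar> < \<delta>")
  case False
  show ?thesis
  proof (rule that[of "\<bar>x0\<bar> - \<delta>" 0])
    show "norm (arc_bump \<kappa> \<delta> x - arc_bump \<kappa> \<delta> x0) \<le> 0 * \<bar>x - x0\<bar>" if "\<bar>x - x0\<bar> < \<bar>x0\<bar> - \<delta>" for x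
    proof -
      have "\<not> \<bar>x\<bar> < \<delta>" using that by linarith
      then show ?thesis using False by (simp add: arc_bump_def)
    qed
  qed (use x0 False in auto)
next
  case True
  let ?f = "\<lambda>y. exp (- (of_real \<kappa> / csqrt (arc_quadratic \<delta> y)))"
  have "?f field_differentiable at (of_real x0)"
    by (rule arc_exponential_differentiable[OF \<delta> refl]) (use True in auto)
  then obtain D where D: "(?f has_field_derivative D) (at (of_real x0))"
    by (auto simp: field_differentiable_def)
  then have "((\<lambda>y. norm ((?f y - ?f (of_real x0)) / (y - of_real x0))) \<longlongrightarrow> norm D) (at (of_real x0))"
    by (intro tendsto_norm) (simp add: has_field_derivative_iff)
  then have "\<forall>\<^sub>F y in at (of_real x0). norm ((?f y - ?f (of_real x0)) / (y - of_real x0)) < norm D + 1"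
    by (rule order_tendstoD(2)) simp
  then obtain e where e: "e > 0" "\<And>y. y \<noteq> of_real x0 \<Longrightarrow> dist y (of_real x0) < e \<Longrightarrow>
      norm ((?f y - ?f (of_real x0)) / (y - of_real x0)) < norm D + 1"
    unfolding eventually_at by auto
  show ?thesis
  proof (rule that[of "min e (\<delta> - \<bar>x0\<bar>)" "norm D + 1"])
    show "min e (\<delta> - \<bar>x0\<bar>) > 0" using e True by simp
    fix x assume x: "\<bar>x - x0\<bar> < min e (\<delta> - \<bar>x0\<bar>)"
    then have xd: "\<bar>x\<bar> < \<delta>" by linarith
    show "norm (arc_bump \<kappa> \<delta> x - arc_bump \<kappa> \<delta> x0) \<le> (norm D + 1) * \<bar>x - x0\<bar>"
    proof (cases "x = x0")
      case False
      have nd: "norm (complex_of_real x - of_real x0) = \<bar>x - x0\<bar>"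
        by (metis norm_of_real of_real_diff)
      have "norm ((?f (of_real x) - ?f (of_real x0)) / (of_real x - of_real x0)) < norm D + 1"
        using x False nd by (intro e(2)) (auto simp: dist_norm)
      then have "norm (?f (of_real x) - ?f (of_real x0)) \<le> (norm D + 1) * \<bar>x - x0\<bar>"
        using False unfolding norm_divide nd by (simp add: pos_divide_less_eq)
      then show ?thesis using xd True \<delta> by (simp add: arc_bump_def arc_function_eq_quadratic)
    qed simp
  qed
qed

lemma arc_piece_Fourier_series:
  assumes \<delta>: "0 < \<delta>" "\<delta> \<le> 1" and \<kappa>: "\<kappa> > 0"
    and sm: "summable (\<lambda>j. norm (fourier_of (arc_bump \<kappa> \<delta>) (of_int (enum_int j))))"
    and y: "cos y \<noteq> cos \<delta>" "cos y \<noteq> -1"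
  shows "(\<lambda>j. fourier_of (arc_bump \<kappa> \<delta>) (of_int (enum_int j)) / of_real (2 * pi) * character (- of_int (enum_int j)) y)
    sums arc_piece \<kappa> \<delta> y"
proof -
  obtain k :: int and x0 where x0_def: "x0 = y + 2 * pi * of_int k" and "-pi \<le> x0" "x0 < pi"
    by (rule period_representative)
  have cos_x0: "cos x0 = cos y" unfolding x0_def by (rule cos_int_periodic)
  have "x0 \<noteq> -pi" using cos_x0 y(2) by auto
  moreover have "\<bar>x0\<bar> \<noteq> \<delta>"
  proof
    assume "\<bar>x0\<bar> = \<delta>"
    then have "cos \<delta> = cos x0" by (auto simp: abs_if split: if_splits)
    then show False using cos_x0 y(1) by simp
  qed
  ultimately have x0: "-pi < x0" "x0 < pi" "\<bar>x0\<bar> \<noteq> \<delta>"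
    using \<open>-pi \<le> x0\<close> \<open>x0 < pi\<close> by auto
  obtain \<eta> L where L: "\<eta> > 0" "\<And>x. \<bar>x - x0\<bar> < \<eta> \<Longrightarrow> norm (arc_bump \<kappa> \<delta> x - arc_bump \<kappa> \<delta> x0) \<le> L * \<bar>x - x0\<bar>"
    using arc_bump_locally_Lipschitz[OF \<delta> x0(3)] by blast
  have coef: "(\<integral>x. arc_bump \<kappa> \<delta> x * character (of_int n) x \<partial>circle_measure) = fourier_of (arc_bump \<kappa> \<delta>) (of_int n)" for n
    unfolding integral_circle fourier_of_def
    using \<delta> pi_gt3 by (intro Bochner_Integration.integral_cong refl) (auto simp: arc_bump_def indicator_def)
  let ?a = "\<lambda>n. fourier_of (arc_bump \<kappa> \<delta>) (of_int n) * character (- of_int n) x0"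
  have "(\<lambda>K. \<Sum>n\<in>{- int K..int K}. (\<integral>x. arc_bump \<kappa> \<delta> x * character (of_int n) x \<partial>circle_measure) * character (- of_int n) x0)
    \<longlonglongrightarrow> of_real (2 * pi) * arc_bump \<kappa> \<delta> x0"
    by (rule Fourier_symmetric_partial_sums[OF _ norm_arc_bump_le x0(1,2) L]) (use \<delta> \<kappa> in auto)
  then have lim1: "(\<lambda>K. \<Sum>n\<in>{- int K..int K}. ?a n) \<longlonglongrightarrow> of_real (2 * pi) * arc_bump \<kappa> \<delta> x0"
    unfolding coef .
  have sma: "summable (\<lambda>j. ?a (enum_int j))"
    by (rule summable_norm_cancel) (use sm in \<open>simp add: norm_mult\<close>)
  then have "(\<lambda>m. \<Sum>j<m. ?a (enum_int j)) \<longlonglongrightarrow> (\<Sum>j. ?a (enum_int j))" by (rule summable_LIMSEQ)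
  then have "(\<lambda>K. \<Sum>j<2 * K + 1. ?a (enum_int j)) \<longlonglongrightarrow> (\<Sum>j. ?a (enum_int j))"
    by (rule LIMSEQ_subseq_LIMSEQ[unfolded o_def, of _ _ "\<lambda>K. 2 * K + 1"]) (auto simp: strict_mono_def)
  then have "(\<Sum>j. ?a (enum_int j)) = of_real (2 * pi) * arc_bump \<kappa> \<delta> x0"
    unfolding sum_enum_int[where a = ?a] by (rule LIMSEQ_unique[OF _ lim1])
  with sma have "(\<lambda>j. ?a (enum_int j)) sums (of_real (2 * pi) * arc_bump \<kappa> \<delta> x0)"
    by (metis summable_sums)
  then have "(\<lambda>j. ?a (enum_int j) / of_real (2 * pi)) sums (of_real (2 * pi) * arc_bump \<kappa> \<delta> x0 / of_real (2 * pi))"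
    by (rule sums_divide)
  moreover have "of_real (2 * pi) * arc_bump \<kappa> \<delta> x0 / of_real (2 * pi) = arc_piece \<kappa> \<delta> y"
  proof -
    have "arc_piece \<kappa> \<delta> y = arc_piece \<kappa> \<delta> x0" unfolding x0_def by (rule arc_piece_periodic[symmetric])
    also have "\<dots> = arc_bump \<kappa> \<delta> x0" using x0 by (intro arc_piece_eq_bump \<delta>) auto
    finally show ?thesis by simp
  qed
  moreover have "character (- of_int n) x0 = character (- of_int n) y" for n
    using character_int_periodic[of "- n" y k] by (simp add: x0_def)
  ultimately show ?thesis by simp
qed

lemma countable_cos_eq: "countable {x. cos (real N * x) = cos c}" if "N > 0"
proof -
  have "{x. cos (real N * x) = cos c}
      \<subseteq> (\<lambda>n::int. (c + 2 * of_int n * pi) / real N) ` UNIV \<union> (\<lambda>n::int. (- c + 2 * of_int n * pi) / real N) ` UNIV"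
  proof
    fix x assume "x \<in> {x. cos (real N * x) = cos c}"
    then obtain n where n: "n \<in> \<int>" "real N * x = c + 2 * n * pi \<or> real N * x = - c + 2 * n * pi"
      by (auto simp: cos_eq)
    then obtain m :: int where "n = of_int m" by (auto elim: Ints_cases)
    moreover have xN: "x = (real N * x) / real N" using that by simp
    ultimately have "x = (c + 2 * of_int m * pi) / real N \<or> x = (- c + 2 * of_int m * pi) / real N"
      using n(2) by (metis (no_types))
    then show "x \<in> (\<lambda>n::int. (c + 2 * of_int n * pi) / real N) ` UNIV \<union> (\<lambda>n::int. (- c + 2 * of_int n * pi) / real N) ` UNIV"
      by (elim disjE) (auto simp only: intro: rangeI)
  qed
  then show ?thesis by (rule countable_subset) auto
qed

lemma AE_arc_piece_Fourier_series:
  assumes \<delta>: "0 < \<delta>" "\<delta> \<le> 1" and \<kappa>: "\<kappa> > 0" and N: "N > 0"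
    and sm: "summable (\<lambda>j. norm (fourier_of (arc_bump \<kappa> \<delta>) (of_int (enum_int j))))"
  shows "AE x in lborel. (\<lambda>j. fourier_of (arc_bump \<kappa> \<delta>) (of_int (enum_int j)) / of_real (2 * pi)
      * character (- (of_int (enum_int j) * real N)) x) sums arc_piece \<kappa> \<delta> (real N * x)"
proof -
  have "countable ({x. cos (real N * x) = cos \<delta>} \<union> {x. cos (real N * x) = cos pi})"
    using countable_cos_eq[OF N] by (intro countable_Un)
  then have "AE x in lborel. x \<notin> {x. cos (real N * x) = cos \<delta>} \<union> {x. cos (real N * x) = cos pi}"
    by (intro AE_not_in countable_imp_null_set_lborel)
  then show ?thesis
  proof eventually_elim
    case (elim x)
    have "character (- of_int n) (real N * x) = character (- (of_int n * real N)) x" for n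
      by (simp add: character_eq_cis mult_ac)
    then show ?case
      using arc_piece_Fourier_series[OF \<delta> \<kappa> sm, of "real N * x"] elim by simp
  qed
qed

text \<open>
  The decay exponent \<open>A + 2\<close> leaves an inverse square after the weight has been absorbed, which makes the bound
  summable over all coefficients with a constant independent of the parameters.
\<close>

lemma arc_coefficient_bound:
  obtains C where "C > 0"
    "\<And>\<delta> \<kappa> N j. 0 < \<delta> \<Longrightarrow> \<delta> \<le> 1 \<Longrightarrow> \<kappa> > 0 \<Longrightarrow> N \<ge> 1 \<Longrightarrow>
       norm (fourier_of (arc_bump \<kappa> \<delta>) (of_int (enum_int j))) * (1 + \<bar>of_int (enum_int j) * real N\<bar>) ^ A
       \<le> C * exp (- (\<kappa> / (10 * \<delta>))) * (1 + (\<delta> / \<kappa>\<^sup>2) ^ (A + 2)) * real N ^ A / (real (Suc j))\<^sup>2"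
proof -
  define m where "m = A + 2"
  define c :: real where "c = 4 * (fact m * fact (2 * m) * 6400 ^ m)"
  define C where "C = c * 2 ^ A * 16"
  have c4: "c \<ge> 4"
  proof -
    have "1 * 1 * 1 \<le> (fact m * fact (2 * m) * 6400 ^ m :: real)"
      by (intro mult_mono) (auto intro: fact_ge_1)
    then show ?thesis by (simp add: c_def)
  qed
  have cC: "c \<le> C"
  proof -
    have "c * 1 * 1 \<le> c * 2 ^ A * 16" using c4 by (intro mult_mono) auto
    then show ?thesis by (simp add: C_def)
  qed
  show ?thesis
  proof (rule that[of C])
    show "C > 0" using cC c4 by linarith
    fix \<delta> \<kappa> :: real and N j :: nat
    assume \<delta>: "0 < \<delta>" "\<delta> \<le> 1" and \<kappa>: "\<kappa> > 0" and N: "N \<ge> 1"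
    define n where "n = real_of_int (enum_int j)"
    define e where "e = exp (- (\<kappa> / (10 * \<delta>)))"
    define r where "r = (\<delta> / \<kappa>\<^sup>2) ^ m"
    have e: "e > 0" and r: "r \<ge> 0" using \<delta> by (auto simp: e_def r_def)
    have N1: "real N \<ge> 1" using N by simp
    have "norm (fourier_of (arc_bump \<kappa> \<delta>) n) * (1 + \<bar>n * real N\<bar>) ^ A \<le> C * e * (1 + r) * real N ^ A / (real (Suc j))\<^sup>2"
    proof (cases "j = 0")
      case True
      then have n0: "n = 0" by (simp add: n_def enum_int_def)
      have "norm (fourier_of (arc_bump \<kappa> \<delta>) n) \<le> 4 * e"
        unfolding e_def by (rule norm_fourier_arc_bump_le[OF \<delta> \<kappa>])
      also have "\<dots> \<le> (C * e) * 1 * 1" using e c4 cC by simp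
      also have "\<dots> \<le> (C * e) * (1 + r) * real N ^ A"
        using e c4 cC r N1 by (intro mult_mono one_le_power) auto
      finally show ?thesis using True n0 by simp
    next
      case False
      then have n4: "real (Suc j) \<le> 4 * \<bar>n\<bar>" unfolding n_def by (intro abs_enum_int_ge) simp
      then have n0: "\<bar>n\<bar> > 0" by linarith
      have n1: "\<bar>n\<bar> \<ge> 1"
      proof -
        have "enum_int j \<noteq> 0" using n0 by (auto simp: n_def)
        then show ?thesis by (simp add: n_def)
      qed
      have "norm (fourier_of (arc_bump \<kappa> \<delta>) n) \<le> c * e * r / \<bar>n\<bar> ^ m"
        using fourier_arc_bump_decay[OF \<delta> \<kappa>, of n m] n0 by (simp add: c_def e_def r_def algebra_simps)
      moreover have "(1 + \<bar>n * real N\<bar>) ^ A \<le> (2 * (\<bar>n\<bar> * real N)) ^ A"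
      proof (rule power_mono)
        have "1 * 1 \<le> \<bar>n\<bar> * real N" using n1 N1 by (intro mult_mono) auto
        then show "1 + \<bar>n * real N\<bar> \<le> 2 * (\<bar>n\<bar> * real N)" by (simp add: abs_mult)
      qed auto
      ultimately have "norm (fourier_of (arc_bump \<kappa> \<delta>) n) * (1 + \<bar>n * real N\<bar>) ^ A
          \<le> c * e * r / \<bar>n\<bar> ^ m * (2 * (\<bar>n\<bar> * real N)) ^ A"
        by (intro mult_mono) (auto intro: order_trans[OF norm_ge_zero])
      also have "\<dots> = c * 2 ^ A * e * r * real N ^ A / \<bar>n\<bar>\<^sup>2"
        using n0 by (simp add: m_def power_add power_mult_distrib power2_eq_square field_simps)
      also have "\<dots> \<le> c * 2 ^ A * e * r * real N ^ A / (real (Suc j) / 4)\<^sup>2"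
        using n4 n0 c4 e r N1 by (intro divide_left_mono power_mono mult_nonneg_nonneg mult_pos_pos zero_less_power) auto
      also have "\<dots> = C * e * r * real N ^ A / (real (Suc j))\<^sup>2"
        by (simp add: C_def power_divide algebra_simps)
      also have "\<dots> \<le> C * e * (1 + r) * real N ^ A / (real (Suc j))\<^sup>2"
        using c4 cC e r N1 by (intro divide_right_mono mult_right_mono mult_left_mono) auto
      finally show ?thesis .
    qed
    then show "norm (fourier_of (arc_bump \<kappa> \<delta>) (of_int (enum_int j))) * (1 + \<bar>of_int (enum_int j) * real N\<bar>) ^ A
       \<le> C * exp (- (\<kappa> / (10 * \<delta>))) * (1 + (\<delta> / \<kappa>\<^sup>2) ^ (A + 2)) * real N ^ A / (real (Suc j))\<^sup>2"
      by (simp only: n_def e_def r_def m_def)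
  qed
qed

section \<open>Propagation of one-sided decay through products\<close>

definition window :: "real \<Rightarrow> complex" where "window = arc_bump 1 1"

lemma window_integrable: "integrable lborel window"
  unfolding window_def by (rule arc_bump_integrable) auto

lemma window_measurable [measurable]: "window \<in> borel_measurable borel"
  unfolding window_def by measurable

lemma window_eq_0: "\<bar>x\<bar> \<ge> 1 \<Longrightarrow> window x = 0"
  by (simp add: window_def arc_bump_def)

lemma window_neq_0: "\<bar>x\<bar> < 1 \<Longrightarrow> window x \<noteq> 0"
  by (simp add: window_def arc_bump_def arc_function_def)

text \<open>
  Quantifying over all functions \<open>G\<close> of the class is what makes the property stable under multiplication by such
  functions. The bound is mere boundedness for negative frequencies and expresses decay of order \<open>A\<close> for positive ones.
\<close>

definition controlled :: "nat \<Rightarrow> real \<Rightarrow> (real \<Rightarrow> complex) \<Rightarrow> bool" where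
  "controlled A B f \<longleftrightarrow> (\<forall>G\<in>disc_functions. \<forall>\<xi>.
     norm (\<integral>x. f x * G (character 1 x) * (window x * character \<xi> x) \<partial>lborel) \<le> B / (1 + max 0 \<xi>) ^ A)"

lemma controlledD:
  assumes "controlled A B f" "G \<in> disc_functions"
  shows "norm (\<integral>x. f x * G (character 1 x) * (window x * character \<xi> x) \<partial>lborel) \<le> B / (1 + max 0 \<xi>) ^ A"
  using assms by (auto simp: controlled_def)

lemma integrable_times_window:
  assumes [measurable]: "f \<in> borel_measurable borel" and "\<And>x. norm (f x) \<le> C"
  shows "integrable lborel (\<lambda>x. f x * window x)"
proof (rule Bochner_Integration.integrable_bound)
  show "integrable lborel (\<lambda>x. C *\<^sub>R window x)" using window_integrable by simp
  show "AE x in lborel. norm (f x * window x) \<le> norm (C *\<^sub>R window x)"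
    using assms(2) by (intro AE_I2) (auto simp: norm_mult intro!: mult_right_mono order_trans[OF _ abs_ge_self])
qed measurable

lemma inverse_squares_sums:
  obtains S :: real where "(\<lambda>k. 1 / (real (Suc k))\<^sup>2) sums S" "S \<ge> 1"
proof -
  have s: "summable (\<lambda>k. 1 / (real (Suc k))\<^sup>2)"
    using inverse_power_summable[of 2, where 'a = real]
    by (simp add: inverse_eq_divide summable_Suc_iff[of "\<lambda>k. 1 / (real k)\<^sup>2"] del: of_nat_Suc)
  show ?thesis
    using that[OF summable_sums[OF s]] sum_le_suminf[OF s, of "{0}"] by simp
qed

text \<open>
  For \<open>\<xi> \<ge> 0\<close> the pairing involves only the transform of the window at \<open>\<xi>, \<xi> + 1, \<xi> + 2, \<dots>\<close>, which is summable and
  small; for negative \<open>\<xi>\<close> the trivial bound suffices.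
\<close>

lemma controlled_one:
  obtains B where "B \<ge> 0" "controlled A B (\<lambda>_. 1)"
proof -
  define m where "m = A + 2"
  define c :: real where "c = 4 * (fact m * fact (2 * m) * 6400 ^ m)"
  have c0: "c \<ge> 4"
  proof -
    have "1 * 1 * 1 \<le> (fact m * fact (2 * m) * 6400 ^ m :: real)"
      by (intro mult_mono) (auto intro: fact_ge_1)
    then show ?thesis by (simp add: c_def)
  qed
  have exp1: "exp (- (1 / 10)) \<le> (1::real)" by simp
  have decay: "norm (fourier_of window \<xi>) \<le> c * 2 ^ m / (1 + \<xi>) ^ m" if "\<xi> \<ge> 0" for \<xi>
  proof (cases "\<xi> \<ge> 1")
    case True
    have "norm (fourier_of window \<xi>) \<le> c * exp (- (1 / 10)) / \<xi> ^ m"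
      using fourier_arc_bump_decay[of 1 1 \<xi> m] True by (simp add: window_def c_def mult_ac)
    also have "\<dots> \<le> c * 1 / ((1 + \<xi>) / 2) ^ m"
      using True c0 exp1 by (intro frac_le mult_mono power_mono) auto
    finally show ?thesis by (simp add: power_divide)
  next
    case False
    have "norm (fourier_of window \<xi>) \<le> 4 * exp (- (1 / 10))"
      using norm_fourier_arc_bump_le[of 1 1 \<xi>] by (simp add: window_def)
    also have "\<dots> \<le> c * 1" using c0 exp1 by linarith
    also have "\<dots> \<le> c * (2 / (1 + \<xi>)) ^ m"
      using False that c0 by (intro mult_left_mono one_le_power) auto
    finally show ?thesis by (simp add: power_divide)
  qed
  obtain S where S: "(\<lambda>k. 1 / (real (Suc k))\<^sup>2) sums S" "S \<ge> 1" by (rule inverse_squares_sums)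
  define B where "B = c * 2 ^ m * S + (\<integral>x. norm (window x) \<partial>lborel)"
  have pos: "(\<integral>x. norm (window x) \<partial>lborel) \<ge> 0" by simp
  have pos': "c * 2 ^ m * S \<ge> 0" using c0 S(2) by simp
  show ?thesis
  proof (rule that[of B])
    show "B \<ge> 0" using pos pos' by (simp add: B_def)
    show "controlled A B (\<lambda>_. 1)"
      unfolding controlled_def
    proof (intro ballI allI)
      fix G \<xi> assume G: "G \<in> disc_functions"
      let ?I = "\<integral>x. 1 * G (character 1 x) * (window x * character \<xi> x) \<partial>lborel"
      have int: "integrable lborel (\<lambda>x. window x * character \<xi> x)"
        using integrable_times_window[of "character \<xi>" 1] by (simp add: mult.commute)
      show "norm ?I \<le> B / (1 + max 0 \<xi>) ^ A"
      proof (cases "\<xi> \<ge> 0")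
        case True
        have "norm ?I \<le> c * 2 ^ m / (1 + \<xi>) ^ A * S"
          unfolding mult_1
        proof (rule disc_function_pairing_bound[OF G int])
          show "(\<lambda>k. c * 2 ^ m / (1 + \<xi>) ^ A * (1 / (real (Suc k))\<^sup>2)) sums (c * 2 ^ m / (1 + \<xi>) ^ A * S)"
            by (rule sums_mult[OF S(1)])
          fix k :: nat
          have "fourier_of (\<lambda>x. window x * character \<xi> x) (real k) = fourier_of window (\<xi> + real k)"
            by (simp add: fourier_of_def character_add mult_ac)
          also have "norm \<dots> \<le> c * 2 ^ m / (1 + (\<xi> + real k)) ^ m"
            using True by (intro decay) auto
          also have "\<dots> \<le> c * 2 ^ m / ((1 + \<xi>) ^ A * (real (Suc k))\<^sup>2)"
          proof (intro divide_left_mono)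
            show "(1 + \<xi>) ^ A * (real (Suc k))\<^sup>2 \<le> (1 + (\<xi> + real k)) ^ m"
              unfolding m_def power_add using True by (intro mult_mono power_mono) auto
          qed (use True c0 in auto)
          finally show "norm (fourier_of (\<lambda>x. window x * character \<xi> x) (real k)) \<le> c * 2 ^ m / (1 + \<xi>) ^ A * (1 / (real (Suc k))\<^sup>2)"
            by simp
        qed
        also have "\<dots> \<le> B / (1 + \<xi>) ^ A"
          using pos True by (simp add: B_def divide_right_mono)
        finally show ?thesis using True by simp
      next
        case False
        have "norm ?I \<le> (\<integral>x. norm (window x) \<partial>lborel)"
        proof (intro order_trans[OF integral_norm_bound] integral_mono)
          have bd: "norm (G (character 1 x)) \<le> 1" for x using G by (auto simp: disc_functions_def)
          note [measurable] = disc_functions_boundary_measurable[OF G]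
          show "integrable lborel (\<lambda>x. norm (1 * G (character 1 x) * (window x * character \<xi> x)))"
            using integrable_norm[OF integrable_times_window[of "\<lambda>x. G (character 1 x)" 1]] bd
            by (simp add: norm_mult)
          show "norm (1 * G (character 1 x) * (window x * character \<xi> x)) \<le> norm (window x)" for x
            using mult_right_mono[OF bd, of "norm (window x)" x] by (simp add: norm_mult)
        qed (use window_integrable in auto)
        also have "\<dots> \<le> B" using pos' by (simp add: B_def)
        finally show ?thesis using False by simp
      qed
    qed
  qed
qed

lemma controlled_mult_disc:
  assumes "controlled A B f" "F \<in> disc_functions"
  shows "controlled A B (\<lambda>x. f x * F (character 1 x))"
  unfolding controlled_def
proof (intro ballI allI)
  fix G \<xi> assume "G \<in> disc_functions"
  then have "(\<lambda>z. F z * G z) \<in> disc_functions" using assms(2) by (intro disc_functions_mult)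
  from controlledD[OF assms(1) this]
  show "norm (\<integral>x. f x * F (character 1 x) * G (character 1 x) * (window x * character \<xi> x) \<partial>lborel) \<le> B / (1 + max 0 \<xi>) ^ A"
    by (simp add: mult.assoc)
qed

text \<open>
  A factor \<open>e^(i \<tau> x)\<close> moves the frequency from \<open>\<xi>\<close> to \<open>\<xi> - \<tau>\<close>, and
  \<open>1 + max 0 \<xi> \<le> (1 + max 0 (\<xi> - \<tau>)) (1 + |\<tau>|)\<close>. The loss is therefore the weight \<open>(1 + |\<tau>|)^A\<close>.
\<close>

lemma controlled_mult_series:
  assumes ctl: "controlled A B f" and [measurable]: "f \<in> borel_measurable borel" and bd: "\<And>x. norm (f x) \<le> 1"
    and B: "B \<ge> 0"
    and s: "AE x in lborel. (\<lambda>j. c j * character (- \<tau> j) x) sums s x"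
    and \<sigma>: "(\<lambda>j. norm (c j) * (1 + \<bar>\<tau> j\<bar>) ^ A) sums \<sigma>"
    and [measurable]: "s \<in> borel_measurable borel"
  shows "controlled A (B * \<sigma>) (\<lambda>x. f x * s x)"
  unfolding controlled_def
proof (intro ballI allI)
  fix G \<xi> assume G: "G \<in> disc_functions"
  note [measurable] = disc_functions_boundary_measurable[OF G]
  have bdG: "norm (G (character 1 x)) \<le> 1" for x using G by (auto simp: disc_functions_def)
  let ?h = "\<lambda>\<xi> x. f x * G (character 1 x) * (window x * character \<xi> x)"
  have sm: "summable (\<lambda>j. norm (c j))"
  proof (rule summable_comparison_test')
    show "summable (\<lambda>j. norm (c j) * (1 + \<bar>\<tau> j\<bar>) ^ A)" using \<sigma> by (rule sums_summable)
    show "norm (norm (c j)) \<le> norm (c j) * (1 + \<bar>\<tau> j\<bar>) ^ A" for j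
      using mult_left_mono[of 1 "(1 + \<bar>\<tau> j\<bar>) ^ A" "norm (c j)"] one_le_power[of "1 + \<bar>\<tau> j\<bar>" A] by simp
  qed
  have h_le: "norm (?h \<eta> x) \<le> norm (window x)" for \<eta> x
  proof -
    have "norm (f x) * norm (G (character 1 x)) * norm (window x) \<le> 1 * 1 * norm (window x)"
      using bd bdG by (intro mult_mono) auto
    then show ?thesis by (simp add: norm_mult)
  qed
  have h_int: "integrable lborel (?h \<eta>)" for \<eta>
    by (rule Bochner_Integration.integrable_bound[OF window_integrable]) (use h_le in auto)
  have "(\<lambda>j. \<integral>x. c j * ?h (\<xi> - \<tau> j) x \<partial>lborel) sums (\<integral>x. (\<Sum>j. c j * ?h (\<xi> - \<tau> j) x) \<partial>lborel)"
  proof (rule sums_integral)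
    show "integrable lborel (\<lambda>x. c j * ?h (\<xi> - \<tau> j) x)" for j using h_int by simp
    show "AE x in lborel. summable (\<lambda>j. norm (c j * ?h (\<xi> - \<tau> j) x))"
    proof (intro AE_I2)
      fix x
      have "norm (norm (c j * ?h (\<xi> - \<tau> j) x)) \<le> norm (c j) * norm (window x)" for j
        unfolding norm_mult[of "c j"] using mult_left_mono[OF h_le, of "norm (c j)" x "\<xi> - \<tau> j"] by simp
      then show "summable (\<lambda>j. norm (c j * ?h (\<xi> - \<tau> j) x))"
        by (intro summable_comparison_test'[OF summable_mult2[OF sm, of "norm (window x)"]]) auto
    qed
    show "summable (\<lambda>j. \<integral>x. norm (c j * ?h (\<xi> - \<tau> j) x) \<partial>lborel)"
    proof (rule summable_comparison_test')
      show "summable (\<lambda>j. norm (c j) * (\<integral>x. norm (window x) \<partial>lborel))" using sm by (rule summable_mult2)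
      fix j
      have "(\<integral>x. norm (?h (\<xi> - \<tau> j) x) \<partial>lborel) \<le> (\<integral>x. norm (window x) \<partial>lborel)"
        using h_le h_int window_integrable by (intro integral_mono) auto
      then have "norm (c j) * (\<integral>x. norm (?h (\<xi> - \<tau> j) x) \<partial>lborel) \<le> norm (c j) * (\<integral>x. norm (window x) \<partial>lborel)"
        by (rule mult_left_mono) simp
      then show "norm (\<integral>x. norm (c j * ?h (\<xi> - \<tau> j) x) \<partial>lborel) \<le> norm (c j) * (\<integral>x. norm (window x) \<partial>lborel)"
        unfolding norm_mult[of "c j"] by simp
    qed
  qed
  also have "(\<integral>x. (\<Sum>j. c j * ?h (\<xi> - \<tau> j) x) \<partial>lborel)
      = (\<integral>x. f x * s x * G (character 1 x) * (window x * character \<xi> x) \<partial>lborel)"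
  proof (rule Bochner_Integration.integral_cong_AE)
    show "AE x in lborel. (\<Sum>j. c j * ?h (\<xi> - \<tau> j) x) = f x * s x * G (character 1 x) * (window x * character \<xi> x)"
      using s
    proof eventually_elim
      case (elim x)
      have "(\<lambda>j. c j * character (- \<tau> j) x * ?h \<xi> x) sums (s x * ?h \<xi> x)" by (rule sums_mult2[OF elim])
      moreover have "c j * character (- \<tau> j) x * ?h \<xi> x = c j * ?h (\<xi> - \<tau> j) x" for j
        using character_add[of \<xi> "- \<tau> j" x] by (simp add: mult_ac)
      ultimately have *: "(\<lambda>j. c j * ?h (\<xi> - \<tau> j) x) sums (s x * ?h \<xi> x)" by (simp only:)
      have "(\<Sum>j. c j * ?h (\<xi> - \<tau> j) x) = s x * ?h \<xi> x" using sums_unique[OF *] by (rule sym)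
      also have "\<dots> = f x * s x * G (character 1 x) * (window x * character \<xi> x)" by (simp add: mult_ac)
      finally show ?case .
    qed
  qed measurable
  finally have eq: "(\<lambda>j. c j * (\<integral>x. ?h (\<xi> - \<tau> j) x \<partial>lborel)) sums
      (\<integral>x. f x * s x * G (character 1 x) * (window x * character \<xi> x) \<partial>lborel)"
    by simp
  have term_le: "norm (c j * (\<integral>x. ?h (\<xi> - \<tau> j) x \<partial>lborel)) \<le> B / (1 + max 0 \<xi>) ^ A * (norm (c j) * (1 + \<bar>\<tau> j\<bar>) ^ A)" for j
  proof -
    have p: "1 + max 0 \<xi> \<le> (1 + max 0 (\<xi> - \<tau> j)) * (1 + \<bar>\<tau> j\<bar>)"
    proof -
      have "max 0 (\<xi> - \<tau> j) * \<bar>\<tau> j\<bar> \<ge> 0" by simp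
      moreover have "max 0 \<xi> \<le> max 0 (\<xi> - \<tau> j) + \<bar>\<tau> j\<bar>" by linarith
      moreover have "(1 + u) * (1 + v) = 1 + u + v + u * v" for u v :: real by (simp add: algebra_simps)
      note this[of "max 0 (\<xi> - \<tau> j)" "\<bar>\<tau> j\<bar>"]
      ultimately show ?thesis by linarith
    qed
    have "norm (\<integral>x. ?h (\<xi> - \<tau> j) x \<partial>lborel) \<le> B / (1 + max 0 (\<xi> - \<tau> j)) ^ A"
      by (rule controlledD[OF ctl G])
    also have "\<dots> = B * (1 + \<bar>\<tau> j\<bar>) ^ A / ((1 + max 0 (\<xi> - \<tau> j)) * (1 + \<bar>\<tau> j\<bar>)) ^ A"
    proof -
      have "(1 + \<bar>\<tau> j\<bar>) ^ A \<noteq> 0" by (metis abs_ge_zero add_pos_nonneg less_irrefl power_not_zero zero_less_one)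
      then show ?thesis by (simp add: power_mult_distrib)
    qed
    also have "\<dots> \<le> B * (1 + \<bar>\<tau> j\<bar>) ^ A / (1 + max 0 \<xi>) ^ A"
      using p B by (intro divide_left_mono power_mono) (auto intro!: mult_pos_pos zero_less_power mult_nonneg_nonneg)
    finally have "norm (c j) * norm (\<integral>x. ?h (\<xi> - \<tau> j) x \<partial>lborel) \<le> norm (c j) * (B * (1 + \<bar>\<tau> j\<bar>) ^ A / (1 + max 0 \<xi>) ^ A)"
      by (rule mult_left_mono) simp
    then show ?thesis by (simp add: norm_mult mult_ac)
  qed
  have sums': "(\<lambda>j. B / (1 + max 0 \<xi>) ^ A * (norm (c j) * (1 + \<bar>\<tau> j\<bar>) ^ A)) sums (B / (1 + max 0 \<xi>) ^ A * \<sigma>)"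
    by (rule sums_mult[OF \<sigma>])
  have "norm (\<Sum>j. c j * (\<integral>x. ?h (\<xi> - \<tau> j) x \<partial>lborel)) \<le> (\<Sum>j. B / (1 + max 0 \<xi>) ^ A * (norm (c j) * (1 + \<bar>\<tau> j\<bar>) ^ A))"
    by (intro norm_suminf_le term_le sums_summable[OF sums'])
  then show "norm (\<integral>x. f x * s x * G (character 1 x) * (window x * character \<xi> x) \<partial>lborel) \<le> B * \<sigma> / (1 + max 0 \<xi>) ^ A"
    using eq sums' by (simp add: sums_iff)
qed

lemma controlled_diff:
  assumes f: "controlled A B f" "f \<in> borel_measurable borel" "\<And>x. norm (f x) \<le> C"
    and g: "controlled A B' g" "g \<in> borel_measurable borel" "\<And>x. norm (g x) \<le> C'"
  shows "controlled A (B + B') (\<lambda>x. f x - g x)"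
  unfolding controlled_def
proof (intro ballI allI)
  fix G \<xi> assume G: "G \<in> disc_functions"
  note [measurable] = disc_functions_boundary_measurable[OF G] f(2) g(2)
  have bdG: "norm (G (character 1 x)) \<le> 1" for x using G by (auto simp: disc_functions_def)
  have int: "integrable lborel (\<lambda>x. u x * G (character 1 x) * (window x * character \<xi> x))"
    if [measurable]: "u \<in> borel_measurable borel" and u: "\<And>x. norm (u x) \<le> D" for u D
  proof -
    have "norm (u x * G (character 1 x) * character \<xi> x) \<le> D" for x
      using mult_mono[OF u bdG, of x x] order_trans[OF norm_ge_zero u[of x]] by (simp add: norm_mult)
    then have "integrable lborel (\<lambda>x. (u x * G (character 1 x) * character \<xi> x) * window x)"
      by (intro integrable_times_window) auto
    then show ?thesis by (simp add: mult_ac)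
  qed
  have "(\<integral>x. (f x - g x) * G (character 1 x) * (window x * character \<xi> x) \<partial>lborel)
      = (\<integral>x. f x * G (character 1 x) * (window x * character \<xi> x) \<partial>lborel)
        - (\<integral>x. g x * G (character 1 x) * (window x * character \<xi> x) \<partial>lborel)"
    using int[OF f(2,3)] int[OF g(2,3)] by (simp add: left_diff_distrib)
  also have "norm \<dots> \<le> B / (1 + max 0 \<xi>) ^ A + B' / (1 + max 0 \<xi>) ^ A"
    by (intro order_trans[OF norm_triangle_ineq4] add_mono controlledD[OF f(1) G] controlledD[OF g(1) G])
  finally show "norm (\<integral>x. (f x - g x) * G (character 1 x) * (window x * character \<xi> x) \<partial>lborel)
      \<le> (B + B') / (1 + max 0 \<xi>) ^ A"
    by (simp add: add_divide_distrib)
qed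

lemma arc_function_power_disc: "\<kappa> \<ge> 0 \<Longrightarrow> N > 0 \<Longrightarrow> (\<lambda>z. arc_function \<kappa> \<delta> (z ^ N)) \<in> disc_functions"
  by (rule disc_functions_power[OF arc_function_disc])

lemma character_times: "character 1 (real N * x) = character 1 x ^ N"
  unfolding character_power by (simp add: character_eq_cis)

lemma arc_measurable:
  assumes "\<kappa> \<ge> 0"
  shows "arc_piece \<kappa> \<delta> \<in> borel_measurable borel" "arc_cutoff \<kappa> \<delta> \<in> borel_measurable borel"
proof -
  note [measurable] = disc_functions_boundary_measurable[OF arc_function_disc[OF assms], of \<delta>]
  show "arc_piece \<kappa> \<delta> \<in> borel_measurable borel" "arc_cutoff \<kappa> \<delta> \<in> borel_measurable borel"
    unfolding arc_piece_def[abs_def] arc_cutoff_def[abs_def] by measurable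
qed

lemma norm_arc_le_1:
  assumes "\<kappa> \<ge> 0"
  shows "norm (arc_function \<kappa> \<delta> (character 1 y)) \<le> 1" "norm (arc_piece \<kappa> \<delta> y) \<le> 1" "norm (arc_cutoff \<kappa> \<delta> y) \<le> 1"
  using arc_function_disc[OF assms, of \<delta>]
  by (auto simp: disc_functions_def arc_piece_def arc_cutoff_def)

text \<open>
  The cut-off function is an analytic factor, which costs nothing, minus the arc piece, which costs its weighted
  \<open>\<ell>^1\<close> norm.
\<close>

lemma controlled_mult_arc_cutoff:
  "\<exists>C>0. \<forall>\<delta> \<kappa> N f B. 0 < \<delta> \<longrightarrow> \<delta> \<le> 1 \<longrightarrow> \<kappa> > 0 \<longrightarrow> N \<ge> 1 \<longrightarrow> controlled A B f \<longrightarrow> B \<ge> 0 \<longrightarrow>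
       f \<in> borel_measurable borel \<longrightarrow> (\<forall>x. norm (f x) \<le> 1) \<longrightarrow>
       controlled A (B * (1 + C * exp (- (\<kappa> / (10 * \<delta>))) * (1 + (\<delta> / \<kappa>\<^sup>2) ^ (A + 2)) * real N ^ A))
         (\<lambda>x. f x * arc_cutoff \<kappa> \<delta> (real N * x))"
proof -
  obtain C where C: "C > 0"
    "\<And>\<delta> \<kappa> N j. 0 < \<delta> \<Longrightarrow> \<delta> \<le> 1 \<Longrightarrow> \<kappa> > 0 \<Longrightarrow> N \<ge> 1 \<Longrightarrow>
       norm (fourier_of (arc_bump \<kappa> \<delta>) (of_int (enum_int j))) * (1 + \<bar>of_int (enum_int j) * real N\<bar>) ^ A
       \<le> C * exp (- (\<kappa> / (10 * \<delta>))) * (1 + (\<delta> / \<kappa>\<^sup>2) ^ (A + 2)) * real N ^ A / (real (Suc j))\<^sup>2"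
    by (rule arc_coefficient_bound[of A], rule that)
  obtain S where S: "(\<lambda>k. 1 / (real (Suc k))\<^sup>2) sums S" and S1: "S \<ge> 1" by (rule inverse_squares_sums)
  show ?thesis
  proof (intro exI[of _ "C * S"] conjI allI impI)
    show "C * S > 0" using C(1) S1 by simp
    fix \<delta> \<kappa> B :: real and N :: nat and f
    assume \<delta>: "0 < \<delta>" "\<delta> \<le> 1" and \<kappa>: "\<kappa> > 0" and N: "N \<ge> 1" and f: "controlled A B f" and B: "B \<ge> 0"
      and meas [measurable]: "f \<in> borel_measurable borel" and bd': "\<forall>x. norm (f x) \<le> 1"
    have bd: "norm (f x) \<le> 1" for x using bd' by blast
    define D where "D = C * exp (- (\<kappa> / (10 * \<delta>))) * (1 + (\<delta> / \<kappa>\<^sup>2) ^ (A + 2)) * real N ^ A"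
    have D0: "D \<ge> 0" using C(1) \<delta> by (simp add: D_def)
    define c where "c j = fourier_of (arc_bump \<kappa> \<delta>) (of_int (enum_int j)) / of_real (2 * pi)" for j
    define \<tau> where "\<tau> j = of_int (enum_int j) * real N" for j
    have one_le: "1 \<le> (1 + \<bar>\<tau> j\<bar>) ^ A" for j by (rule one_le_power) simp
    have bound: "norm (fourier_of (arc_bump \<kappa> \<delta>) (of_int (enum_int j))) * (1 + \<bar>\<tau> j\<bar>) ^ A \<le> D * (1 / (real (Suc j))\<^sup>2)" for j
      using C(2)[OF \<delta> \<kappa> N, of j] by (simp add: D_def \<tau>_def)
    have sumD: "(\<lambda>j. D * (1 / (real (Suc j))\<^sup>2)) sums (D * S)" by (rule sums_mult[OF S])
    have sm: "summable (\<lambda>j. norm (fourier_of (arc_bump \<kappa> \<delta>) (of_int (enum_int j))))"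
    proof (rule summable_comparison_test'[OF sums_summable[OF sumD]])
      show "norm (norm (fourier_of (arc_bump \<kappa> \<delta>) (of_int (enum_int j)))) \<le> D * (1 / (real (Suc j))\<^sup>2)" for j
        using bound[of j] mult_left_mono[OF one_le[of j], of "norm (fourier_of (arc_bump \<kappa> \<delta>) (of_int (enum_int j)))"] by simp
    qed
    have c_le: "norm (c j) * (1 + \<bar>\<tau> j\<bar>) ^ A \<le> D * (1 / (real (Suc j))\<^sup>2)" for j
    proof -
      have "norm (c j) \<le> norm (fourier_of (arc_bump \<kappa> \<delta>) (of_int (enum_int j))) / 1"
        unfolding c_def norm_divide using pi_gt3 by (intro divide_left_mono) auto
      then have "norm (c j) * (1 + \<bar>\<tau> j\<bar>) ^ A \<le> norm (fourier_of (arc_bump \<kappa> \<delta>) (of_int (enum_int j))) * (1 + \<bar>\<tau> j\<bar>) ^ A"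
        by (intro mult_right_mono) auto
      then show ?thesis using bound[of j] by linarith
    qed
    define \<sigma> where "\<sigma> = (\<Sum>j. norm (c j) * (1 + \<bar>\<tau> j\<bar>) ^ A)"
    have "summable (\<lambda>j. norm (c j) * (1 + \<bar>\<tau> j\<bar>) ^ A)"
      by (rule summable_comparison_test'[OF sums_summable[OF sumD]]) (use c_le in auto)
    then have \<sigma>: "(\<lambda>j. norm (c j) * (1 + \<bar>\<tau> j\<bar>) ^ A) sums \<sigma>" unfolding \<sigma>_def by (rule summable_sums)
    have \<sigma>_le: "\<sigma> \<le> D * S" by (rule sums_le[OF c_le \<sigma> sumD])
    note [measurable] = arc_measurable[OF less_imp_le[OF \<kappa>], of \<delta>]
    have ser: "controlled A (B * \<sigma>) (\<lambda>x. f x * arc_piece \<kappa> \<delta> (real N * x))"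
    proof (rule controlled_mult_series[OF f meas bd B _ \<sigma>])
      show "AE x in lborel. (\<lambda>j. c j * character (- \<tau> j) x) sums arc_piece \<kappa> \<delta> (real N * x)"
        unfolding c_def \<tau>_def using N by (intro AE_arc_piece_Fourier_series \<delta> \<kappa> sm) auto
    qed measurable
    have disc: "(\<lambda>z. arc_function \<kappa> \<delta> (z ^ N)) \<in> disc_functions"
      using N \<kappa> by (intro arc_function_power_disc) auto
    have anal: "controlled A B (\<lambda>x. f x * arc_function \<kappa> \<delta> (character 1 (real N * x)))"
      using controlled_mult_disc[OF f disc] by (simp add: character_times)
    have le1: "norm (f x * u) \<le> 1" if "norm u \<le> 1" for x u
      using mult_mono[OF bd[of x] that] by (simp add: norm_mult)
    have "controlled A (B + B * \<sigma>) (\<lambda>x. f x * arc_function \<kappa> \<delta> (character 1 (real N * x)) - f x * arc_piece \<kappa> \<delta> (real N * x))"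
    proof (rule controlled_diff[OF anal _ _ ser])
      show "(\<lambda>x. f x * arc_function \<kappa> \<delta> (character 1 (real N * x))) \<in> borel_measurable borel"
        using disc_functions_boundary_measurable[OF disc] by (simp add: character_times)
    qed (use norm_arc_le_1[OF less_imp_le[OF \<kappa>]] in \<open>auto intro!: le1\<close>)
    also have "(\<lambda>x. f x * arc_function \<kappa> \<delta> (character 1 (real N * x)) - f x * arc_piece \<kappa> \<delta> (real N * x))
        = (\<lambda>x. f x * arc_cutoff \<kappa> \<delta> (real N * x))"
      by (simp add: arc_cutoff_eq algebra_simps)
    finally have fin: "controlled A (B + B * \<sigma>) (\<lambda>x. f x * arc_cutoff \<kappa> \<delta> (real N * x))" .
    have "B + B * \<sigma> \<le> B * (1 + C * S * exp (- (\<kappa> / (10 * \<delta>))) * (1 + (\<delta> / \<kappa>\<^sup>2) ^ (A + 2)) * real N ^ A)"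
      using mult_left_mono[OF \<sigma>_le B] by (simp add: D_def algebra_simps)
    then show "controlled A (B * (1 + C * S * exp (- (\<kappa> / (10 * \<delta>))) * (1 + (\<delta> / \<kappa>\<^sup>2) ^ (A + 2)) * real N ^ A))
         (\<lambda>x. f x * arc_cutoff \<kappa> \<delta> (real N * x))"
      using fin unfolding controlled_def
      by (meson divide_right_mono max.cobounded1 add_nonneg_nonneg order_trans zero_le_one zero_le_power)
  qed
qed

section \<open>Scales and blocks of factors\<close>

text \<open>
  The scales are tuned so that the number of dilations times the weight is \<open>4^(-k)\<close> (summable), the weight over the width is \<open>2^k\<close>
  (growing faster than the logarithm of the dilations), and the number of dilations times the width is \<open>2^(-3 k)\<close>
  (decaying slower than every negative power of the number of dilations).
\<close>

definition num_dilations :: "nat \<Rightarrow> nat" where "num_dilations k = 2 ^ k\<^sup>2"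
definition arc_weight :: "nat \<Rightarrow> real" where "arc_weight k = 1 / 2 ^ (k\<^sup>2 + 2 * k)"
definition arc_width :: "nat \<Rightarrow> real" where "arc_width k = 1 / 2 ^ (k\<^sup>2 + 3 * k)"
definition dilation :: "nat \<Rightarrow> nat \<Rightarrow> nat" where "dilation k j = 2 ^ (12 * k\<^sup>2) + j"

lemma arc_weight_pos: "arc_weight k > 0" and arc_width_pos: "arc_width k > 0" and arc_width_le_1: "arc_width k \<le> 1"
  by (simp_all add: arc_weight_def arc_width_def divide_le_eq)

lemma dilation_ge_1: "dilation k j \<ge> 1"
  by (simp add: dilation_def Suc_leI trans_le_add1)

lemma dilation_le: "j \<in> {1..num_dilations k} \<Longrightarrow> real (dilation k j) \<le> 2 ^ (12 * k\<^sup>2 + 1)"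
proof -
  assume "j \<in> {1..num_dilations k}"
  then have "j \<le> 2 ^ k\<^sup>2" by (simp add: num_dilations_def)
  also have "(2::nat) ^ k\<^sup>2 \<le> 2 ^ (12 * k\<^sup>2)" by (intro power_increasing) auto
  finally have "dilation k j \<le> 2 ^ (12 * k\<^sup>2 + 1)" by (simp add: dilation_def)
  then have "real (dilation k j) \<le> real (2 ^ (12 * k\<^sup>2 + 1))" by (simp only: of_nat_le_iff)
  then show ?thesis by simp
qed

lemma num_dilations_arc_weight: "real (num_dilations k) * arc_weight k = (1 / 4) ^ k"
proof -
  have "(2::real) ^ (2 * k) = 4 ^ k" by (simp add: power_mult)
  then show ?thesis by (simp add: num_dilations_def arc_weight_def power_add power_divide)
qed

lemma arc_weight_over_width: "arc_weight k / arc_width k = 2 ^ k"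
proof -
  have "(2::real) ^ (k\<^sup>2 + 3 * k) = 2 ^ (k\<^sup>2 + 2 * k) * 2 ^ k" by (simp flip: power_add)
  then show ?thesis by (simp add: arc_weight_def arc_width_def)
qed

lemma arc_width_over_weight_squared: "arc_width k / (arc_weight k)\<^sup>2 = 2 ^ (k\<^sup>2 + k)"
proof -
  have *: "(1 / c) / (1 / a)\<^sup>2 = b" if "a * a = b * c" "c \<noteq> 0" "a \<noteq> 0" for a b c :: real
    using that by (simp add: power2_eq_square field_simps)
  show ?thesis
    unfolding arc_weight_def arc_width_def by (rule *) (simp_all flip: power_add)
qed

definition block :: "nat \<Rightarrow> real \<Rightarrow> complex" where
  "block k x = (\<Prod>j\<in>{1..num_dilations k}. arc_cutoff (arc_weight k) (arc_width k) (real (dilation k j) * x))"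

lemma block_measurable [measurable]: "block k \<in> borel_measurable borel"
proof -
  note [measurable] = arc_measurable(2)[OF less_imp_le[OF arc_weight_pos]]
  show ?thesis unfolding block_def[abs_def] by measurable
qed

lemma norm_block_le: "norm (block k x) \<le> 1"
  unfolding block_def prod_norm[symmetric]
  by (intro prod_le_1) (auto intro!: norm_arc_le_1 less_imp_le[OF arc_weight_pos])

lemma norm_arc_piece_le:
  assumes "0 < \<delta>" "\<delta> \<le> 1" "\<kappa> \<ge> 0"
  shows "norm (arc_piece \<kappa> \<delta> y) \<le> exp (- (\<kappa> / (5 * \<delta>)))"
proof -
  obtain k :: int and x where x_def: "x = y + 2 * pi * of_int k" and "-pi \<le> x" "x < pi"
    by (rule period_representative)
  then have "\<bar>x\<bar> \<le> pi" by (simp add: abs_le_iff)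
  have "arc_piece \<kappa> \<delta> y = arc_piece \<kappa> \<delta> x" unfolding x_def by (rule arc_piece_periodic[symmetric])
  also have "\<dots> = arc_bump \<kappa> \<delta> x" by (rule arc_piece_eq_bump[OF assms(1,2) \<open>\<bar>x\<bar> \<le> pi\<close>])
  finally show ?thesis using norm_arc_bump_le[OF assms] by simp
qed

text \<open>
  Since \<open>|G| \<le> 1\<close>, \<open>|G - 1|^2 \<le> 2 - 2 Re G\<close>, and the mean of the right-hand side is determined by \<open>G(0)\<close>. The parameter
  \<open>\<epsilon>\<close> passes from the square to the first power.
\<close>

lemma disc_function_L1_distance_to_1:
  assumes G: "G \<in> disc_functions" and \<epsilon>: "\<epsilon> > 0"
  shows "(\<integral>x. norm (G (character 1 x) - 1) \<partial>circle_measure) \<le> 2 * pi * \<epsilon> + 4 * pi * (1 - Re (G 0)) / \<epsilon>"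
proof -
  interpret finite_measure circle_measure by (rule finite_measure_circle)
  let ?g = "\<lambda>x. G (character 1 x)"
  have bd: "norm (?g x) \<le> 1" for x using G by (auto simp: disc_functions_def)
  note [measurable] = disc_functions_boundary_measurable[OF G]
  have one: "(\<integral>x. 1 \<partial>circle_measure) = (2 * pi :: real)"
    unfolding integral_circle by simp
  have int_g: "integrable circle_measure ?g"
    using bd by (intro integrable_circle_bounded[where B = 1]) auto
  have mean: "(\<integral>x. ?g x \<partial>circle_measure) = of_real (2 * pi) * G 0"
    unfolding integral_circle by (rule disc_function_mean_value[OF G])
  have "(\<integral>x. Re (?g x) \<partial>circle_measure) = Re (of_real (2 * pi) * G 0)"
    unfolding mean[symmetric] using int_g by (rule integral_Re)
  then have re: "(\<integral>x. Re (?g x) \<partial>circle_measure) = 2 * pi * Re (G 0)" by simp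
  have pt: "norm (?g x - 1) \<le> \<epsilon> + (2 - 2 * Re (?g x)) / \<epsilon>" for x
  proof -
    let ?a = "norm (?g x - 1)"
    have "?a\<^sup>2 = (norm (?g x))\<^sup>2 + 1 - 2 * Re (?g x)"
      unfolding cmod_power2 by (simp add: power2_eq_square algebra_simps)
    moreover have "(norm (?g x))\<^sup>2 \<le> 1" using bd by (simp add: power_le_one)
    ultimately have sq: "?a\<^sup>2 \<le> 2 - 2 * Re (?g x)" by simp
    have "?a * \<epsilon> \<le> \<epsilon>\<^sup>2 + ?a\<^sup>2"
    proof -
      have "0 \<le> ?a * \<epsilon>" using \<epsilon> by simp
      then show ?thesis using sum_squares_bound[of ?a \<epsilon>] by linarith
    qed
    then have "?a * \<epsilon> \<le> (\<epsilon> + (2 - 2 * Re (?g x)) / \<epsilon>) * \<epsilon>"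
      using sq \<epsilon> by (simp add: distrib_right power2_eq_square)
    then show ?thesis by (rule mult_right_le_imp_le[OF _ \<epsilon>])
  qed
  have "(\<integral>x. norm (?g x - 1) \<partial>circle_measure) \<le> (\<integral>x. \<epsilon> + (2 - 2 * Re (?g x)) / \<epsilon> \<partial>circle_measure)"
    using int_g pt by (intro integral_mono) auto
  also have "\<dots> = \<epsilon> * (2 * pi) + (2 * (2 * pi) - 2 * (2 * pi * Re (G 0))) / \<epsilon>"
    using int_g re one by simp
  also have "\<dots> = 2 * pi * \<epsilon> + 4 * pi * (1 - Re (G 0)) / \<epsilon>" by (simp add: algebra_simps)
  finally show ?thesis .
qed

definition block_error :: "nat \<Rightarrow> real" where
  "block_error k = 6 * pi * (1 / 2) ^ k + 2 * pi * real (num_dilations k) * exp (- (2 ^ k / 5))"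

text \<open>
  The product of the analytic factors has value \<open>exp (- 4^(-k))\<close> at 0, and taking \<open>\<epsilon> = 2^(-k)\<close> makes
  its distance to 1 of order \<open>2^(-k)\<close>. Estimating all factors of the block at once matters: estimates
  of this kind for the single factors would add up to something large. The cut-offs change each factor by a tiny amount.
\<close>

lemma block_L1_distance_to_1: "(\<integral>x. norm (block k x - 1) \<partial>circle_measure) \<le> block_error k"
proof -
  interpret finite_measure circle_measure by (rule finite_measure_circle)
  let ?J = "{1..num_dilations k}" and ?\<kappa> = "arc_weight k" and ?\<delta> = "arc_width k"
  have \<kappa>0: "?\<kappa> \<ge> 0" by (rule less_imp_le[OF arc_weight_pos])
  define G where "G z = (\<Prod>j\<in>?J. arc_function ?\<kappa> ?\<delta> (z ^ dilation k j))" for z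
  have G: "G \<in> disc_functions"
    unfolding G_def[abs_def] using dilation_ge_1[of k]
    by (intro disc_functions_prod arc_function_power_disc \<kappa>0) (auto simp: Suc_le_eq)
  note [measurable] = disc_functions_boundary_measurable[OF G]
  have bd: "norm (G (character 1 x)) \<le> 1" for x using G by (auto simp: disc_functions_def)
  have "G 0 = (\<Prod>j\<in>?J. of_real (exp (- ?\<kappa>)))"
    unfolding G_def
  proof (intro prod.cong refl)
    fix j
    have "dilation k j \<noteq> 0" using dilation_ge_1[of k j] by linarith
    then show "arc_function ?\<kappa> ?\<delta> (0 ^ dilation k j) = of_real (exp (- ?\<kappa>))"
      by (simp add: power_0_left arc_function_0)
  qed
  also have "\<dots> = of_real (exp (- (real (num_dilations k) * ?\<kappa>)))"
    by (simp flip: exp_of_nat_mult of_real_power)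
  finally have "Re (G 0) = exp (- ((1 / 4) ^ k))" by (simp add: num_dilations_arc_weight)
  then have G0: "1 - Re (G 0) \<le> (1 / 4) ^ k" using exp_ge_add_one_self[of "- ((1 / 4) ^ k)"] by simp
  have diff: "norm (block k x - G (character 1 x)) \<le> real (num_dilations k) * exp (- (2 ^ k / 5))" for x
  proof -
    have "norm (block k x - G (character 1 x))
        \<le> (\<Sum>j\<in>?J. norm (arc_cutoff ?\<kappa> ?\<delta> (real (dilation k j) * x) - arc_function ?\<kappa> ?\<delta> (character 1 (real (dilation k j) * x))))"
      unfolding block_def G_def character_times[symmetric]
      by (intro norm_prod_diff norm_arc_le_1 \<kappa>0)
    also have "\<dots> \<le> (\<Sum>j\<in>?J. exp (- (2 ^ k / 5)))"
    proof (rule sum_mono)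
      fix j
      have e: "?\<kappa> / (5 * ?\<delta>) = 2 ^ k / 5" unfolding arc_weight_over_width[symmetric] by simp
      show "norm (arc_cutoff ?\<kappa> ?\<delta> (real (dilation k j) * x) - arc_function ?\<kappa> ?\<delta> (character 1 (real (dilation k j) * x)))
          \<le> exp (- (2 ^ k / 5))"
        using norm_arc_piece_le[OF arc_width_pos[of k] arc_width_le_1[of k] \<kappa>0, of "real (dilation k j) * x", unfolded e]
        by (simp add: arc_cutoff_eq)
    qed
    finally show ?thesis by simp
  qed
  have int: "integrable circle_measure (\<lambda>x. norm (u x - 1))"
    if "u \<in> borel_measurable borel" "\<And>x. norm (u x) \<le> 1" for u :: "real \<Rightarrow> complex"
  proof (rule integrable_circle_bounded)
    show "(\<lambda>x. norm (u x - 1)) \<in> borel_measurable borel" using that(1) by measurable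
    show "norm (norm (u x - 1)) \<le> 2" for x
      using norm_triangle_ineq4[of "u x" 1] that(2)[of x] by simp
  qed
  have intG: "integrable circle_measure (\<lambda>x. norm (G (character 1 x) - 1))"
    by (rule int[OF disc_functions_boundary_measurable[OF G] bd])
  have "(\<integral>x. norm (block k x - 1) \<partial>circle_measure)
      \<le> (\<integral>x. real (num_dilations k) * exp (- (2 ^ k / 5)) + norm (G (character 1 x) - 1) \<partial>circle_measure)"
  proof (rule integral_mono)
    show "integrable circle_measure (\<lambda>x. norm (block k x - 1))"
      by (rule int[OF block_measurable norm_block_le])
    show "integrable circle_measure (\<lambda>x. real (num_dilations k) * exp (- (2 ^ k / 5)) + norm (G (character 1 x) - 1))"
      using intG by simp
    show "norm (block k x - 1) \<le> real (num_dilations k) * exp (- (2 ^ k / 5)) + norm (G (character 1 x) - 1)" for x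
      using norm_triangle_ineq[of "block k x - G (character 1 x)" "G (character 1 x) - 1"] diff[of x] by simp
  qed
  also have "\<dots> = 2 * pi * real (num_dilations k) * exp (- (2 ^ k / 5)) + (\<integral>x. norm (G (character 1 x) - 1) \<partial>circle_measure)"
    using intG by (simp add: measure_circle)
  also have "(\<integral>x. norm (G (character 1 x) - 1) \<partial>circle_measure) \<le> 2 * pi * (1 / 2) ^ k + 4 * pi * (1 - Re (G 0)) / (1 / 2) ^ k"
    by (rule disc_function_L1_distance_to_1[OF G]) simp
  also have "4 * pi * (1 - Re (G 0)) / (1 / 2) ^ k \<le> 4 * pi * (1 / 4) ^ k / (1 / 2) ^ k"
    using G0 by (intro divide_right_mono mult_left_mono) auto
  also have "4 * pi * (1 / 4) ^ k / (1 / 2) ^ k = 4 * pi * (1 / 2) ^ k"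
  proof -
    have "(4::real) ^ k = 2 ^ k * 2 ^ k" by (simp flip: power_mult_distrib)
    then show ?thesis by (simp add: power_divide)
  qed
  finally show ?thesis by (simp add: block_error_def algebra_simps)
qed

lemma summable_block_error: "summable block_error"
proof -
  have "summable (\<lambda>k. 2 ^ k\<^sup>2 * exp (- (2 ^ k / 5)) :: real)"
  proof (rule summable_comparison_test_ev)
    have "(\<lambda>k::nat. 2 powr (real k ^ 2) * exp (- (2 powr real k / 5)) * 2 powr real k :: real) \<longlonglongrightarrow> 0"
      by real_asymp
    then have "\<forall>\<^sub>F k in sequentially. 2 powr (real k ^ 2) * exp (- (2 powr real k / 5)) * 2 powr real k < (1::real)"
      by (rule order_tendstoD) simp
    then show "\<forall>\<^sub>F k in sequentially. norm (2 ^ k\<^sup>2 * exp (- (2 ^ k / 5)) :: real) \<le> (1 / 2) ^ k"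
    proof eventually_elim
      case (elim k)
      have "2 powr (real k ^ 2) = (2::real) ^ k\<^sup>2" using powr_realpow[of 2 "k\<^sup>2"] by simp
      moreover have "2 powr real k = (2::real) ^ k" by (simp add: powr_realpow)
      ultimately show ?case using elim by (simp add: power_divide field_simps)
    qed
    show "summable (\<lambda>k. (1 / 2) ^ k :: real)" by (intro summable_geometric) auto
  qed
  then have "summable (\<lambda>k. 2 * pi * (2 ^ k\<^sup>2 * exp (- (2 ^ k / 5))))" by (rule summable_mult)
  moreover have "summable (\<lambda>k. 6 * pi * (1 / 2) ^ k)" by (intro summable_mult summable_geometric) auto
  ultimately have "summable (\<lambda>k. 6 * pi * (1 / 2) ^ k + 2 * pi * (2 ^ k\<^sup>2 * exp (- (2 ^ k / 5))))"
    by (intro summable_add)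
  then show ?thesis by (simp add: block_error_def[abs_def] num_dilations_def mult_ac)
qed

lemma block_error_nonneg: "block_error k \<ge> 0"
  by (simp add: block_error_def)

definition partial_product :: "nat \<Rightarrow> nat \<Rightarrow> real \<Rightarrow> complex" where
  "partial_product k0 K x = (\<Prod>k<K. block (k0 + k) x)"

lemma partial_product_measurable [measurable]: "partial_product k0 K \<in> borel_measurable borel"
  unfolding partial_product_def[abs_def] by measurable

lemma norm_partial_product_le: "norm (partial_product k0 K x) \<le> 1"
  unfolding partial_product_def by (simp add: prod_norm[symmetric] prod_le_1 norm_block_le)

lemma controlled_mono: "controlled A B f \<Longrightarrow> B \<le> B' \<Longrightarrow> controlled A B' f"
  unfolding controlled_def
  by (meson divide_right_mono max.cobounded1 add_nonneg_nonneg order_trans zero_le_one zero_le_power)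

text \<open>
  The costs of all factors of all blocks have a finite sum, because \<open>exp (- 2^k / 10)\<close> defeats every factor of the form
  \<open>2^(a (k + 1)^2)\<close>.
\<close>

lemma controlled_mult_block:
  "\<exists>s. (\<forall>k. s k \<ge> 0) \<and> summable s \<and>
    (\<forall>k f B. controlled A B f \<longrightarrow> B \<ge> 0 \<longrightarrow> f \<in> borel_measurable borel \<longrightarrow> (\<forall>x. norm (f x) \<le> 1) \<longrightarrow>
       controlled A (B * exp (s k)) (\<lambda>x. f x * block k x))"
proof -
  obtain C where C: "C > 0"
    "\<And>\<delta> \<kappa> N f B. 0 < \<delta> \<Longrightarrow> \<delta> \<le> 1 \<Longrightarrow> \<kappa> > 0 \<Longrightarrow> N \<ge> 1 \<Longrightarrow> controlled A B f \<Longrightarrow> B \<ge> 0 \<Longrightarrow>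
       f \<in> borel_measurable borel \<Longrightarrow> (\<And>x. norm (f x) \<le> 1) \<Longrightarrow>
       controlled A (B * (1 + C * exp (- (\<kappa> / (10 * \<delta>))) * (1 + (\<delta> / \<kappa>\<^sup>2) ^ (A + 2)) * real N ^ A))
         (\<lambda>x. f x * arc_cutoff \<kappa> \<delta> (real N * x))"
    using controlled_mult_arc_cutoff[of A] by blast
  define \<sigma> where "\<sigma> k = C * exp (- (2 ^ k / 10)) * (1 + (2 ^ (k\<^sup>2 + k)) ^ (A + 2)) * (2 ^ (12 * k\<^sup>2 + 1)) ^ A" for k :: nat
  have \<sigma>0: "\<sigma> k \<ge> 0" for k using C(1) by (simp add: \<sigma>_def)
  have one: "controlled A (B * exp (\<sigma> k)) (\<lambda>x. f x * arc_cutoff (arc_weight k) (arc_width k) (real (dilation k j) * x))"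
    if "controlled A B f" "B \<ge> 0" "f \<in> borel_measurable borel" "\<And>x. norm (f x) \<le> 1" "j \<in> {1..num_dilations k}" for k j B f
  proof (rule controlled_mono[OF C(2)[OF arc_width_pos arc_width_le_1 arc_weight_pos dilation_ge_1 that(1-4)]])
    have e: "arc_weight k / (10 * arc_width k) = 2 ^ k / 10"
      unfolding arc_weight_over_width[symmetric] by simp
    have "C * exp (- (2 ^ k / 10)) * (1 + (2 ^ (k\<^sup>2 + k)) ^ (A + 2)) * real (dilation k j) ^ A \<le> \<sigma> k"
      unfolding \<sigma>_def using C(1) dilation_le[OF that(5)]
      by (intro mult_left_mono power_mono) auto
    then have "1 + C * exp (- (2 ^ k / 10)) * (1 + (2 ^ (k\<^sup>2 + k)) ^ (A + 2)) * real (dilation k j) ^ A \<le> exp (\<sigma> k)"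
      using exp_ge_add_one_self[of "\<sigma> k"] by linarith
    then show "B * (1 + C * exp (- (arc_weight k / (10 * arc_width k))) * (1 + (arc_width k / (arc_weight k)\<^sup>2) ^ (A + 2)) * real (dilation k j) ^ A)
        \<le> B * exp (\<sigma> k)"
      unfolding e arc_width_over_weight_squared using that(2) by (intro mult_left_mono)
  qed
  have many: "controlled A (B * exp (real n * \<sigma> k)) (\<lambda>x. f x * (\<Prod>j\<in>{1..n}. arc_cutoff (arc_weight k) (arc_width k) (real (dilation k j) * x)))"
    if f: "controlled A B f" "B \<ge> 0" "f \<in> borel_measurable borel" "\<And>x. norm (f x) \<le> 1" and "n \<le> num_dilations k" for k n B f
    using that(5)
  proof (induction n)
    case 0
    then show ?case using f by simp
  next
    case (Suc n)
    let ?\<psi> = "\<lambda>j x. arc_cutoff (arc_weight k) (arc_width k) (real (dilation k j) * x)"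
    note [measurable] = arc_measurable(2)[OF less_imp_le[OF arc_weight_pos]] f(3)
    have IH: "controlled A (B * exp (real n * \<sigma> k)) (\<lambda>x. f x * (\<Prod>j\<in>{1..n}. ?\<psi> j x))"
      using Suc by simp
    have "controlled A (B * exp (real n * \<sigma> k) * exp (\<sigma> k)) (\<lambda>x. f x * (\<Prod>j\<in>{1..n}. ?\<psi> j x) * ?\<psi> (Suc n) x)"
    proof (rule one[OF IH])
      show "norm (f x * (\<Prod>j\<in>{1..n}. ?\<psi> j x)) \<le> 1" for x
      proof -
        have "norm (\<Prod>j\<in>{1..n}. ?\<psi> j x) \<le> 1"
          unfolding prod_norm[symmetric]
          by (intro prod_le_1) (auto intro!: norm_arc_le_1 less_imp_le[OF arc_weight_pos])
        then show ?thesis using mult_mono[OF f(4)[of x]] by (force simp: norm_mult)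
      qed
    qed (use Suc f(2) in auto)
    moreover have "{1..Suc n} = insert (Suc n) {1..n}" by auto
    ultimately show ?case by (simp add: algebra_simps flip: exp_add)
  qed
  show ?thesis
  proof (intro exI[of _ "\<lambda>k. real (num_dilations k) * \<sigma> k"] conjI)
    show "\<forall>k. real (num_dilations k) * \<sigma> k \<ge> 0" using \<sigma>0 by simp
    show "\<forall>k f B. controlled A B f \<longrightarrow> B \<ge> 0 \<longrightarrow> f \<in> borel_measurable borel \<longrightarrow> (\<forall>x. norm (f x) \<le> 1) \<longrightarrow>
       controlled A (B * exp (real (num_dilations k) * \<sigma> k)) (\<lambda>x. f x * block k x)"
      using many[OF _ _ _ _ order_refl] by (simp add: block_def)
    define a where "a = real (14 * A + 6)"
    have bound: "real (num_dilations k) * \<sigma> k \<le> C * (2 powr (a * (real k + 1) ^ 2) * exp (- (2 powr real k / 10)))" for k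
    proof -
      have "(1 + (2 ^ (k\<^sup>2 + k)) ^ (A + 2)) \<le> (2::real) ^ ((k\<^sup>2 + k) * (A + 2) + 1)"
      proof -
        have "1 \<le> (2::real) ^ ((k\<^sup>2 + k) * (A + 2))" by (rule one_le_power) simp
        then show ?thesis unfolding power_mult[symmetric] power_add[of _ _ 1] power_one_right by linarith
      qed
      then have "real (num_dilations k) * \<sigma> k
          \<le> 2 ^ k\<^sup>2 * (C * exp (- (2 ^ k / 10)) * 2 ^ ((k\<^sup>2 + k) * (A + 2) + 1) * 2 ^ ((12 * k\<^sup>2 + 1) * A))"
        unfolding \<sigma>_def num_dilations_def using C(1)
        by (simp only: of_nat_power of_nat_numeral power_mult[of 2 "12 * k\<^sup>2 + 1" A]) (intro mult_left_mono mult_right_mono, auto)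
      also have "\<dots> = C * exp (- (2 ^ k / 10)) * 2 ^ (k\<^sup>2 + ((k\<^sup>2 + k) * (A + 2) + 1) + (12 * k\<^sup>2 + 1) * A)"
        by (simp only: power_add) (simp add: mult_ac)
      also have "\<dots> \<le> C * exp (- (2 ^ k / 10)) * 2 ^ ((14 * A + 6) * (k + 1)\<^sup>2)"
      proof (intro mult_left_mono power_increasing)
        have "k\<^sup>2 \<le> (k + 1)\<^sup>2" "k \<le> (k + 1)\<^sup>2" "1 \<le> (k + 1)\<^sup>2" "k\<^sup>2 + k \<le> (k + 1)\<^sup>2" by (auto simp: power2_eq_square)
        moreover from this have "12 * k\<^sup>2 + 1 \<le> 13 * (k + 1)\<^sup>2" by linarith
        ultimately have "(k\<^sup>2 + k) * (A + 2) \<le> (k + 1)\<^sup>2 * (A + 2)" "(12 * k\<^sup>2 + 1) * A \<le> (13 * (k + 1)\<^sup>2) * A"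
          by (intro mult_right_mono; (assumption | simp only: zero_le))+
        moreover have "k\<^sup>2 + 1 \<le> 2 * (k + 1)\<^sup>2" by (auto simp: power2_eq_square)
        ultimately have "k\<^sup>2 + ((k\<^sup>2 + k) * (A + 2) + 1) + (12 * k\<^sup>2 + 1) * A \<le> 2 * (k + 1)\<^sup>2 + (k + 1)\<^sup>2 * (A + 2) + (13 * (k + 1)\<^sup>2) * A"
          by linarith
        also have "\<dots> \<le> (14 * A + 6) * (k + 1)\<^sup>2" by (simp add: algebra_simps)
        finally show "k\<^sup>2 + ((k\<^sup>2 + k) * (A + 2) + 1) + (12 * k\<^sup>2 + 1) * A \<le> (14 * A + 6) * (k + 1)\<^sup>2" .
      qed (use C(1) in auto)
      also have "(2::real) ^ ((14 * A + 6) * (k + 1)\<^sup>2) = 2 powr (a * (real k + 1) ^ 2)"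
      proof -
        have "a * (real k + 1) ^ 2 = real ((14 * A + 6) * (k + 1)\<^sup>2)" by (simp add: a_def)
        then show ?thesis by (simp only: powr_realpow[OF zero_less_numeral])
      qed
      also have "(2::real) ^ k = 2 powr real k" by (simp add: powr_realpow)
      finally show ?thesis by (simp add: mult_ac)
    qed
    show "summable (\<lambda>k. real (num_dilations k) * \<sigma> k)"
    proof (rule summable_comparison_test_ev)
      have "(\<lambda>k::nat. 2 powr (a * (real k + 1) ^ 2) * exp (- (2 powr real k / 10)) * 2 powr real k) \<longlonglongrightarrow> 0"
      proof -
        have "a > 0" by (simp add: a_def)
        then show ?thesis by real_asymp
      qed
      then have "\<forall>\<^sub>F k in sequentially. 2 powr (a * (real k + 1) ^ 2) * exp (- (2 powr real k / 10)) * 2 powr real k < (1::real)"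
        by (rule order_tendstoD) simp
      then show "\<forall>\<^sub>F k in sequentially. norm (real (num_dilations k) * \<sigma> k) \<le> C * (1 / 2) ^ k"
      proof eventually_elim
        case (elim k)
        have "2 powr real k = (2::real) ^ k" by (simp add: powr_realpow)
        with elim have "2 powr (a * (real k + 1) ^ 2) * exp (- (2 powr real k / 10)) \<le> (1 / 2) ^ k"
          by (simp add: power_divide field_simps)
        then have "C * (2 powr (a * (real k + 1) ^ 2) * exp (- (2 powr real k / 10))) \<le> C * (1 / 2) ^ k"
          using C(1) by (intro mult_left_mono) auto
        then show ?case using bound[of k] \<sigma>0[of k] by simp
      qed
      show "summable (\<lambda>k. C * (1 / 2) ^ k)" by (intro summable_mult summable_geometric) auto
    qed
  qed
qed

lemma controlled_partial_product:
  obtains B where "\<And>k0 K. controlled A B (partial_product k0 K)"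
proof -
  obtain B where B: "B \<ge> 0" "controlled A B (\<lambda>_. 1)" by (rule controlled_one)
  obtain s where s: "\<And>k. s k \<ge> 0" "summable s"
    "\<And>k f B. controlled A B f \<Longrightarrow> B \<ge> 0 \<Longrightarrow> f \<in> borel_measurable borel \<Longrightarrow> (\<And>x. norm (f x) \<le> 1) \<Longrightarrow>
       controlled A (B * exp (s k)) (\<lambda>x. f x * block k x)"
    using controlled_mult_block[of A] by blast
  have "controlled A (B * exp (\<Sum>k<K. s (k0 + k))) (partial_product k0 K)" for k0 K
  proof (induction K)
    case 0
    then show ?case using B(2) by (simp add: partial_product_def[abs_def])
  next
    case (Suc K)
    have "controlled A (B * exp (\<Sum>k<K. s (k0 + k)) * exp (s (k0 + K))) (\<lambda>x. partial_product k0 K x * block (k0 + K) x)"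
      using B(1) by (intro s(3)[OF Suc] norm_partial_product_le) auto
    then show ?case by (simp add: partial_product_def[abs_def] exp_add mult.assoc)
  qed
  moreover have "B * exp (\<Sum>k<K. s (k0 + k)) \<le> B * exp (\<Sum>k. s k)" for k0 K
  proof -
    have "(\<Sum>k<K. s (k0 + k)) = (\<Sum>k\<in>(+) k0 ` {..<K}. s k)" by (subst sum.reindex) auto
    also have "\<dots> \<le> (\<Sum>k. s k)" using s by (intro sum_le_suminf) auto
    finally show ?thesis using B(1) by (intro mult_left_mono) auto
  qed
  ultimately show ?thesis using that controlled_mono by blast
qed

section \<open>The infinite product\<close>

text \<open>
  Off the set where the distances of the blocks to 1 are summable the value is set to 0, so that the bound by 1 and
  the vanishing outside the sieved set hold at every point.
\<close>

definition block_product :: "nat \<Rightarrow> real \<Rightarrow> complex" where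
  "block_product k0 x = (if (\<Sum>k. ennreal (norm (block (k0 + k) x - 1))) < \<infinity>
     then lim (\<lambda>K. partial_product k0 K x) else 0)"

lemma block_product_measurable [measurable]: "block_product k0 \<in> borel_measurable borel"
  unfolding block_product_def[abs_def] by measurable

lemma partial_product_Suc: "partial_product k0 (Suc K) x = partial_product k0 K x * block (k0 + K) x"
  by (simp add: partial_product_def)

lemma block_product_limit:
  assumes "(\<Sum>k. ennreal (norm (block (k0 + k) x - 1))) < \<infinity>"
  shows "(\<lambda>K. partial_product k0 K x) \<longlonglongrightarrow> block_product k0 x"
    "ennreal (norm (block_product k0 x - 1)) \<le> (\<Sum>k. ennreal (norm (block (k0 + k) x - 1)))"
proof -
  let ?P = "\<lambda>K. partial_product k0 K x" and ?b = "\<lambda>k. norm (block (k0 + k) x - 1)"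
  have sm: "summable ?b" using assms by (intro summable_suminf_not_top) auto
  have step: "norm (?P (Suc K) - ?P K) \<le> ?b K" for K
  proof -
    have "?P (Suc K) - ?P K = ?P K * (block (k0 + K) x - 1)"
      by (simp add: partial_product_Suc algebra_simps)
    then show ?thesis
      using mult_right_mono[OF norm_partial_product_le[of k0 K x], of "?b K"] by (simp add: norm_mult)
  qed
  have "summable (\<lambda>K. norm (?P (Suc K) - ?P K))"
    by (rule summable_comparison_test'[OF sm]) (use step in auto)
  then have "summable (\<lambda>K. ?P (Suc K) - ?P K)" by (rule summable_norm_cancel)
  from summable_LIMSEQ[OF this] have "(\<lambda>K. ?P K - ?P 0) \<longlonglongrightarrow> (\<Sum>K. ?P (Suc K) - ?P K)"
    by (simp only: sum_lessThan_telescope[of ?P])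
  from tendsto_add[OF this tendsto_const[of "?P 0"]] have "convergent ?P"
    by (auto simp: convergent_def)
  then show lim: "?P \<longlonglongrightarrow> block_product k0 x"
    using assms by (simp add: block_product_def convergent_LIMSEQ_iff)
  have fin: "norm (?P K - 1) \<le> (\<Sum>k<K. ?b k)" for K
  proof (induction K)
    case 0
    show ?case by (simp add: partial_product_def)
  next
    case (Suc K)
    show ?case using norm_triangle_ineq[of "?P (Suc K) - ?P K" "?P K - 1"] step[of K] Suc by simp
  qed
  have le: "norm (?P K - 1) \<le> suminf ?b" for K
    by (rule order_trans[OF fin sum_le_suminf[OF sm]]) auto
  have "norm (block_product k0 x - 1) \<le> suminf ?b"
    by (rule LIMSEQ_le_const2[OF tendsto_norm[OF tendsto_diff[OF lim tendsto_const]]]) (use le in auto)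
  then show "ennreal (norm (block_product k0 x - 1)) \<le> (\<Sum>k. ennreal (?b k))"
    using sm by (simp add: suminf_ennreal2 ennreal_leI)
qed

lemma norm_block_product_le: "norm (block_product k0 x) \<le> 1"
proof (cases "(\<Sum>k. ennreal (norm (block (k0 + k) x - 1))) < \<infinity>")
  case True
  show ?thesis
    by (rule LIMSEQ_le_const2[OF tendsto_norm[OF block_product_limit(1)[OF True]]])
       (use norm_partial_product_le in auto)
qed (simp add: block_product_def)

lemma block_product_eq_0:
  assumes "j \<in> {1..num_dilations k}" "cos (real (dilation k j) * x) > cos (arc_width k)" "k \<ge> k0"
  shows "block_product k0 x = 0"
proof (cases "(\<Sum>k. ennreal (norm (block (k0 + k) x - 1))) < \<infinity>")
  case True
  have "arc_cutoff (arc_weight k) (arc_width k) (real (dilation k j) * x) = 0"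
    using assms(2) by (simp add: arc_cutoff_def)
  then have "block k x = 0" unfolding block_def using assms(1) by (intro prod_zero) auto
  then have "partial_product k0 K x = 0" if "K > k - k0" for K
    unfolding partial_product_def using that assms(3) by (intro prod_zero) (auto intro!: bexI[of _ "k - k0"])
  then have "\<forall>\<^sub>F K in sequentially. partial_product k0 K x = 0"
    by (auto simp: eventually_at_top_dense)
  then have "(\<lambda>K. partial_product k0 K x) \<longlonglongrightarrow> 0" by (rule tendsto_eventually)
  then show ?thesis using block_product_limit(1)[OF True] LIMSEQ_unique by blast
qed (simp add: block_product_def)

lemma nn_integral_block_distance:
  "(\<integral>\<^sup>+x. (\<Sum>k. ennreal (norm (block (k0 + k) x - 1))) \<partial>circle_measure) \<le> ennreal (\<Sum>k. block_error (k0 + k))"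
proof -
  have sm: "summable (\<lambda>k. block_error (k0 + k))"
    using summable_block_error by (simp add: add.commute[of k0] summable_iff_shift)
  have "(\<integral>\<^sup>+x. (\<Sum>k. ennreal (norm (block (k0 + k) x - 1))) \<partial>circle_measure)
      = (\<Sum>k. \<integral>\<^sup>+x. ennreal (norm (block (k0 + k) x - 1)) \<partial>circle_measure)"
    by (rule nn_integral_suminf) measurable
  also have "\<dots> \<le> (\<Sum>k. ennreal (block_error (k0 + k)))"
  proof (rule suminf_le)
    fix k
    have "integrable circle_measure (\<lambda>x. norm (block (k0 + k) x - 1))"
    proof (rule integrable_circle_bounded)
      show "norm (norm (block (k0 + k) x - 1)) \<le> 2" for x
        using norm_triangle_ineq4[of "block (k0 + k) x" 1] norm_block_le[of "k0 + k" x] by simp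
    qed measurable
    then have "(\<integral>\<^sup>+x. ennreal (norm (block (k0 + k) x - 1)) \<partial>circle_measure)
        = ennreal (\<integral>x. norm (block (k0 + k) x - 1) \<partial>circle_measure)"
      by (intro nn_integral_eq_integral) auto
    also have "\<dots> \<le> ennreal (block_error (k0 + k))"
      by (intro ennreal_leI block_L1_distance_to_1)
    finally show "(\<integral>\<^sup>+x. ennreal (norm (block (k0 + k) x - 1)) \<partial>circle_measure) \<le> ennreal (block_error (k0 + k))" .
  qed auto
  also have "\<dots> = ennreal (\<Sum>k. block_error (k0 + k))"
    by (rule suminf_ennreal2[OF block_error_nonneg sm])
  finally show ?thesis .
qed

lemma AE_block_product_limit:
  "AE x in circle_measure. (\<Sum>k. ennreal (norm (block (k0 + k) x - 1))) < \<infinity>"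
proof -
  have "(\<integral>\<^sup>+x. (\<Sum>k. ennreal (norm (block (k0 + k) x - 1))) \<partial>circle_measure) \<noteq> \<infinity>"
    using nn_integral_block_distance[of k0] by (auto simp: top_unique)
  then have "AE x in circle_measure. (\<Sum>k. ennreal (norm (block (k0 + k) x - 1))) \<noteq> \<infinity>"
    by (intro nn_integral_PInf_AE) measurable
  then show ?thesis by eventually_elim (simp add: top.not_eq_extremum)
qed

definition product_density :: "nat \<Rightarrow> real \<Rightarrow> complex" where
  "product_density k0 x = block_product k0 x * window x"

lemma product_density_integrable: "integrable lborel (product_density k0)"
  unfolding product_density_def[abs_def]
  by (rule integrable_times_window[OF block_product_measurable norm_block_product_le])

text \<open>
  The bounds for the partial products do not depend on the number of factors, so they survive the limit.
\<close>

lemma product_density_fourier_decay: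
  obtains B where "B > 0" "\<And>k0 \<xi>. \<xi> > 0 \<Longrightarrow> norm (fourier_of (product_density k0) \<xi>) \<le> B / (1 + \<xi>) ^ A"
proof -
  obtain B where B: "\<And>k0 K. controlled A B (partial_product k0 K)" using controlled_partial_product[of A] by blast
  have "norm (fourier_of (product_density k0) \<xi>) \<le> (\<bar>B\<bar> + 1) / (1 + \<xi>) ^ A" if "\<xi> > 0" for k0 \<xi>
  proof -
    have "AE x in lborel. x \<in> {-pi..pi} \<longrightarrow> (\<Sum>k. ennreal (norm (block (k0 + k) x - 1))) < \<infinity>"
      using AE_block_product_limit[of k0] unfolding circle_measure_def
      by (subst (asm) AE_restrict_space_iff) auto
    then have conv: "AE x in lborel. (\<lambda>K. partial_product k0 K x * window x * character \<xi> x)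
        \<longlonglongrightarrow> block_product k0 x * window x * character \<xi> x"
    proof eventually_elim
      case (elim x)
      show ?case
      proof (cases "\<bar>x\<bar> < 1")
        case True
        then have "x \<in> {-pi..pi}" using pi_gt3 by auto
        then have S: "(\<Sum>k. ennreal (norm (block (k0 + k) x - 1))) < \<infinity>" using elim by blast
        show ?thesis by (intro tendsto_mult tendsto_const block_product_limit(1)[OF S])
      next
        case False
        then show ?thesis using window_eq_0[of x] by simp
      qed
    qed
    have lim: "(\<lambda>K. \<integral>x. partial_product k0 K x * window x * character \<xi> x \<partial>lborel)
        \<longlonglongrightarrow> (\<integral>x. block_product k0 x * window x * character \<xi> x \<partial>lborel)"
    proof (rule integral_dominated_convergence[where w = "\<lambda>x. norm (window x)"])
      show "AE x in lborel. norm (partial_product k0 K x * window x * character \<xi> x) \<le> norm (window x)" for K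
        using mult_right_mono[OF norm_partial_product_le, of "norm (window _)" k0 K]
        by (intro AE_I2) (simp add: norm_mult)
    qed (use conv window_integrable in auto)
    have "norm (\<integral>x. partial_product k0 K x * window x * character \<xi> x \<partial>lborel) \<le> (\<bar>B\<bar> + 1) / (1 + \<xi>) ^ A" for K
    proof -
      have "norm (\<integral>x. partial_product k0 K x * window x * character \<xi> x \<partial>lborel) \<le> B / (1 + \<xi>) ^ A"
        using controlledD[OF B disc_functions_one, of k0 K \<xi>] that by (simp add: mult.assoc)
      also have "\<dots> \<le> (\<bar>B\<bar> + 1) / (1 + \<xi>) ^ A" using that by (intro divide_right_mono) auto
      finally show ?thesis .
    qed
    then have "norm (\<integral>x. block_product k0 x * window x * character \<xi> x \<partial>lborel) \<le> (\<bar>B\<bar> + 1) / (1 + \<xi>) ^ A"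
      by (intro LIMSEQ_le_const2[OF tendsto_norm[OF lim]]) auto
    then show ?thesis by (simp add: fourier_of_def product_density_def)
  qed
  then show ?thesis by (intro that[of "\<bar>B\<bar> + 1"]) auto
qed

text \<open>
  If the product vanished almost everywhere on \<open>(-1, 1)\<close>, its \<open>L^1\<close> distance to 1 there would be 2, but it is less than 1.
\<close>

lemma product_density_not_AE_0:
  assumes "(\<Sum>k. block_error (k0 + k)) < 1"
  shows "\<not> (AE x in lborel. product_density k0 x = 0)"
proof
  assume "AE x in lborel. product_density k0 x = 0"
  then have z: "AE x in lborel. x \<in> {-1<..<1} \<longrightarrow> block_product k0 x = 0"
    by eventually_elim (use window_neq_0 in \<open>auto simp: product_density_def abs_less_iff\<close>)
  have "AE x in lborel. x \<in> {-pi..pi} \<longrightarrow> (\<Sum>k. ennreal (norm (block (k0 + k) x - 1))) < \<infinity>"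
    using AE_block_product_limit[of k0] unfolding circle_measure_def
    by (subst (asm) AE_restrict_space_iff) auto
  with z have ae: "AE x in lborel. indicator {-1<..<1} x \<le> (\<Sum>k. ennreal (norm (block (k0 + k) x - 1))) * indicator {-pi..pi} x"
  proof eventually_elim
    case (elim x)
    show ?case
    proof (cases "x \<in> {-1<..<1}")
      case True
      then have x: "x \<in> {-pi..pi}" using pi_gt3 by auto
      then have S: "(\<Sum>k. ennreal (norm (block (k0 + k) x - 1))) < \<infinity>" using elim(2) by blast
      have b0: "block_product k0 x = 0" using elim(1) True by blast
      have le: "1 \<le> (\<Sum>k. ennreal (norm (block (k0 + k) x - 1)))"
        using block_product_limit(2)[OF S] unfolding b0
        by (simp only: diff_0 norm_minus_cancel norm_one ennreal_1)
      have "indicator {-1<..<1} x = (1::ennreal)" "indicator {-pi..pi} x = (1::ennreal)"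
        using True x by simp_all
      then show ?thesis using le by (simp only: mult_1_right)
    qed simp
  qed
  have "ennreal 2 = (\<integral>\<^sup>+x. indicator {-1<..<1::real} x \<partial>lborel)" by simp
  also have "\<dots> \<le> (\<integral>\<^sup>+x. (\<Sum>k. ennreal (norm (block (k0 + k) x - 1))) * indicator {-pi..pi} x \<partial>lborel)"
    by (rule nn_integral_mono_AE[OF ae])
  also have "\<dots> = (\<integral>\<^sup>+x. (\<Sum>k. ennreal (norm (block (k0 + k) x - 1))) \<partial>circle_measure)"
    unfolding circle_measure_def by (intro nn_integral_restrict_space[symmetric]) simp
  also have "\<dots> \<le> ennreal (\<Sum>k. block_error (k0 + k))" by (rule nn_integral_block_distance)
  also have "\<dots> < ennreal 2" using assms by (intro ennreal_lessI) auto
  finally show False by simp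
qed

lemma block_error_tail_small: obtains k0 where "k0 \<ge> 1" "(\<Sum>k. block_error (k0 + k)) < 1"
proof -
  have "\<forall>\<^sub>F k0 in sequentially. norm (\<Sum>k. block_error (k + k0)) < 1"
    using suminf_exist_split[OF zero_less_one summable_block_error] by (auto simp: eventually_sequentially)
  then have "\<forall>\<^sub>F k0 in sequentially. k0 \<ge> 1 \<and> norm (\<Sum>k. block_error (k + k0)) < 1"
    using eventually_ge_at_top[of 1] by eventually_elim auto
  then obtain k0 where "k0 \<ge> 1" "norm (\<Sum>k. block_error (k + k0)) < 1"
    by (auto simp: eventually_sequentially)
  then show ?thesis by (intro that[of k0]) (auto simp: add.commute)
qed

section \<open>The sieved set\<close>

definition sieved_set :: "nat \<Rightarrow> real set" where
  "sieved_set k0 = {x \<in> {-1..1}. \<forall>k\<ge>k0. \<forall>j\<in>{1..num_dilations k}. cos (real (dilation k j) * x) \<le> cos (arc_width k)}"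

lemma compact_sieved_set: "compact (sieved_set k0)"
proof -
  have "sieved_set k0 = {-1..1} \<inter> (\<Inter>k\<in>{k0..}. \<Inter>j\<in>{1..num_dilations k}. {x. cos (real (dilation k j) * x) \<le> cos (arc_width k)})"
    by (auto simp: sieved_set_def)
  moreover have "closed (\<Inter>k\<in>{k0..}. \<Inter>j\<in>{1..num_dilations k}. {x. cos (real (dilation k j) * x) \<le> cos (arc_width k)})"
    by (intro closed_INT ballI closed_Collect_le continuous_intros)
  ultimately show ?thesis by (simp add: compact_Int_closed)
qed

text \<open>
  The length is eight times the inverse width, so that the kernel is reduced by a factor \<open>1/4\<close> for each unit of
  its exponent on the sieved set. The exponent \<open>2 k^2\<close> makes this reduction stronger than the factor
  \<open>kernel_degree k\<close> lost in normalisation.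
\<close>

definition kernel_length :: "nat \<Rightarrow> nat" where "kernel_length k = 2 ^ (k\<^sup>2 + 3 * k + 3)"
definition kernel_degree :: "nat \<Rightarrow> nat" where "kernel_degree k = kernel_length k * (2 * k\<^sup>2)"

lemma kernel_small_on_sieved_set:
  assumes x: "x \<in> sieved_set k0" and k: "k \<ge> k0" "k \<ge> 1" and j: "j \<in> {1..num_dilations k}"
  shows "2 / (real (kernel_length k) * norm (1 - character (- real (dilation k j)) x)) \<le> 1 / 2"
    "character (- real (dilation k j)) x \<noteq> 1"
proof -
  define \<theta> where "\<theta> = real (dilation k j) * x"
  define \<delta> where "\<delta> = arc_width k"
  have \<delta>: "0 < \<delta>" "\<delta> \<le> 1" by (simp_all add: \<delta>_def arc_width_pos arc_width_le_1)
  have "cos \<theta> \<le> cos \<delta>" using x k j by (simp add: sieved_set_def \<theta>_def \<delta>_def)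
  moreover have "\<delta> * \<delta> / 8 \<le> 1 - cos \<delta>" using cos_diff_bounds(1)[OF \<delta>, of 0] \<delta> by simp
  moreover have "(norm (1 - cis \<theta>))\<^sup>2 = 2 - 2 * cos \<theta>"
  proof -
    have "(norm (1 - cis \<theta>))\<^sup>2 = (1 - cos \<theta>)\<^sup>2 + (sin \<theta>)\<^sup>2" by (simp add: cmod_power2)
    also have "\<dots> = 2 - 2 * cos \<theta>" using sin_cos_squared_add[of \<theta>] by (simp add: power2_eq_square algebra_simps)
    finally show ?thesis .
  qed
  ultimately have "(\<delta> / 2)\<^sup>2 \<le> (norm (1 - cis \<theta>))\<^sup>2" by (simp add: power2_eq_square)
  then have ge: "\<delta> / 2 \<le> norm (1 - cis \<theta>)" by (rule power2_le_imp_le) simp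
  have c: "character (- real (dilation k j)) x = cis \<theta>" by (simp add: character_eq_cis \<theta>_def)
  show "character (- real (dilation k j)) x \<noteq> 1" using ge \<delta> unfolding c by auto
  have "real (kernel_length k) * \<delta> = 8"
    by (simp add: kernel_length_def \<delta>_def arc_width_def power_add)
  then have "4 \<le> real (kernel_length k) * norm (1 - cis \<theta>)"
    using mult_left_mono[OF ge, of "real (kernel_length k)"] by simp
  then show "2 / (real (kernel_length k) * norm (1 - character (- real (dilation k j)) x)) \<le> 1 / 2"
    unfolding c by (simp add: divide_le_eq)
qed

text \<open>
  From \<open>l (Q + j) = l' (Q + j')\<close> it follows that \<open>(l - l') Q = l' j' - l j\<close>, whose right-hand side is smaller than \<open>Q\<close> in absolute value, so
  \<open>l = l'\<close>.
\<close>

lemma kernel_frequencies_distinct: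
  assumes "k \<ge> 1"
  shows "inj_on (\<lambda>(l, j). l * int (dilation k j)) (({- int (kernel_degree k)..int (kernel_degree k)} - {0}) \<times> {1..num_dilations k})"
proof (rule inj_onI)
  let ?D = "{- int (kernel_degree k)..int (kernel_degree k)}"
  fix x y
  assume xy: "x \<in> (?D - {0}) \<times> {1..num_dilations k}" "y \<in> (?D - {0}) \<times> {1..num_dilations k}"
    and eq': "(case x of (l, j) \<Rightarrow> l * int (dilation k j)) = (case y of (l, j) \<Rightarrow> l * int (dilation k j))"
  obtain l j l' j' where x: "x = (l, j)" and y: "y = (l', j')" by (cases x, cases y) blast
  have l: "l \<in> ?D" "l \<noteq> 0" and l': "l' \<in> ?D" "l' \<noteq> 0"
    and j: "j \<in> {1..num_dilations k}" "j' \<in> {1..num_dilations k}"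
    and eq: "l * int (dilation k j) = l' * int (dilation k j')"
    using xy eq' unfolding x y by auto
  define L M Q where "L = int (kernel_degree k)" and "M = int (num_dilations k)" and "Q = (2::int) ^ (12 * k\<^sup>2)"
  have Q: "int (dilation k i) = Q + int i" for i by (simp add: dilation_def Q_def)
  have "2 * (L * M) < Q"
  proof -
    have k2: "int (k\<^sup>2) \<le> 2 ^ k\<^sup>2" using less_exp[of "k\<^sup>2"] by (metis less_imp_le of_nat_le_iff of_nat_numeral of_nat_power)
    have "2 * (L * M) = 2 ^ (2 * k\<^sup>2 + 3 * k + 5) * int (k\<^sup>2)"
    proof -
      have "(2::int) ^ (2 + ((k\<^sup>2 + 3 * k + 3) + k\<^sup>2)) = 4 * (2 ^ (k\<^sup>2 + 3 * k + 3) * 2 ^ k\<^sup>2)"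
        unfolding power_add[of _ 2] power_add[of _ "k\<^sup>2 + 3 * k + 3"] by simp
      moreover have "2 + ((k\<^sup>2 + 3 * k + 3) + k\<^sup>2) = 2 * k\<^sup>2 + 3 * k + 5" by simp
      ultimately have "(2::int) ^ (2 * k\<^sup>2 + 3 * k + 5) = 4 * (2 ^ (k\<^sup>2 + 3 * k + 3) * 2 ^ k\<^sup>2)" by metis
      then show ?thesis
        by (simp only: L_def M_def kernel_degree_def kernel_length_def num_dilations_def) simp
    qed
    also have "\<dots> \<le> 2 ^ (2 * k\<^sup>2 + 3 * k + 5) * 2 ^ k\<^sup>2" using k2 by (intro mult_left_mono) auto
    also have "\<dots> = 2 ^ (3 * k\<^sup>2 + 3 * k + 5)" by (simp flip: power_add)
    also have "(2::int) ^ (3 * k\<^sup>2 + 3 * k + 5) < 2 ^ (12 * k\<^sup>2)"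
    proof (rule power_strict_increasing)
      have "k * 1 \<le> k * k" "1 * 1 \<le> k * k" using assms by (intro mult_le_mono; simp)+
      then show "3 * k\<^sup>2 + 3 * k + 5 < 12 * k\<^sup>2" unfolding power2_eq_square by linarith
    qed simp
    finally show ?thesis by (simp add: Q_def)
  qed
  have bnd: "\<bar>a * int i\<bar> \<le> L * M" if "a \<in> {- int (kernel_degree k)..int (kernel_degree k)}" "i \<in> {1..num_dilations k}" for a i
    unfolding abs_mult using that by (intro mult_mono) (auto simp: L_def M_def)
  have e: "(l - l') * Q = l' * int j' - l * int j" using eq by (simp add: Q algebra_simps)
  have "l = l'"
  proof (rule ccontr)
    assume "l \<noteq> l'"
    then have "1 * Q \<le> \<bar>l - l'\<bar> * Q" by (intro mult_right_mono) (auto simp: Q_def)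
    also have "\<dots> = \<bar>l' * int j' - l * int j\<bar>" unfolding e[symmetric] by (simp add: abs_mult Q_def)
    also have "\<dots> \<le> 2 * (L * M)" using bnd[OF l(1) j(1)] bnd[OF l'(1) j(2)] by linarith
    finally show False using \<open>2 * (L * M) < Q\<close> by simp
  qed
  moreover have "j = j'" using eq l(2) unfolding \<open>l = l'\<close> by (simp add: Q)
  ultimately show "x = y" by (simp add: x y)
qed

text \<open>
  The degree is \<open>2^(k^2 + O(k))\<close> and the number of dilations is \<open>2^(k^2)\<close>, so the last quantity is
  \<open>2^(- (2 - q) k^2 + O(k))\<close>. This is where \<open>q < 2\<close> enters.
\<close>

lemma kernel_parameter_limits:
  fixes q :: real
  assumes q: "1 \<le> q" "q < 2"
  defines "\<tau> \<equiv> \<lambda>k. (1 / 2) ^ k / real (kernel_degree k)"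
  shows "(\<lambda>k. real (kernel_degree k) * (1 / 4) ^ (2 * k\<^sup>2)) \<longlonglongrightarrow> 0"
    "(\<lambda>k. real (kernel_degree k) * \<tau> k) \<longlonglongrightarrow> 0"
    "(\<lambda>k. \<tau> k powr (1 - q) / real (num_dilations k)) \<longlonglongrightarrow> 0"
proof -
  have deg: "real (kernel_degree k) \<le> 2 powr ((real k)\<^sup>2 + 5 * real k + 4)" for k
  proof -
    have "real k \<le> 2 ^ k" using less_exp[of k] by (metis less_imp_le of_nat_le_iff of_nat_numeral of_nat_power)
    then have "(real k)\<^sup>2 \<le> (2 ^ k)\<^sup>2" by (intro power_mono) auto
    then have "real (kernel_degree k) \<le> 2 ^ (k\<^sup>2 + 3 * k + 3) * (2 * (2 ^ k)\<^sup>2)"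
      by (simp add: kernel_degree_def kernel_length_def)
    also have "\<dots> = 2 ^ (k\<^sup>2 + 5 * k + 4)"
    proof -
      have "(2::real) ^ ((k\<^sup>2 + 3 * k + 3) + (1 + k * 2)) = 2 ^ (k\<^sup>2 + 3 * k + 3) * (2 * (2 ^ k)\<^sup>2)"
        unfolding power_add[of _ "k\<^sup>2 + 3 * k + 3"] power_add[of _ 1] power_mult by simp
      moreover have "(k\<^sup>2 + 3 * k + 3) + (1 + k * 2) = k\<^sup>2 + 5 * k + 4" by simp
      ultimately show ?thesis by metis
    qed
    also have "\<dots> = 2 powr real (k\<^sup>2 + 5 * k + 4)" by (rule powr_realpow[symmetric]) simp
    finally show ?thesis by simp
  qed
  have num: "real (num_dilations k) = 2 powr (real k)\<^sup>2" for k
    using powr_realpow[of 2 "k\<^sup>2"] by (simp add: num_dilations_def)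
  have half: "(1 / 2) ^ k = 2 powr (- real k)" for k
    by (simp only: powr_minus powr_realpow[OF zero_less_numeral] power_one_over inverse_eq_divide)
  show "(\<lambda>k. real (kernel_degree k) * (1 / 4) ^ (2 * k\<^sup>2)) \<longlonglongrightarrow> 0"
  proof (rule tendsto_sandwich[OF _ _ tendsto_const])
    show "\<forall>\<^sub>F k in sequentially. real (kernel_degree k) * (1 / 4) ^ (2 * k\<^sup>2) \<le> 2 powr ((real k)\<^sup>2 + 5 * real k + 4) * 2 powr (- 4 * (real k)\<^sup>2)"
    proof (intro always_eventually allI)
      fix k :: nat
      have "(1 / 4) ^ (2 * k\<^sup>2) = (1 / 2 :: real) ^ (2 * (2 * k\<^sup>2))" by (subst power_mult) (simp add: power2_eq_square)
      also have "\<dots> = 2 powr (- 4 * (real k)\<^sup>2)" unfolding half by simp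
      finally have "(1 / 4) ^ (2 * k\<^sup>2) = 2 powr (- 4 * (real k)\<^sup>2)" .
      then show "real (kernel_degree k) * (1 / 4) ^ (2 * k\<^sup>2) \<le> 2 powr ((real k)\<^sup>2 + 5 * real k + 4) * 2 powr (- 4 * (real k)\<^sup>2)"
        using deg[of k] by (simp add: mult_right_mono)
    qed
    show "(\<lambda>k. 2 powr ((real k)\<^sup>2 + 5 * real k + 4) * 2 powr (- 4 * (real k)\<^sup>2)) \<longlonglongrightarrow> 0" by real_asymp
  qed auto
  show "(\<lambda>k. real (kernel_degree k) * \<tau> k) \<longlonglongrightarrow> 0"
  proof (rule tendsto_sandwich[OF _ _ tendsto_const])
    show "\<forall>\<^sub>F k in sequentially. real (kernel_degree k) * \<tau> k \<le> (1 / 2) ^ k"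
      by (intro always_eventually allI) (simp add: \<tau>_def)
    show "(\<lambda>k. (1 / 2 :: real) ^ k) \<longlonglongrightarrow> 0" by (intro LIMSEQ_realpow_zero) auto
  qed (auto simp: \<tau>_def)
  show "(\<lambda>k. \<tau> k powr (1 - q) / real (num_dilations k)) \<longlonglongrightarrow> 0"
  proof (rule tendsto_sandwich[OF _ _ tendsto_const])
    show "\<forall>\<^sub>F k in sequentially. \<tau> k powr (1 - q) / real (num_dilations k) \<le> 2 powr (6 * real k + 4 - (2 - q) * (real k)\<^sup>2)"
    proof (rule eventually_mono[OF eventually_ge_at_top[of 1]])
      fix k :: nat assume k: "k \<ge> 1"
      then have dpos: "real (kernel_degree k) > 0" by (simp add: kernel_degree_def kernel_length_def)
      have \<tau>pos: "\<tau> k > 0" using dpos by (simp add: \<tau>_def)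
      have "2 powr (- ((real k)\<^sup>2 + 6 * real k + 4)) = 2 powr (- real k) / 2 powr ((real k)\<^sup>2 + 5 * real k + 4)"
        unfolding powr_diff[symmetric] by (simp add: algebra_simps)
      also have "\<dots> \<le> \<tau> k" unfolding \<tau>_def half using deg[of k] dpos by (intro divide_left_mono) auto
      finally have "\<tau> k powr (1 - q) \<le> (2 powr (- ((real k)\<^sup>2 + 6 * real k + 4))) powr (1 - q)"
        using q by (intro powr_mono2') auto
      also have "\<dots> = 2 powr (((real k)\<^sup>2 + 6 * real k + 4) * (q - 1))"
      proof -
        have "- e * (1 - q) = e * (q - 1)" for e :: real by (simp add: algebra_simps)
        then show ?thesis by (simp only: powr_powr)
      qed
      finally have "\<tau> k powr (1 - q) / real (num_dilations k)
          \<le> 2 powr (((real k)\<^sup>2 + 6 * real k + 4) * (q - 1)) / 2 powr (real k)\<^sup>2"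
        unfolding num by (intro divide_right_mono) auto
      also have "\<dots> = 2 powr (((real k)\<^sup>2 + 6 * real k + 4) * (q - 1) - (real k)\<^sup>2)" by (simp add: powr_diff)
      also have "\<dots> \<le> 2 powr (6 * real k + 4 - (2 - q) * (real k)\<^sup>2)"
      proof (rule powr_mono)
        have "(6 * real k + 4) * (q - 1) \<le> (6 * real k + 4) * 1" using q by (intro mult_left_mono) auto
        then show "((real k)\<^sup>2 + 6 * real k + 4) * (q - 1) - (real k)\<^sup>2 \<le> 6 * real k + 4 - (2 - q) * (real k)\<^sup>2"
          by (simp add: algebra_simps)
      qed simp
      finally show "\<tau> k powr (1 - q) / real (num_dilations k) \<le> 2 powr (6 * real k + 4 - (2 - q) * (real k)\<^sup>2)" .
    qed
    have "(\<lambda>k. 2 powr (6 * real k + 4 - s * (real k)\<^sup>2)) \<longlonglongrightarrow> 0" if "s > 0" for s :: real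
      using that by real_asymp
    then show "(\<lambda>k. 2 powr (6 * real k + 4 - (2 - q) * (real k)\<^sup>2)) \<longlonglongrightarrow> 0"
      using q by simp
  qed auto
qed

lemma sieved_set_no_Lq_Fourier_transform:
  assumes k0: "k0 \<ge> 1" and mu: "\<mu> \<in> measures_on (sieved_set k0)" and nt: "nontrivial_measure \<mu>"
    and q: "0 < q" "q < 2"
  shows "(\<integral>\<^sup>+ \<xi>. ennreal (norm (fourier_transform \<mu> \<xi>) powr q) \<partial>lborel) = \<infinity>"
proof (rule ccontr)
  assume "\<not> ?thesis"
  then have fin: "(\<integral>\<^sup>+ \<xi>. ennreal (norm (fourier_transform \<mu> \<xi>) powr q) \<partial>lborel) < \<infinity>"
    by (simp add: top.not_eq_extremum)
  have cm: "complex_borel_measure \<mu>" using mu by (simp add: measures_on_def)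
  have E: "sieved_set k0 \<in> sets borel" by (rule borel_compact[OF compact_sieved_set])
  have [measurable]: "fourier_transform \<mu> \<in> borel_measurable borel"
    by (rule borel_measurable_continuous_onI[OF continuous_on_fourier_transform[OF cm]])
  obtain V where V: "V \<ge> 0" "\<And>f B. f \<in> borel_measurable borel \<Longrightarrow> (\<And>x. x \<in> sieved_set k0 \<Longrightarrow> norm (f x) \<le> B)
           \<Longrightarrow> norm (complex_measure_integral \<mu> f) \<le> V * B"
    using complex_measure_integral_bound[OF mu E] by blast
  \<comment> \<open>The transform is bounded, so integrability for \<open>q\<close> implies it for the larger exponent \<open>p \<ge> 1\<close>.\<close>
  define p where "p = max 1 q"
  have p: "1 \<le> p" "p < 2" "q \<le> p" using q by (auto simp: p_def)
  have "norm (fourier_transform \<mu> \<xi>) \<le> V" for \<xi>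
    using V(2)[of "character \<xi>" 1] by (simp add: fourier_transform_character)
  then have finp: "(\<integral>\<^sup>+ \<xi>. ennreal (norm (fourier_transform \<mu> \<xi>) powr p) \<partial>lborel) < \<infinity>"
    by (intro powr_integrable_larger_exponent[OF _ _ q(1) p(3) fin]) auto
  define good where "good k c \<longleftrightarrow> c 0 = 1 \<and> (\<forall>l. norm (c l) \<le> 1) \<and>
      (\<forall>z. norm z = 1 \<longrightarrow> z \<noteq> 1 \<longrightarrow> norm (\<Sum>l\<in>{- int (kernel_degree k)..int (kernel_degree k)}. c l * z powi l)
         \<le> real (kernel_degree k) * (2 / (real (kernel_length k) * norm (1 - z))) ^ (2 * (2 * k\<^sup>2)))"
    for k and c :: "int \<Rightarrow> complex"
  have "\<exists>c. good k c" if k: "k \<ge> 1" for k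
  proof -
    have nm: "kernel_length k \<ge> 1" "2 * k\<^sup>2 \<ge> 1" using k by (auto simp: kernel_length_def)
    obtain c :: "int \<Rightarrow> complex" where "c 0 = 1" "\<And>l. norm (c l) \<le> 1"
      "\<And>z. norm z = 1 \<Longrightarrow> z \<noteq> 1 \<Longrightarrow> norm (\<Sum>l\<in>{- int (kernel_length k * (2 * k\<^sup>2))..int (kernel_length k * (2 * k\<^sup>2))}. c l * z powi l)
         \<le> real (kernel_length k * (2 * k\<^sup>2)) * (2 / (real (kernel_length k) * norm (1 - z))) ^ (2 * (2 * k\<^sup>2))"
      using concentrated_trig_polynomial[OF nm] by blast
    then show ?thesis unfolding good_def kernel_degree_def by blast
  qed
  then obtain c where good: "\<And>k. k \<ge> 1 \<Longrightarrow> good k (c k)" by metis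
  have c: "c k 0 = 1" "norm (c k l) \<le> 1"
    "norm z = 1 \<Longrightarrow> z \<noteq> 1 \<Longrightarrow> norm (\<Sum>l\<in>{- int (kernel_degree k)..int (kernel_degree k)}. c k l * z powi l)
         \<le> real (kernel_degree k) * (2 / (real (kernel_length k) * norm (1 - z))) ^ (2 * (2 * k\<^sup>2))"
    if "k \<ge> 1" for k l z
    using good[OF that] unfolding good_def by blast+
  define \<tau> where "\<tau> k = (1 / 2) ^ k / real (kernel_degree k)" for k
  have lim: "(\<lambda>k. real (kernel_degree k) * (1 / 4) ^ (2 * k\<^sup>2)) \<longlonglongrightarrow> 0"
    "(\<lambda>k. real (kernel_degree k) * \<tau> k) \<longlonglongrightarrow> 0"
    "(\<lambda>k. \<tau> k powr (1 - p) / real (num_dilations k)) \<longlonglongrightarrow> 0"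
    using kernel_parameter_limits[OF p(1,2)] by (simp_all add: \<tau>_def)
  have "fourier_transform \<mu> t = 0" for t
  proof (rule fourier_transform_eq_0_criterion[OF mu E p(1) finp, where c = "\<lambda>k. c (k + k0)" and L = "\<lambda>k. kernel_degree (k + k0)"
        and J = "\<lambda>k. {1..num_dilations (k + k0)}" and N = "\<lambda>k. dilation (k + k0)"
        and \<epsilon> = "\<lambda>k. real (kernel_degree (k + k0)) * (1 / 4) ^ (2 * (k + k0)\<^sup>2)" and \<tau> = "\<lambda>k. \<tau> (k + k0)"])
    fix k l
    have k: "k + k0 \<ge> 1" using k0 by simp
    show "c (k + k0) 0 = 1" "norm (c (k + k0) l) \<le> 1" using c k by auto
    show "finite {1..num_dilations (k + k0)}" "{1..num_dilations (k + k0)} \<noteq> {}"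
      by (simp_all add: num_dilations_def)
    show "inj_on (\<lambda>(l, j). l * int (dilation (k + k0) j)) (({- int (kernel_degree (k + k0))..int (kernel_degree (k + k0))} - {0}) \<times> {1..num_dilations (k + k0)})"
      by (rule kernel_frequencies_distinct[OF k])
    show "\<tau> (k + k0) > 0" using k by (simp add: \<tau>_def kernel_degree_def kernel_length_def)
  next
    fix k x j
    assume x: "x \<in> sieved_set k0" and j: "j \<in> {1..num_dilations (k + k0)}"
    let ?k = "k + k0"
    have k: "?k \<ge> 1" "?k \<ge> k0" using k0 by simp_all
    let ?z = "character (- real (dilation ?k j)) x"
    have z: "2 / (real (kernel_length ?k) * norm (1 - ?z)) \<le> 1 / 2" "?z \<noteq> 1"
      using kernel_small_on_sieved_set[OF x k(2,1) j] by auto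
    have "character (- (real_of_int l * real (dilation ?k j))) x = ?z powi l" for l
      by (simp add: character_eq_cis cis_power_int mult_ac)
    then have "norm (\<Sum>l\<in>{- int (kernel_degree ?k)..int (kernel_degree ?k)}. c ?k l * character (- (real_of_int l * real (dilation ?k j))) x)
        = norm (\<Sum>l\<in>{- int (kernel_degree ?k)..int (kernel_degree ?k)}. c ?k l * ?z powi l)"
      by simp
    also have "\<dots> \<le> real (kernel_degree ?k) * (2 / (real (kernel_length ?k) * norm (1 - ?z))) ^ (2 * (2 * ?k\<^sup>2))"
      by (rule c(3)[OF k(1) norm_character z(2)])
    also have "\<dots> \<le> real (kernel_degree ?k) * (1 / 2) ^ (2 * (2 * ?k\<^sup>2))"
      using z(1) by (intro mult_left_mono power_mono) auto
    also have "(1 / 2 :: real) ^ (2 * (2 * ?k\<^sup>2)) = (1 / 4) ^ (2 * ?k\<^sup>2)"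
      by (subst power_mult) (simp add: power2_eq_square)
    finally show "norm (\<Sum>l\<in>{- int (kernel_degree ?k)..int (kernel_degree ?k)}. c ?k l * character (- (real_of_int l * real (dilation ?k j))) x)
        \<le> real (kernel_degree ?k) * (1 / 4) ^ (2 * ?k\<^sup>2)" .
  next
    show "(\<lambda>k. real (kernel_degree (k + k0)) * (1 / 4) ^ (2 * (k + k0)\<^sup>2)) \<longlonglongrightarrow> 0"
      using LIMSEQ_ignore_initial_segment[OF lim(1), of k0] .
    show "(\<lambda>k. real (kernel_degree (k + k0)) * \<tau> (k + k0)) \<longlonglongrightarrow> 0"
      using LIMSEQ_ignore_initial_segment[OF lim(2), of k0] .
    show "(\<lambda>k. \<tau> (k + k0) powr (1 - p) / real (card {1..num_dilations (k + k0)})) \<longlonglongrightarrow> 0"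
      using LIMSEQ_ignore_initial_segment[OF lim(3), of k0] by simp
  qed
  then have "\<mu> A = 0" if "A \<in> sets borel" for A
    using complex_measure_eq_0_if_fourier_eq_0[OF cm _ that] by blast
  then show False using nt by (auto simp: nontrivial_measure_def)
qed

theorem theorem5p1:
  shows "\<exists>E :: real set. compact E \<and> emeasure lborel E > 0 \<and>
    (\<forall>\<mu> \<in> measures_on E. nontrivial_measure \<mu> \<longrightarrow>
       (\<forall>q :: real. 0 < q \<and> q < 2 \<longrightarrow>
          (\<integral>\<^sup>+ \<xi>. ennreal (norm (fourier_transform \<mu> \<xi>) powr q) \<partial>lborel) = \<infinity>)) \<and>
    (\<exists>\<nu> \<in> measures_on E. nontrivial_measure \<nu> \<and>
       (\<forall>A :: real. A > 0 \<longrightarrow> (\<exists>C :: real. C > 0 \<and>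
          (\<forall>\<xi> :: real. \<xi> > 0 \<longrightarrow> norm (fourier_transform \<nu> \<xi>) \<le> C * \<xi> powr (- A)))))"
proof -
  obtain k0 where k0: "k0 \<ge> 1" "(\<Sum>k. block_error (k0 + k)) < 1" by (rule block_error_tail_small)
  define f where "f = product_density k0"
  define E where "E = sieved_set k0"
  have f: "integrable lborel f" unfolding f_def by (rule product_density_integrable)
  have fE: "f x = 0" if xE: "x \<notin> E" for x
  proof (cases "x \<in> {-1..1}")
    case True
    with xE have "\<exists>k\<ge>k0. \<exists>j\<in>{1..num_dilations k}. cos (real (dilation k j) * x) > cos (arc_width k)"
      by (simp add: E_def sieved_set_def not_le)
    then obtain k j where "k \<ge> k0" "j \<in> {1..num_dilations k}" "cos (real (dilation k j) * x) > cos (arc_width k)"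
      by blast
    then show ?thesis using block_product_eq_0 by (simp add: f_def product_density_def)
  next
    case False
    then show ?thesis using window_eq_0[of x] by (auto simp: f_def product_density_def)
  qed
  have ne: "\<not> (AE x in lborel. f x = 0)" unfolding f_def by (rule product_density_not_AE_0[OF k0(2)])
  have Eb: "E \<in> sets borel" unfolding E_def by (rule borel_compact[OF compact_sieved_set])
  have decay: "\<exists>C>0. \<forall>\<xi>>0. norm (fourier_transform (density_measure f) \<xi>) \<le> C * \<xi> powr (- A)" if A: "A > 0" for A
  proof -
    obtain B where B: "B > 0" "\<And>k0 \<xi>. \<xi> > 0 \<Longrightarrow> norm (fourier_of (product_density k0) \<xi>) \<le> B / (1 + \<xi>) ^ nat \<lceil>A\<rceil>"
      using product_density_fourier_decay[of "nat \<lceil>A\<rceil>"] by blast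
    have "norm (fourier_transform (density_measure f) \<xi>) \<le> B * \<xi> powr (- A)" if \<xi>: "\<xi> > 0" for \<xi>
    proof -
      have "\<xi> powr A \<le> (1 + \<xi>) powr A" using \<xi> A by (intro powr_mono2) auto
      also have "\<dots> \<le> (1 + \<xi>) powr real (nat \<lceil>A\<rceil>)" using \<xi> A by (intro powr_mono) auto
      also have "\<dots> = (1 + \<xi>) ^ nat \<lceil>A\<rceil>" using \<xi> by (intro powr_realpow) auto
      finally have le: "\<xi> powr A \<le> (1 + \<xi>) ^ nat \<lceil>A\<rceil>" .
      have "fourier_transform (density_measure f) \<xi> = fourier_of f \<xi>"
        by (simp only: fourier_of_def fourier_transform_density_measure[OF f])
      then have "norm (fourier_transform (density_measure f) \<xi>) = norm (fourier_of (product_density k0) \<xi>)"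
        by (simp only: f_def)
      also have "\<dots> \<le> B / (1 + \<xi>) ^ nat \<lceil>A\<rceil>" by (rule B(2)[OF \<xi>])
      also have "\<dots> \<le> B / \<xi> powr A" using le B(1) \<xi> by (intro divide_left_mono) auto
      finally show ?thesis by (simp add: powr_minus divide_inverse)
    qed
    then show ?thesis using B(1) by blast
  qed
  show ?thesis
  proof (intro exI[of _ E] conjI ballI impI allI)
    show "compact E" unfolding E_def by (rule compact_sieved_set)
    show "emeasure lborel E > 0" by (rule emeasure_pos_if_density[OF ne Eb fE])
    show "(\<integral>\<^sup>+ \<xi>. ennreal (norm (fourier_transform \<mu> \<xi>) powr q) \<partial>lborel) = \<infinity>"
      if "\<mu> \<in> measures_on E" "nontrivial_measure \<mu>" "0 < q \<and> q < 2" for \<mu> q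
      using sieved_set_no_Lq_Fourier_transform[OF k0(1)] that by (simp add: E_def)
    show "\<exists>\<nu>\<in>measures_on E. nontrivial_measure \<nu> \<and>
       (\<forall>A>0. \<exists>C>0. \<forall>\<xi>>0. norm (fourier_transform \<nu> \<xi>) \<le> C * \<xi> powr - A)"
    proof (intro bexI[of _ "density_measure f"] conjI)
      show "density_measure f \<in> measures_on E" by (rule density_measure_on[OF f fE])
      show "nontrivial_measure (density_measure f)" by (rule nontrivial_density_measure[OF f ne])
    qed (use decay in blast)
  qed
qed

end
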